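(* Let $u_0\in H^s(\mathbb{R})\cap BV(\mathbb{R})$ with $s\geqslant3$. For $\ell>0$ let $u^\ell$ be the dissipative solution, constructed as in the context, of the regularised Burgers equation $u_t+uu_x+\ell^2P_x=0$ with initial datum $u_0$. Let $u$ be a limit of a subsequence of $u^\ell$ as $\ell\to+\infty$ and $\nu$ the associated measure, as described in the context, so that $[u_t+\tfrac12(u^2)_x]_x=\nu$. Then for $t<1/\sup_x|u_0'(x)|$ we have $$\nu=\tfrac12\,u_x^2 .$$
   Context: $\mathcal{M}^1(\mathbb{R})$ is the space of finite Radon measures on $\mathbb{R}$; $BV(\mathbb{R})$ is understood as functions with finite total variation on $\mathbb{R}$. In the equation, $P=\mathfrak{G}\ast\tfrac12u_x^2$ with $\mathfrak{G}(x)=(2\ell)^{-1}e^{-|x|/\ell}$. Limit and measure. It is known that there are a function $u$ with $u\in L^\infty([0,T],BV(\mathbb{R}))$ for all $T>0$, a measure $0\leqslant\nu\in L^\infty([0,+\infty[,\mathcal{M}^1(\mathbb{R}))$ and a subsequence $\ell\to+\infty$ along which $u^\ell\to u$ in $\mathcal{C}([0,T],L^1(\mathcal{I}))$ for all $T>0$ and bounded intervals $\mathcal{I}$, and $\tfrac12(u^\ell_x)^2\to\nu$ weakly (as measures); then $[u_t+\tfrac12(u^2)_x]_x=\nu$ in the sense of distributions. Construction of the dissipative solution $u^\ell$. Define $y_0(\xi)$, $\xi\in\mathbb{R}$, by $\int_0^{y_0(\xi)}(1+u_0'(x)^2)\,\mathrm{d}x=\xi$. Let $(v,q)$, with $(v,q)\in\mathcal{C}([0,T],L^\infty(\mathbb{R},\mathbb{R}^2))$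 for every $T>0$, be the global solution of $$v_t=\begin{cases}-P(1+\cos v)-\sin^2(v/2),&v>-\pi,\\0,&v\leqslant-\pi,\end{cases}\qquad q_t=\begin{cases}q(\tfrac12-P)\sin v,&v>-\pi,\\0,&v\leqslant-\pi,\end{cases}$$ with $v(0,\xi)=2\arctan(u_0'(y_0(\xi)))$, $q(0,\xi)=1$, where, with $\bar q=q$ if $v>-\pi$ and $\bar q=0$ if $v\leqslant-\pi$, and $k(t,\xi,\xi')=\exp\{-\tfrac1\ell|\int_\xi^{\xi'}\bar q(t,s)\cos^2\tfrac{v(t,s)}2\,\mathrm{d}s|\}$, $$P(t,\xi)=\frac1{4\ell}\int_{\mathbb{R}}k(t,\xi,\xi')\,\bar q(t,\xi')\sin^2\tfrac{v(t,\xi')}2\,\mathrm{d}\xi',$$ $$P_x(t,\xi)=\frac1{4\ell^2}\Big(\int_\xi^{+\infty}-\int_{-\infty}^\xi\Big)k(t,\xi,\xi')\,\bar q(t,\xi')\sin^2\tfrac{v(t,\xi')}2\,\mathrm{d}\xi'.$$ Let $u(t,\xi)=u_0(y_0(\xi))-\int_0^t\ell^2P_x(s,\xi)\,\mathrm{d}s$ and $y(t,\xi)=y_0(\xi)+\int_0^tu(s,\xi)\,\mathrm{d}s$. Then $u^\ell$ is defined by $u^\ell(t,x)=u(t,\xi)$ whenever $x=y(t,\xi)$. It is known that this is well defined and gives a global weak solution with $u^\ell(0,\cdot)=u_0$ satisfying $[\tfrac12u^2+\tfrac12\ell^2u_x^2]_t+[\tfrac13u^3+\ell^2uP+\tfrac12\ell^2uu_x^2]_x\leqslant0$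 in the sense of distributions and $u^\ell_x\leqslant2/t$. If $u_0=0$, $1/\sup_x|u_0'|$ is read as $+\infty$. *)

theory Defs
  imports "HOL-Analysis.Analysis"
begin

text \<open>
  Conventions.  Elements of Lebesgue spaces are given by Borel representatives; space-time
  functions are curried, the time variable first, and only their values at times \<open>t \<ge> 0\<close> matter.
\<close>

section \<open>Test functions\<close>

definition compactly_supported :: "('a::topological_space \<Rightarrow> real) \<Rightarrow> bool" where
  "compactly_supported \<phi> \<longleftrightarrow> compact (closure {z. \<phi> z \<noteq> 0})"

definition smooth :: "(real \<Rightarrow> real) \<Rightarrow> bool" where
  "smooth \<phi> \<longleftrightarrow> (\<forall>n x. ((deriv ^^ n) \<phi>) field_differentiable (at x))"

definition test_function :: "(real \<Rightarrow> real) \<Rightarrow> bool" where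
  "test_function \<phi> \<longleftrightarrow> smooth \<phi> \<and> compactly_supported \<phi>"

definition schwartz :: "(real \<Rightarrow> real) \<Rightarrow> bool" where
  "schwartz \<phi> \<longleftrightarrow> smooth \<phi> \<and> (\<forall>m n. \<exists>C. \<forall>x. \<bar>x\<bar> ^ m * \<bar>(deriv ^^ n) \<phi> x\<bar> \<le> C)"

definition Dt :: "(real \<times> real \<Rightarrow> real) \<Rightarrow> real \<times> real \<Rightarrow> real" where
  "Dt \<phi> = (\<lambda>(t, x). deriv (\<lambda>s. \<phi> (s, x)) t)"

definition Dx :: "(real \<times> real \<Rightarrow> real) \<Rightarrow> real \<times> real \<Rightarrow> real" where
  "Dx \<phi> = (\<lambda>(t, x). deriv (\<lambda>y. \<phi> (t, y)) x)"

text \<open>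
  By Schwarz's theorem it is enough to consider the mixed derivatives in which all
  \<open>x\<close>-derivatives are taken first.
\<close>
definition smooth2 :: "(real \<times> real \<Rightarrow> real) \<Rightarrow> bool" where
  "smooth2 \<phi> \<longleftrightarrow> (\<forall>i j. let \<psi> = (Dt ^^ i) ((Dx ^^ j) \<phi>) in
     continuous_on UNIV \<psi> \<and>
     (\<forall>t x. (\<lambda>s. \<psi> (s, x)) field_differentiable (at t) \<and>
            (\<lambda>y. \<psi> (t, y)) field_differentiable (at x)))"

definition test_function2 :: "(real \<times> real \<Rightarrow> real) \<Rightarrow> bool" where
  "test_function2 \<phi> \<longleftrightarrow> smooth2 \<phi> \<and> compactly_supported \<phi> \<and>
     closure {z. \<phi> z \<noteq> 0} \<subseteq> {0<..} \<times> UNIV"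


section \<open>Function spaces\<close>

text \<open>
  The second conjunct says that \<open>g\<close> is the Fourier transform of \<open>f\<close>
  as a tempered distribution.  Real-valued Schwartz functions suffice by linearity.
\<close>
definition fourier_transform_of :: "(real \<Rightarrow> real) \<Rightarrow> (real \<Rightarrow> complex) \<Rightarrow> bool" where
  "fourier_transform_of f g \<longleftrightarrow> g \<in> borel_measurable borel \<and>
     (\<forall>\<phi>. schwartz \<phi> \<longrightarrow>
        (LBINT \<omega>. g \<omega> * complex_of_real (\<phi> \<omega>)) =
        (LBINT x. complex_of_real (f x) * (LBINT \<omega>. cis (- (x * \<omega>)) * complex_of_real (\<phi> \<omega>))))"

text \<open>The Sobolev space \<open>H\<^sup>s(\<real>)\<close> for real \<open>s \<ge> 0\<close>.\<close>
definition sobolev_H :: "real \<Rightarrow> (real \<Rightarrow> real) set" where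
  "sobolev_H s = {f. f \<in> borel_measurable borel \<and> integrable lborel (\<lambda>x. (f x)\<^sup>2) \<and>
     (\<exists>g. fourier_transform_of f g \<and>
          integrable lborel (\<lambda>\<omega>. (1 + \<omega>\<^sup>2) powr s * (cmod (g \<omega>))\<^sup>2))}"

definition total_variation :: "(real \<Rightarrow> real) \<Rightarrow> ennreal" where
  "total_variation f =
     (SUP xs\<in>{xs. sorted xs}. \<Sum>i<length xs - 1. ennreal \<bar>f (xs ! Suc i) - f (xs ! i)\<bar>)"

definition BV :: "(real \<Rightarrow> real) set" where
  "BV = {f. total_variation f < \<infinity>}"

text \<open>\<open>u \<in> L\<^sup>\<infinity>([0,T], BV(\<real>))\<close> for all \<open>T\<close>; variation is that of a good representative.\<close>
definition Linf_BV :: "(real \<Rightarrow> real \<Rightarrow> real) \<Rightarrow> bool" where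
  "Linf_BV u \<longleftrightarrow> (\<forall>T>0. \<exists>C::real. AE t in lborel. t \<in> {0..T} \<longrightarrow>
     (\<exists>g. (AE x in lborel. g x = u t x) \<and> total_variation g \<le> ennreal C))"

definition locally_integrable :: "(real \<Rightarrow> real) \<Rightarrow> bool" where
  "locally_integrable f \<longleftrightarrow> (\<forall>a b. set_integrable lborel {a..b} f)"

text \<open>Weak (distributional) derivative on \<open>\<real>\<close>; it is unique up to null sets.\<close>
definition has_weak_derivative :: "(real \<Rightarrow> real) \<Rightarrow> (real \<Rightarrow> real) \<Rightarrow> bool" where
  "has_weak_derivative f g \<longleftrightarrow>
     f \<in> borel_measurable borel \<and> g \<in> borel_measurable borel \<and>
     locally_integrable f \<and> locally_integrable g \<and>
     (\<forall>\<phi>. test_function \<phi> \<longrightarrow> (LBINT x. f x * deriv \<phi> x) = - (LBINT x. g x * \<phi> x))"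

text \<open>\<open>u \<in> C([0,T], L\<^sup>1(I))\<close> for all \<open>T > 0\<close> and all bounded intervals \<open>I\<close>.\<close>
definition C_L1loc :: "(real \<Rightarrow> real \<Rightarrow> real) \<Rightarrow> bool" where
  "C_L1loc u \<longleftrightarrow> (\<forall>t\<ge>0. u t \<in> borel_measurable borel \<and> locally_integrable (u t) \<and>
     (\<forall>a b. ((\<lambda>s. LBINT x:{a..b}. \<bar>u s x - u t x\<bar>) \<longlongrightarrow> 0) (at t within {0..})))"

definition converges_C_L1loc ::
    "(nat \<Rightarrow> real \<Rightarrow> real \<Rightarrow> real) \<Rightarrow> (real \<Rightarrow> real \<Rightarrow> real) \<Rightarrow> bool" where
  "converges_C_L1loc w u \<longleftrightarrow> (\<forall>k. C_L1loc (w k)) \<and> C_L1loc u \<and>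
     (\<forall>T>0. \<forall>a b.
        uniform_limit {0..T} (\<lambda>k t. LBINT x:{a..b}. \<bar>w k t x - u t x\<bar>) (\<lambda>t. 0) sequentially)"

text \<open>
  Nonnegative elements of \<open>L\<^sup>\<infinity>([0,\<infinity>), M\<^sup>1(\<real>))\<close>, as weakly-* measurable, essentially bounded
  families of Borel measures.  Finite Borel measures on \<open>\<real>\<close> are automatically Radon.
\<close>
definition Linf_measure :: "(real \<Rightarrow> real measure) \<Rightarrow> bool" where
  "Linf_measure \<nu> \<longleftrightarrow>
     (\<forall>t\<ge>0. sets (\<nu> t) = sets borel) \<and>
     (\<exists>C::real. AE t in lborel. t \<ge> 0 \<longrightarrow> emeasure (\<nu> t) UNIV \<le> ennreal C) \<and>
     (\<forall>\<phi>. continuous_on UNIV \<phi> \<and> compactly_supported \<phi> \<longrightarrow>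
        (\<lambda>t. \<integral>x. \<phi> x \<partial>(\<nu> t)) \<in> borel_measurable (restrict_space borel {0..}))"

text \<open>
  Weak convergence of \<open>f k t x dt dx\<close> to \<open>\<nu> t (dx) dt\<close> as measures on \<open>[0,\<infinity>) \<times> \<real>\<close>.  Test
  functions are defined on the whole plane and need not vanish at \<open>t = 0\<close>.
\<close>
definition converges_weakly_measure ::
    "(nat \<Rightarrow> real \<Rightarrow> real \<Rightarrow> real) \<Rightarrow> (real \<Rightarrow> real measure) \<Rightarrow> bool" where
  "converges_weakly_measure f \<nu> \<longleftrightarrow>
     (\<forall>\<phi>::real \<times> real \<Rightarrow> real. continuous_on UNIV \<phi> \<and> compactly_supported \<phi> \<longrightarrow>
        (\<lambda>k. LBINT t:{0..}. (LBINT x. \<phi> (t, x) * f k t x))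
          \<longlonglongrightarrow> (LBINT t:{0..}. (\<integral>x. \<phi> (t, x) \<partial>(\<nu> t))))"

text \<open>\<open>[u\<^sub>t + (u\<^sup>2/2)\<^sub>x]\<^sub>x = \<nu>\<close> in the sense of distributions on \<open>(0,\<infinity>) \<times> \<real>\<close>.\<close>
definition burgers_x_equation :: "(real \<Rightarrow> real \<Rightarrow> real) \<Rightarrow> (real \<Rightarrow> real measure) \<Rightarrow> bool" where
  "burgers_x_equation u \<nu> \<longleftrightarrow> (\<forall>\<phi>. test_function2 \<phi> \<longrightarrow>
     (LBINT t:{0..}. (LBINT x. u t x * Dt (Dx \<phi>) (t, x) + (u t x)\<^sup>2 / 2 * Dx (Dx \<phi>) (t, x))) =
     (LBINT t:{0..}. (\<integral>x. \<phi> (t, x) \<partial>(\<nu> t))))"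


section \<open>The dissipative solution of the regularised Burgers equation\<close>

text \<open>In this block \<open>v\<close> and \<open>q\<close> are the Lagrangian unknowns at one fixed time.\<close>

definition qbar :: "(real \<Rightarrow> real) \<Rightarrow> (real \<Rightarrow> real) \<Rightarrow> real \<Rightarrow> real" where
  "qbar v q \<xi> = (if v \<xi> > - pi then q \<xi> else 0)"

definition kern :: "real \<Rightarrow> (real \<Rightarrow> real) \<Rightarrow> (real \<Rightarrow> real) \<Rightarrow> real \<Rightarrow> real \<Rightarrow> real" where
  "kern l v q \<xi> \<xi>' =
     exp (- (1 / l) * \<bar>LBINT s=ereal \<xi>..ereal \<xi>'. qbar v q s * (cos (v s / 2))\<^sup>2\<bar>)"

definition P_integrand :: "real \<Rightarrow> (real \<Rightarrow> real) \<Rightarrow> (real \<Rightarrow> real) \<Rightarrow> real \<Rightarrow> real \<Rightarrow> real" where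
  "P_integrand l v q \<xi> \<xi>' = kern l v q \<xi> \<xi>' * qbar v q \<xi>' * (sin (v \<xi>' / 2))\<^sup>2"

definition P_lag :: "real \<Rightarrow> (real \<Rightarrow> real) \<Rightarrow> (real \<Rightarrow> real) \<Rightarrow> real \<Rightarrow> real" where
  "P_lag l v q \<xi> = 1 / (4 * l) * (LBINT \<xi>'. P_integrand l v q \<xi> \<xi>')"

definition Px_lag :: "real \<Rightarrow> (real \<Rightarrow> real) \<Rightarrow> (real \<Rightarrow> real) \<Rightarrow> real \<Rightarrow> real" where
  "Px_lag l v q \<xi> = 1 / (4 * l\<^sup>2) *
     ((LBINT \<xi>':{\<xi>..}. P_integrand l v q \<xi> \<xi>') - (LBINT \<xi>':{..\<xi>}. P_integrand l v q \<xi> \<xi>'))"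

definition v_rhs :: "real \<Rightarrow> (real \<Rightarrow> real) \<Rightarrow> (real \<Rightarrow> real) \<Rightarrow> real \<Rightarrow> real" where
  "v_rhs l v q \<xi> =
     (if v \<xi> > - pi then - P_lag l v q \<xi> * (1 + cos (v \<xi>)) - (sin (v \<xi> / 2))\<^sup>2 else 0)"

definition q_rhs :: "real \<Rightarrow> (real \<Rightarrow> real) \<Rightarrow> (real \<Rightarrow> real) \<Rightarrow> real \<Rightarrow> real" where
  "q_rhs l v q \<xi> = (if v \<xi> > - pi then q \<xi> * (1 / 2 - P_lag l v q \<xi>) * sin (v \<xi>) else 0)"

text \<open>\<open>w \<in> C([0,T], L\<^sup>\<infinity>(\<real>))\<close> for all \<open>T > 0\<close>.\<close>
definition C_Linf :: "(real \<Rightarrow> real \<Rightarrow> real) \<Rightarrow> bool" where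
  "C_Linf w \<longleftrightarrow> (\<forall>t\<ge>0. w t \<in> borel_measurable borel \<and>
     (\<exists>C. AE \<xi> in lborel. \<bar>w t \<xi>\<bar> \<le> C) \<and>
     (\<forall>\<epsilon>>0. \<exists>\<delta>>0. \<forall>s\<ge>0. \<bar>s - t\<bar> < \<delta> \<longrightarrow> (AE \<xi> in lborel. \<bar>w s \<xi> - w t \<xi>\<bar> \<le> \<epsilon>)))"

definition initial_label :: "(real \<Rightarrow> real) \<Rightarrow> (real \<Rightarrow> real) \<Rightarrow> bool" where
  "initial_label u0 y0 \<longleftrightarrow>
     (\<forall>\<xi>. (LBINT x=ereal 0..ereal (y0 \<xi>). 1 + (deriv u0 x)\<^sup>2) = \<xi>)"

text \<open>
  The right-hand sides jump at \<open>v = -\<pi>\<close>, so the system is understood in integrated form.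
  Integrability of the integrand of \<open>P\<close> makes sure that \<open>P\<close> is not a default value.
\<close>
definition lagrangian_solution ::
    "real \<Rightarrow> (real \<Rightarrow> real) \<Rightarrow> (real \<Rightarrow> real) \<Rightarrow>
     (real \<Rightarrow> real \<Rightarrow> real) \<Rightarrow> (real \<Rightarrow> real \<Rightarrow> real) \<Rightarrow> bool" where
  "lagrangian_solution l u0 y0 v q \<longleftrightarrow>
     C_Linf v \<and> C_Linf q \<and>
     (AE \<xi> in lborel. v 0 \<xi> = 2 * arctan (deriv u0 (y0 \<xi>)) \<and> q 0 \<xi> = 1) \<and>
     (\<forall>t\<ge>0. \<forall>\<xi>. integrable lborel (P_integrand l (v t) (q t) \<xi>)) \<and>
     (AE \<xi> in lborel. \<forall>t\<ge>0.
        ((\<lambda>s. v_rhs l (v s) (q s) \<xi>) has_integral (v t \<xi> - v 0 \<xi>)) {0..t} \<and>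
        ((\<lambda>s. q_rhs l (v s) (q s) \<xi>) has_integral (q t \<xi> - q 0 \<xi>)) {0..t})"

definition u_lag ::
    "real \<Rightarrow> (real \<Rightarrow> real) \<Rightarrow> (real \<Rightarrow> real) \<Rightarrow>
     (real \<Rightarrow> real \<Rightarrow> real) \<Rightarrow> (real \<Rightarrow> real \<Rightarrow> real) \<Rightarrow> real \<Rightarrow> real \<Rightarrow> real" where
  "u_lag l u0 y0 v q t \<xi> =
     u0 (y0 \<xi>) - (LBINT s=ereal 0..ereal t. l\<^sup>2 * Px_lag l (v s) (q s) \<xi>)"

definition y_lag ::
    "real \<Rightarrow> (real \<Rightarrow> real) \<Rightarrow> (real \<Rightarrow> real) \<Rightarrow>
     (real \<Rightarrow> real \<Rightarrow> real) \<Rightarrow> (real \<Rightarrow> real \<Rightarrow> real) \<Rightarrow> real \<Rightarrow> real \<Rightarrow> real" where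
  "y_lag l u0 y0 v q t \<xi> =
     y0 \<xi> + (LBINT s=ereal 0..ereal t. u_lag l u0 y0 v q s \<xi>)"

definition dissipative_solution ::
    "real \<Rightarrow> (real \<Rightarrow> real) \<Rightarrow> (real \<Rightarrow> real \<Rightarrow> real) \<Rightarrow> bool" where
  "dissipative_solution l u0 w \<longleftrightarrow> (\<exists>y0 v q.
     initial_label u0 y0 \<and> lagrangian_solution l u0 y0 v q \<and>
     (\<forall>t\<ge>0. \<forall>\<xi>. w t (y_lag l u0 y0 v q t \<xi>) = u_lag l u0 y0 v q t \<xi>))"

end

theory Submission
  imports Defs "HOL-Probability.Probability"
begin

text \<open>
  Before the time \<open>1 / sup \<bar>u0'\<bar>\<close> the convergence of the solutions is strong.  In Lagrangian coordinates
  \<open>v = 2 arctan u\<^sub>x\<close>, and \<open>P\<close> is a perturbation of size \<open>1 / l\<close> of the Riccati equation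
  \<open>v\<^sub>t = - sin\<^sup>2 (v / 2)\<close>: a bootstrap argument keeps \<open>v\<close> away from \<open>- \<pi>\<close> and \<open>q\<close> away from \<open>0\<close> and
  \<open>\<infinity>\<close> on \<open>[0, T]\<close> when \<open>T sup \<bar>u0'\<bar> < 1\<close> and \<open>l\<close> is large.  Since \<open>u0'\<close> is Lipschitz (\<open>u0 \<in> H\<^sup>3\<close>) and \<open>P\<close>
  is Lipschitz in the label, so are \<open>v\<close> and \<open>q\<close>, uniformly in \<open>l\<close>.  Hence the derivatives \<open>u\<^sup>l\<^sub>x = tan (v / 2)\<close>
  are bounded and Lipschitz in \<open>x\<close>, uniformly in \<open>l\<close> and \<open>t \<in> [0, T]\<close>.  Together with the convergence
  \<open>u\<^sup>l \<rightarrow> u\<close> in \<open>L\<^sup>1\<^sub>l\<^sub>o\<^sub>c\<close> this gives \<open>u\<^sup>l\<^sub>x \<rightarrow> u\<^sub>x\<close> pointwise, so that \<open>(u\<^sup>l\<^sub>x)\<^sup>2 / 2\<close> can only converge to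
  \<open>u\<^sub>x\<^sup>2 / 2\<close>.
\<close>

section \<open>Gronwall inequalities and total variation\<close>

text \<open>Along a label, W = tan (v / 2) for the unperturbed equation solves W' = - W^2 / 2 and
  breaks no earlier than time 2 / sup |u0'|. Up to 1 / sup |u0'| the denominator of W stays at least
  1/2, and this room absorbs the perturbation. The obstacle is that P is nonlocal. Its prefactor 1 /
  l is cancelled by the mass of the kernel, which is of order l: an integrable energy contributes
  O(1 / l), but a uniform deviation of \<open>v\<close> gains no factor 1 / l. It enters through
  sin^2, hence quadratically, and this lets the bootstrap close. The integrable part is paid for by
  the bounded variation of \<open>u0\<close>. A second obstacle is that the equations hold for
  almost every label, and that the null sets in the L^infinity continuity depend on the times, while
  derivatives in the label are needed. P is Lipschitz in the label even for merely measurable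
  \<open>v\<close> and \<open>q\<close> within the bounds, and passes this regularity on to them.
  Finally \<nu> is accessible only through test functions, so that for almost every time a countable
  family of them has to determine it.\<close>

lemma gronwall:
  fixes z :: "real \<Rightarrow> real"
  assumes cont: "continuous_on {0..T} z" and L: "L \<ge> 0"
    and le: "\<And>t. t \<in> {0..T} \<Longrightarrow> z t \<le> A + L * integral {0..t} z"
    and t: "t \<in> {0..T}"
  shows "z t \<le> A * exp (L * t)"
proof -
  define h where "h r = (A + L * integral {0..r} z) * exp (- (L * r))" for r
  have "h t \<le> h 0"
  proof (rule DERIV_nonpos_imp_decreasing_open[where f = h and a = 0 and b = t])
    show "0 \<le> t" using t by simp
    have "continuous_on {0..t} (\<lambda>r. integral {0..r} z)"
      by (intro indefinite_integral_continuous_1 integrable_continuous_real continuous_on_subset[OF cont]) (use t in auto)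
    then show "continuous_on {0..t} h" unfolding h_def by (intro continuous_intros)
    fix r assume r: "0 < r" "r < t"
    have "((\<lambda>r. integral {0..r} z) has_real_derivative z r) (at r within {0..t})"
      by (intro integral_has_real_derivative continuous_on_subset[OF cont]) (use r t in auto)
    then have "((\<lambda>r. integral {0..r} z) has_real_derivative z r) (at r)"
      using r by (simp add: at_within_Icc_at)
    then have "(h has_real_derivative (L * z r) * exp (- (L * r)) + (A + L * integral {0..r} z) * (exp (- (L * r)) * - L)) (at r)"
      unfolding h_def by (auto intro!: derivative_eq_intros simp: algebra_simps)
    moreover have "(L * z r) * exp (- (L * r)) + (A + L * integral {0..r} z) * (exp (- (L * r)) * - L)
      = L * exp (- (L * r)) * (z r - (A + L * integral {0..r} z))" by (simp add: algebra_simps)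
    moreover have "\<dots> \<le> 0"
      using le[of r] r t L by (intro mult_nonneg_nonpos) auto
    ultimately show "\<exists>y. (h has_real_derivative y) (at r) \<and> y \<le> 0" by metis
  qed
  then have "(A + L * integral {0..t} z) * exp (- (L * t)) \<le> A" by (simp add: h_def)
  then have "(A + L * integral {0..t} z) * exp (- (L * t)) * exp (L * t) \<le> A * exp (L * t)"
    by (rule mult_right_mono) simp
  then have "A + L * integral {0..t} z \<le> A * exp (L * t)" by (simp add: mult.assoc flip: exp_add)
  then show ?thesis using le[OF t] by simp
qed

text \<open>Time is reversed: the value at 0 is controlled by the value at \<open>t\<close>. This is
  what keeps \<open>q\<close> away from 0 in \<open>exponential_bounds\<close>.\<close>

lemma gronwall_backward:
  fixes z :: "real \<Rightarrow> real"
  assumes cont: "continuous_on {0..t} z" and L: "L \<ge> 0" and t: "0 \<le> t"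
    and le: "\<And>s. s \<in> {0..t} \<Longrightarrow> z s \<le> A + L * integral {s..t} z"
  shows "z 0 \<le> A * exp (L * t)"
proof -
  define h where "h r = (A + L * integral {r..t} z) * exp (L * r)" for r
  have "- h t \<le> - h 0"
  proof (rule DERIV_nonpos_imp_decreasing_open[where f = "\<lambda>r. - h r" and a = 0 and b = t])
    show "0 \<le> t" using t by simp
    have "continuous_on {0..t} (\<lambda>r. integral {r..t} z)"
      by (intro indefinite_integral_continuous_1' integrable_continuous_real cont)
    then show "continuous_on {0..t} (\<lambda>r. - h r)" unfolding h_def by (intro continuous_intros)
    fix r assume r: "0 < r" "r < t"
    have "((\<lambda>r. integral {r..t} z) has_real_derivative - z r) (at r within {0..t})"
      by (intro integral_has_real_derivative' continuous_on_subset[OF cont]) (use r t in auto)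
    then have "((\<lambda>r. integral {r..t} z) has_real_derivative - z r) (at r)"
      using r by (simp add: at_within_Icc_at)
    then have "((\<lambda>r. - h r) has_real_derivative - ((L * - z r) * exp (L * r) + (A + L * integral {r..t} z) * (exp (L * r) * L))) (at r)"
      unfolding h_def by (auto intro!: derivative_eq_intros simp: algebra_simps)
    moreover have "- ((L * - z r) * exp (L * r) + (A + L * integral {r..t} z) * (exp (L * r) * L))
      = L * exp (L * r) * (z r - (A + L * integral {r..t} z))" by (simp add: algebra_simps)
    moreover have "\<dots> \<le> 0"
      using le[of r] r t L by (intro mult_nonneg_nonpos) auto
    ultimately show "\<exists>y. ((\<lambda>r. - h r) has_real_derivative y) (at r) \<and> y \<le> 0" by metis
  qed
  then show ?thesis using le[of 0] t by (simp add: h_def)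
qed

section \<open>Mass of the exponential kernel\<close>

lemma nn_integral_exp_abs_le:
  fixes c :: real
  assumes c: "c > 0"
  shows "(\<integral>\<^sup>+y. ennreal (exp (- (c * \<bar>y - x\<bar>))) \<partial>lborel) \<le> ennreal (2 / c)"
proof -
  have half: "(\<integral>\<^sup>+y. ennreal (exp (- (c * y))) * indicator {0..} y \<partial>lborel) = ennreal (1 / c)"
  proof -
    have "((\<lambda>y. - exp (- (c * y)) / c) \<longlongrightarrow> - 0 / c) at_top"
      using c by (intro tendsto_intros filterlim_compose[OF exp_at_bot]) (auto intro!: filterlim_tendsto_pos_mult_at_top simp: filterlim_uminus_at_bot filterlim_ident)
    then have "(\<integral>\<^sup>+y. ennreal (exp (- (c * y))) * indicator {0..} y \<partial>lborel) = ennreal (- 0 / c - (- exp (- (c * 0)) / c))"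
      using c by (intro nn_integral_FTC_atLeast) (auto intro!: derivative_eq_intros simp: field_simps)
    then show ?thesis using c by simp
  qed
  have half': "(\<integral>\<^sup>+y. ennreal (exp (c * y)) * indicator {..0} y \<partial>lborel) = ennreal (1 / c)"
  proof -
    have "(\<integral>\<^sup>+y. ennreal (exp (c * y)) * indicator {..0} y \<partial>lborel)
        = \<bar>-1::real\<bar> * (\<integral>\<^sup>+y. ennreal (exp (c * (0 + (-1) * y))) * indicator {..0} (0 + (-1) * y) \<partial>lborel)"
      by (rule nn_integral_real_affine) auto
    also have "\<dots> = (\<integral>\<^sup>+y. ennreal (exp (- (c * y))) * indicator {0..} y \<partial>lborel)"
      by (simp, intro nn_integral_cong) (auto simp: indicator_def)
    finally show ?thesis using half by simp
  qed
  have "(\<integral>\<^sup>+y. ennreal (exp (- (c * \<bar>y - x\<bar>))) \<partial>lborel) = \<bar>1::real\<bar> * (\<integral>\<^sup>+y. ennreal (exp (- (c * \<bar>x + 1 * y - x\<bar>))) \<partial>lborel)"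
    by (rule nn_integral_real_affine) auto
  also have "\<dots> = (\<integral>\<^sup>+y. ennreal (exp (- (c * \<bar>y\<bar>))) \<partial>lborel)" by simp
  also have "\<dots> \<le> (\<integral>\<^sup>+y. ennreal (exp (- (c * y))) * indicator {0..} y + ennreal (exp (c * y)) * indicator {..0} y \<partial>lborel)"
    by (intro nn_integral_mono) (auto simp: indicator_def)
  also have "\<dots> = ennreal (1 / c) + ennreal (1 / c)"
    by (subst nn_integral_add) (auto simp: half half')
  also have "\<dots> = ennreal (2 / c)" using c by (simp flip: ennreal_plus)
  finally show ?thesis .
qed

lemma integrable_exp_abs:
  fixes c :: real
  assumes "c > 0"
  shows "integrable lborel (\<lambda>y. exp (- (c * \<bar>y - x\<bar>)))" and "(LBINT y. exp (- (c * \<bar>y - x\<bar>))) \<le> 2 / c"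
proof -
  show *: "integrable lborel (\<lambda>y. exp (- (c * \<bar>y - x\<bar>)))"
    using nn_integral_exp_abs_le[OF assms, of x]
    by (intro integrableI_nonneg) (auto simp: le_less_trans)
  have "ennreal (LBINT y. exp (- (c * \<bar>y - x\<bar>))) \<le> ennreal (2 / c)"
    using nn_integral_exp_abs_le[OF assms, of x] nn_integral_eq_integral[OF *] by simp
  then show "(LBINT y. exp (- (c * \<bar>y - x\<bar>))) \<le> 2 / c" using assms by (simp add: ennreal_le_iff)
qed

text \<open>On a piece of length h the mean value theorem turns the increment of f into h * |f' z|,
  and replacing f' by the constant f' z costs at most C * h^2. Over n + 1 equal pieces the errors
  add up to C * (b - a)^2 / (n + 1), which vanishes in the limit.\<close>

lemma integral_abs_derivative_le_variation:
  fixes f f' :: "real \<Rightarrow> real"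
  assumes f': "\<And>x. (f has_real_derivative f' x) (at x)"
    and lip: "\<And>x y. \<bar>f' x - f' y\<bar> \<le> C * \<bar>x - y\<bar>"
    and tv: "total_variation f \<le> ennreal V" and V: "V \<ge> 0" and ab: "a \<le> b"
  shows "integral {a..b} (\<lambda>x. \<bar>f' x\<bar>) \<le> V"
proof -
  have C: "C \<ge> 0" using lip[of 0 1] by simp
  have cont: "continuous_on S f'" for S
  proof -
    have "C-lipschitz_on S f'" using lip C by (auto simp: lipschitz_on_def dist_real_def)
    then show ?thesis by (rule lipschitz_on_continuous_on)
  qed
  have int: "(\<lambda>x. \<bar>f' x\<bar>) integrable_on {c..d}" for c d
    by (intro integrable_continuous_real continuous_intros cont)
  have step: "integral {c..d} (\<lambda>x. \<bar>f' x\<bar>) \<le> \<bar>f d - f c\<bar> + C * (d - c)\<^sup>2" if cd: "c < d" for c d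
  proof -
    obtain z where z: "c < z" "z < d" "f d - f c = (d - c) * f' z"
      using MVT2[OF cd, of f f'] f' by blast
    have "integral {c..d} (\<lambda>x. \<bar>f' x\<bar>) \<le> integral {c..d} (\<lambda>x. \<bar>f' z\<bar> + C * (d - c))"
    proof (rule integral_le[OF int])
      fix x assume x: "x \<in> {c..d}"
      have "C * \<bar>x - z\<bar> \<le> C * (d - c)" using x z C by (intro mult_left_mono) auto
      then show "\<bar>f' x\<bar> \<le> \<bar>f' z\<bar> + C * (d - c)" using lip[of x z] by linarith
    qed auto
    also have "\<dots> = \<bar>f d - f c\<bar> + C * (d - c)\<^sup>2"
    proof -
      have "\<bar>f d - f c\<bar> = (d - c) * \<bar>f' z\<bar>" using cd by (simp add: z(3) abs_mult)
      then show ?thesis using cd by (simp add: power2_eq_square algebra_simps)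
    qed
    finally show ?thesis .
  qed
  show ?thesis
  proof (cases "a = b")
    case False
    then have ab': "a < b" using ab by simp
    have main: "integral {a..b} (\<lambda>x. \<bar>f' x\<bar>) \<le> V + C * (b - a)\<^sup>2 / real (Suc n)" for n
    proof -
      define h where "h = (b - a) / real (Suc n)"
      have h: "h > 0" using ab' by (simp add: h_def)
      define p where "p i = a + real i * h" for i
      have pmono: "p i \<le> p j" if "i \<le> j" for i j
        using that h by (simp add: p_def mult_right_mono)
      have ind: "integral {a..p k} (\<lambda>x. \<bar>f' x\<bar>) \<le> (\<Sum>i<k. \<bar>f (p (Suc i)) - f (p i)\<bar>) + real k * (C * h\<^sup>2)" for k
      proof (induction k)
        case (Suc k)
        have "integral {a..p (Suc k)} (\<lambda>x. \<bar>f' x\<bar>) = integral {a..p k} (\<lambda>x. \<bar>f' x\<bar>) + integral {p k..p (Suc k)} (\<lambda>x. \<bar>f' x\<bar>)"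
          using pmono[of 0 k] pmono[of k "Suc k"] by (intro Henstock_Kurzweil_Integration.integral_combine[symmetric] int) (auto simp: p_def)
        moreover have "integral {p k..p (Suc k)} (\<lambda>x. \<bar>f' x\<bar>) \<le> \<bar>f (p (Suc k)) - f (p k)\<bar> + C * h\<^sup>2"
          using step[of "p k" "p (Suc k)"] h by (simp add: p_def algebra_simps)
        ultimately show ?case using Suc by (simp add: algebra_simps)
      qed (simp add: p_def)
      \<comment> \<open>There are \<open>Suc (Suc n)\<close> points, so that
        \<open>length xs - 1\<close> counts the \<open>Suc n\<close> pieces.\<close>
      define xs where "xs = map p [0..<Suc (Suc n)]"
      have sorted: "sorted xs"
        unfolding xs_def sorted_map by (rule sorted_wrt_mono_rel[OF _ sorted_upt]) (auto intro: pmono)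
      have nth: "xs ! i = p i" if "i \<le> Suc n" for i
        using that unfolding xs_def by (subst nth_map) (auto simp del: upt_Suc)
      have len: "length xs - 1 = Suc n" by (simp add: xs_def)
      have "(\<Sum>i<length xs - 1. ennreal \<bar>f (xs ! Suc i) - f (xs ! i)\<bar>) \<le> total_variation f"
        unfolding total_variation_def by (intro SUP_upper) (use sorted in auto)
      then have "(\<Sum>i<Suc n. ennreal \<bar>f (xs ! Suc i) - f (xs ! i)\<bar>) \<le> ennreal V"
        using tv unfolding len by (rule order_trans)
      then have "(\<Sum>i<Suc n. \<bar>f (xs ! Suc i) - f (xs ! i)\<bar>) \<le> V"
        using V by (simp add: ennreal_le_iff del: sum.lessThan_Suc)
      moreover have "(\<Sum>i<Suc n. \<bar>f (xs ! Suc i) - f (xs ! i)\<bar>) = (\<Sum>i<Suc n. \<bar>f (p (Suc i)) - f (p i)\<bar>)"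
        by (intro sum.cong refl) (auto simp: nth)
      moreover have "p (Suc n) = b" by (simp add: p_def h_def field_simps)
      moreover have "real (Suc n) * (C * h\<^sup>2) = C * (b - a)\<^sup>2 / real (Suc n)"
      proof -
        have "real (Suc n) * (C * (Y / (real (Suc n))\<^sup>2)) = C * Y / real (Suc n)" for Y
          by (simp add: power2_eq_square del: of_nat_Suc)
        then show ?thesis by (simp only: h_def power_divide)
      qed
      ultimately show ?thesis using ind[of "Suc n"] by simp
    qed
    have "(\<lambda>n. V + C * (b - a)\<^sup>2 * inverse (real (Suc n))) \<longlonglongrightarrow> V + C * (b - a)\<^sup>2 * 0"
      by (intro tendsto_intros LIMSEQ_inverse_real_of_nat)
    then show ?thesis
      using main by (intro LIMSEQ_le_const[of _ V]) (auto simp: divide_inverse)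
  qed (use V in simp)
qed

text \<open>Increments along a sorted list are increments along its image, which is again sorted.
  Needed for \<open>u0\<close> composed with the label map \<open>y0\<close>.\<close>

lemma total_variation_compose_mono:
  assumes "mono g"
  shows "total_variation (\<lambda>x. f (g x)) \<le> total_variation f"
  unfolding total_variation_def
proof (rule SUP_least)
  fix xs :: "real list" assume xs: "xs \<in> {xs. sorted xs}"
  have "sorted (map g xs)"
    unfolding sorted_map using xs assms by (auto intro: sorted_wrt_mono_rel simp: mono_def)
  then have "(\<Sum>i<length (map g xs) - 1. ennreal \<bar>f (map g xs ! Suc i) - f (map g xs ! i)\<bar>)
    \<le> (SUP xs\<in>{xs. sorted xs}. \<Sum>i<length xs - 1. ennreal \<bar>f (xs ! Suc i) - f (xs ! i)\<bar>)"
    by (intro SUP_upper) auto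
  moreover have "(\<Sum>i<length xs - 1. ennreal \<bar>f (g (xs ! Suc i)) - f (g (xs ! i))\<bar>)
    = (\<Sum>i<length (map g xs) - 1. ennreal \<bar>f (map g xs ! Suc i) - f (map g xs ! i)\<bar>)"
    by (intro sum.cong) auto
  ultimately show "(\<Sum>i<length xs - 1. ennreal \<bar>f (g (xs ! Suc i)) - f (g (xs ! i))\<bar>)
    \<le> (SUP xs\<in>{xs. sorted xs}. \<Sum>i<length xs - 1. ennreal \<bar>f (xs ! Suc i) - f (xs ! i)\<bar>)"
    by simp
qed

lemma BV_bounded:
  assumes "f \<in> BV"
  shows "\<exists>B. \<forall>x. \<bar>f x\<bar> \<le> B"
proof -
  obtain V where V: "total_variation f = ennreal V" "V \<ge> 0"
    using assms unfolding BV_def by (cases "total_variation f" rule: ennreal_cases) auto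
  have pair: "\<bar>f y - f x\<bar> \<le> V" if "x \<le> y" for x y
  proof -
    have "(\<Sum>i<length [x, y] - 1. ennreal \<bar>f ([x, y] ! Suc i) - f ([x, y] ! i)\<bar>) \<le> total_variation f"
      unfolding total_variation_def by (intro SUP_upper) (use that in auto)
    then show ?thesis using V by (simp add: ennreal_le_iff)
  qed
  have "\<bar>f x\<bar> \<le> \<bar>f 0\<bar> + V" for x
    using pair[of 0 x] pair[of x 0] by (cases "x \<le> 0") linarith+
  then show ?thesis by blast
qed

section \<open>The source term at a fixed time\<close>

text \<open>\<open>v\<close> and \<open>q\<close> frozen at one time. The bounds hold only almost
  everywhere and no regularity beyond measurability is assumed, because this is all that is known
  during the bootstrap. \<open>\<beta> < pi\<close> keeps \<open>cos (v / 2)\<close> away from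
  0.\<close>

locale profile =
  fixes l a b \<beta> :: real and v q :: "real \<Rightarrow> real"
  assumes l: "l > 0" and a: "a > 0" and \<beta>: "0 \<le> \<beta>" "\<beta> < pi"
    and v_meas [measurable]: "v \<in> borel_measurable borel"
    and q_meas [measurable]: "q \<in> borel_measurable borel"
    and bounds: "AE \<xi> in lborel. \<bar>v \<xi>\<bar> \<le> \<beta> \<and> a \<le> q \<xi> \<and> q \<xi> \<le> b"
begin

definition g where "g = a * (cos (\<beta> / 2))\<^sup>2"

definition w where "w \<xi> = qbar v q \<xi> * (cos (v \<xi> / 2))\<^sup>2"

text \<open>The Eulerian position up to a constant: \<open>w\<close> is the expression that becomes
  the label derivative of \<open>y_lag\<close>. In this variable \<open>kern\<close> is exp (-
  distance / l), and \<open>g\<close> and \<open>b\<close> bound the stretching from below and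
  above.\<close>

definition A where "A x = (LBINT \<xi>=ereal 0..ereal x. w \<xi>)"

lemma g_pos: "g > 0"
proof -
  have "cos (\<beta> / 2) > 0" using \<beta> by (intro cos_gt_zero_pi) auto
  then show ?thesis using a by (simp add: g_def)
qed

lemma cos_half_ge:
  assumes "\<bar>x\<bar> \<le> \<beta>"
  shows "(cos (\<beta> / 2))\<^sup>2 \<le> (cos (x / 2))\<^sup>2"
proof (rule power_mono)
  have "cos (\<beta> / 2) \<le> cos (\<bar>x\<bar> / 2)" using assms \<beta> by (intro cos_monotone_0_pi_le) auto
  also have "cos (\<bar>x\<bar> / 2) = cos (x / 2)" by (cases "x \<ge> 0") auto
  finally show "cos (\<beta> / 2) \<le> cos (x / 2)" .
  show "0 \<le> cos (\<beta> / 2)" using \<beta> by (intro cos_ge_zero) auto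
qed

lemma qbar_eq: "\<bar>v \<xi>\<bar> \<le> \<beta> \<Longrightarrow> qbar v q \<xi> = q \<xi>"
  using \<beta> by (auto simp: qbar_def)

lemma b_pos: "b > 0"
proof -
  \<comment> \<open>A bound that holds almost everywhere holds somewhere, since
    \<open>lborel\<close> is not the null measure.\<close>
  have "ae_filter lborel \<noteq> (bot :: real filter)" by (simp add: ae_filter_eq_bot_iff)
  then obtain \<xi> where "a \<le> q \<xi>" "q \<xi> \<le> b" using bounds eventually_happens' by blast
  then show ?thesis using a by linarith
qed

lemma qbar_meas [measurable]: "qbar v q \<in> borel_measurable borel"
  unfolding qbar_def[abs_def] by measurable

lemma w_meas [measurable]: "w \<in> borel_measurable borel"
  unfolding w_def[abs_def] by measurable

lemma w_bounds: "AE \<xi> in lborel. g \<le> w \<xi> \<and> w \<xi> \<le> b"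
  using bounds
proof eventually_elim
  case (elim \<xi>)
  have "a * (cos (\<beta> / 2))\<^sup>2 \<le> q \<xi> * (cos (v \<xi> / 2))\<^sup>2"
    using elim a by (intro mult_mono cos_half_ge) auto
  moreover have "q \<xi> * (cos (v \<xi> / 2))\<^sup>2 \<le> b * 1"
    using elim a by (intro mult_mono) (auto simp: abs_square_le_1)
  ultimately show ?case using elim by (simp add: g_def w_def qbar_eq)
qed

lemma w_integrable: "set_integrable lborel {x..y} w"
proof -
  have "set_integrable lborel {x..y} (\<lambda>_. b)"
    by (intro borel_integrable_atLeastAtMost' continuous_intros)
  then show ?thesis
  proof (rule set_integrable_bound)
    show "AE \<xi> in lborel. \<xi> \<in> {x..y} \<longrightarrow> norm (w \<xi>) \<le> norm b"
      using w_bounds by eventually_elim (use g_pos in auto)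
  qed (simp add: set_borel_measurable_def)
qed

lemma w_interval_integrable: "interval_lebesgue_integrable lborel (ereal x) (ereal y) w"
  unfolding interval_lebesgue_integrable_def
  by (auto intro: set_integrable_subset[OF w_integrable[of "min x y" "max x y"]])

lemma A_diff: "(LBINT \<xi>=ereal x..ereal y. w \<xi>) = A y - A x"
proof -
  have "A x + (LBINT \<xi>=ereal x..ereal y. w \<xi>) = A y"
    unfolding A_def
    by (rule interval_integral_sum) (simp add: min_def max_def w_interval_integrable)
  then show ?thesis by simp
qed

lemma A_diff_bounds:
  assumes "x \<le> y"
  shows "g * (y - x) \<le> A y - A x" "A y - A x \<le> b * (y - x)"
proof -
  have eq: "A y - A x = (LBINT \<xi>:{x..y}. w \<xi>)"
    using assms by (simp add: A_diff[symmetric] interval_integral_Icc)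
  have const: "(LBINT \<xi>:{x..y}. c) = c * (y - x)" for c
    using assms by (simp add: set_lebesgue_integral_def)
  have int: "set_integrable lborel {x..y} (\<lambda>_. c)" for c :: real
    by (intro borel_integrable_atLeastAtMost' continuous_intros)
  have "(LBINT \<xi>:{x..y}. g) \<le> (LBINT \<xi>:{x..y}. w \<xi>)"
    using w_bounds by (intro set_integral_mono_AE int w_integrable) auto
  then show "g * (y - x) \<le> A y - A x" by (simp add: eq const)
  have "(LBINT \<xi>:{x..y}. w \<xi>) \<le> (LBINT \<xi>:{x..y}. b)"
    using w_bounds by (intro set_integral_mono_AE int w_integrable) auto
  then show "A y - A x \<le> b * (y - x)" by (simp add: eq const)
qed

lemma A_abs_bounds: "g * \<bar>y - x\<bar> \<le> \<bar>A y - A x\<bar>" "\<bar>A y - A x\<bar> \<le> b * \<bar>y - x\<bar>"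
proof -
  have nn: "g * (y - x) \<ge> 0" if "x \<le> y" for x y using g_pos that by simp
  show "g * \<bar>y - x\<bar> \<le> \<bar>A y - A x\<bar>" "\<bar>A y - A x\<bar> \<le> b * \<bar>y - x\<bar>"
    using A_diff_bounds[of x y] A_diff_bounds[of y x] nn[of x y] nn[of y x]
    by (cases "x \<le> y"; simp add: abs_if)+
qed

lemma A_continuous: "continuous_on S A"
proof -
  have "b-lipschitz_on S A"
    using A_abs_bounds(2) b_pos by (auto simp: lipschitz_on_def dist_real_def)
  then show ?thesis by (rule lipschitz_on_continuous_on)
qed

lemma kern_eq: "kern l v q \<xi> \<xi>' = exp (- (\<bar>A \<xi>' - A \<xi>\<bar> / l))"
  by (simp add: kern_def A_diff[symmetric] w_def)

lemma kern_meas [measurable]: "kern l v q \<xi> \<in> borel_measurable borel"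
proof -
  have [measurable]: "A \<in> borel_measurable borel"
    by (intro borel_measurable_continuous_onI A_continuous)
  show ?thesis unfolding kern_eq[abs_def] by measurable
qed

lemma kern_le: "kern l v q \<xi> \<xi>' \<le> exp (- (g / l * \<bar>\<xi>' - \<xi>\<bar>))"
  using A_abs_bounds(1)[of \<xi>' \<xi>] l by (simp add: kern_eq divide_right_mono)

text \<open>By the triangle inequality for \<open>A\<close>, moving the base point costs only a
  factor. Hence P is Lipschitz in the label although \<open>v\<close> and \<open>q\<close> are
  merely measurable.\<close>

lemma kern_shift: "kern l v q \<xi>\<^sub>1 \<xi>' \<le> exp (b / l * \<bar>\<xi>\<^sub>1 - \<xi>\<^sub>2\<bar>) * kern l v q \<xi>\<^sub>2 \<xi>'"
proof -
  have "\<bar>A \<xi>' - A \<xi>\<^sub>2\<bar> \<le> \<bar>A \<xi>' - A \<xi>\<^sub>1\<bar> + b * \<bar>\<xi>\<^sub>1 - \<xi>\<^sub>2\<bar>"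
    using A_abs_bounds(2)[of \<xi>\<^sub>1 \<xi>\<^sub>2] by linarith
  then have "\<bar>A \<xi>' - A \<xi>\<^sub>2\<bar> / l \<le> \<bar>A \<xi>' - A \<xi>\<^sub>1\<bar> / l + b / l * \<bar>\<xi>\<^sub>1 - \<xi>\<^sub>2\<bar>"
    using l by (simp add: field_simps)
  then show ?thesis by (simp add: kern_eq flip: exp_add)
qed

lemma P_integrand_meas [measurable]: "P_integrand l v q \<xi> \<in> borel_measurable borel"
  unfolding P_integrand_def[abs_def] by measurable

lemma P_integrand_bounds:
  "AE \<xi>' in lborel. \<forall>\<xi>. 0 \<le> P_integrand l v q \<xi> \<xi>' \<and>
     P_integrand l v q \<xi> \<xi>' \<le> exp (- (g / l * \<bar>\<xi>' - \<xi>\<bar>)) * b * (sin (v \<xi>' / 2))\<^sup>2"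
  using bounds
proof (eventually_elim, intro allI conjI)
  case (elim \<xi>') fix \<xi>
  show "0 \<le> P_integrand l v q \<xi> \<xi>'"
    using elim a by (auto simp: P_integrand_def kern_eq qbar_eq)
  show "P_integrand l v q \<xi> \<xi>' \<le> exp (- (g / l * \<bar>\<xi>' - \<xi>\<bar>)) * b * (sin (v \<xi>' / 2))\<^sup>2"
    unfolding P_integrand_def using elim a
    by (intro mult_mono kern_le) (auto simp: qbar_eq)
qed

lemma P_integrand_le_exp:
  "AE \<xi>' in lborel. \<forall>\<xi>. norm (P_integrand l v q \<xi> \<xi>') \<le> b * exp (- (g / l * \<bar>\<xi>' - \<xi>\<bar>))"
  using P_integrand_bounds
proof (eventually_elim, intro allI)
  case (elim \<xi>') fix \<xi>
  have "exp (- (g / l * \<bar>\<xi>' - \<xi>\<bar>)) * b * (sin (v \<xi>' / 2))\<^sup>2 \<le> exp (- (g / l * \<bar>\<xi>' - \<xi>\<bar>)) * b * 1"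
    using b_pos by (intro mult_left_mono) (auto simp: abs_square_le_1)
  then show "norm (P_integrand l v q \<xi> \<xi>') \<le> b * exp (- (g / l * \<bar>\<xi>' - \<xi>\<bar>))"
    using elim[rule_format, of \<xi>] by (simp add: mult.commute)
qed

lemma exp_integrable: "integrable lborel (\<lambda>\<xi>'. b * exp (- (g / l * \<bar>\<xi>' - \<xi>\<bar>)))"
  using g_pos l by (intro integrable_mult_right integrable_exp_abs) auto

lemma P_integrand_integrable: "integrable lborel (P_integrand l v q \<xi>)"
proof (rule Bochner_Integration.integrable_bound[OF exp_integrable[of \<xi>]])
  show "AE \<xi>' in lborel. norm (P_integrand l v q \<xi> \<xi>') \<le> norm (b * exp (- (g / l * \<bar>\<xi>' - \<xi>\<bar>)))"
    using P_integrand_le_exp by eventually_elim (use b_pos in auto)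
qed simp

lemma P_lag_nonneg: "0 \<le> P_lag l v q \<xi>"
proof -
  have "AE \<xi>' in lborel. 0 \<le> P_integrand l v q \<xi> \<xi>'"
    using P_integrand_bounds by eventually_elim auto
  then have "0 \<le> (LBINT \<xi>'. P_integrand l v q \<xi> \<xi>')" by (rule integral_nonneg_AE)
  then show ?thesis using l by (simp add: P_lag_def)
qed

lemma P_lag_shift: "P_lag l v q \<xi>\<^sub>1 \<le> exp (b / l * \<bar>\<xi>\<^sub>1 - \<xi>\<^sub>2\<bar>) * P_lag l v q \<xi>\<^sub>2"
proof -
  have "(LBINT \<xi>'. P_integrand l v q \<xi>\<^sub>1 \<xi>') \<le> (LBINT \<xi>'. exp (b / l * \<bar>\<xi>\<^sub>1 - \<xi>\<^sub>2\<bar>) * P_integrand l v q \<xi>\<^sub>2 \<xi>')"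
  proof (rule integral_mono_AE)
    show "AE \<xi>' in lborel. P_integrand l v q \<xi>\<^sub>1 \<xi>' \<le> exp (b / l * \<bar>\<xi>\<^sub>1 - \<xi>\<^sub>2\<bar>) * P_integrand l v q \<xi>\<^sub>2 \<xi>'"
      using bounds
    proof eventually_elim
      case (elim \<xi>')
      have "kern l v q \<xi>\<^sub>1 \<xi>' * (qbar v q \<xi>' * (sin (v \<xi>' / 2))\<^sup>2) \<le> exp (b / l * \<bar>\<xi>\<^sub>1 - \<xi>\<^sub>2\<bar>) * kern l v q \<xi>\<^sub>2 \<xi>' * (qbar v q \<xi>' * (sin (v \<xi>' / 2))\<^sup>2)"
        using elim a by (intro mult_right_mono kern_shift) (auto simp: qbar_eq)
      then show ?case by (simp add: P_integrand_def mult_ac)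
    qed
  qed (intro integrable_mult_right P_integrand_integrable)+
  then have "1 / (4 * l) * (LBINT \<xi>'. P_integrand l v q \<xi>\<^sub>1 \<xi>') \<le> 1 / (4 * l) * (LBINT \<xi>'. exp (b / l * \<bar>\<xi>\<^sub>1 - \<xi>\<^sub>2\<bar>) * P_integrand l v q \<xi>\<^sub>2 \<xi>')"
    using l by (intro mult_left_mono) auto
  then show ?thesis by (simp add: P_lag_def mult_ac)
qed

text \<open>The energy is split into an integrable part and a constant. Against \<open>h\<close> the
  kernel is bounded by 1, so that the prefactor 1 / l survives. Against the constant \<kappa> the
  kernel integrates to at most 2 * l / g, which cancels 1 / l and leaves a bound proportional to
  \<kappa>.\<close>

lemma P_lag_le:
  assumes h: "integrable lborel h" "(LBINT \<xi>. h \<xi>) \<le> H" "\<And>\<xi>. 0 \<le> h \<xi>" and \<kappa>: "\<kappa> \<ge> 0"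
    and sin: "AE \<xi> in lborel. (sin (v \<xi> / 2))\<^sup>2 \<le> h \<xi> + \<kappa>"
  shows "P_lag l v q \<xi> \<le> b * H / (4 * l) + b * \<kappa> / (2 * g)"
proof -
  have gl: "g / l > 0" using g_pos l by simp
  have "(LBINT \<xi>'. P_integrand l v q \<xi> \<xi>') \<le> (LBINT \<xi>'. b * h \<xi>' + b * \<kappa> * exp (- (g / l * \<bar>\<xi>' - \<xi>\<bar>)))"
  proof (rule integral_mono_AE[OF P_integrand_integrable])
    show "integrable lborel (\<lambda>\<xi>'. b * h \<xi>' + b * \<kappa> * exp (- (g / l * \<bar>\<xi>' - \<xi>\<bar>)))"
      by (intro Bochner_Integration.integrable_add integrable_mult_right h integrable_exp_abs gl)
    show "AE \<xi>' in lborel. P_integrand l v q \<xi> \<xi>' \<le> b * h \<xi>' + b * \<kappa> * exp (- (g / l * \<bar>\<xi>' - \<xi>\<bar>))"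
      using P_integrand_bounds sin
    proof eventually_elim
      case (elim \<xi>')
      define e where "e = exp (- (g / l * \<bar>\<xi>' - \<xi>\<bar>))"
      have e: "0 \<le> e" "e \<le> 1" using mult_nonneg_nonneg[of "g / l" "\<bar>\<xi>' - \<xi>\<bar>"] gl by (auto simp: e_def)
      have "e * b * (sin (v \<xi>' / 2))\<^sup>2 \<le> e * b * (h \<xi>' + \<kappa>)"
        using elim e b_pos by (intro mult_left_mono) auto
      also have "\<dots> = e * (b * h \<xi>') + b * \<kappa> * e" by (simp add: algebra_simps)
      also have "e * (b * h \<xi>') \<le> 1 * (b * h \<xi>')"
        using e h(3) b_pos by (intro mult_right_mono) auto
      finally show ?case using elim(1)[rule_format, of \<xi>] by (simp add: e_def)
    qed
  qed
  also have "\<dots> = b * (LBINT \<xi>. h \<xi>) + b * \<kappa> * (LBINT \<xi>'. exp (- (g / l * \<bar>\<xi>' - \<xi>\<bar>)))"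
    using h(1) integrable_exp_abs(1)[OF gl, of \<xi>] by simp
  also have "\<dots> \<le> b * H + b * \<kappa> * (2 / (g / l))"
    using h(2) integrable_exp_abs(2)[OF gl, of \<xi>] b_pos \<kappa> by (intro add_mono mult_left_mono) auto
  finally have "(LBINT \<xi>'. P_integrand l v q \<xi> \<xi>') / (4 * l) \<le> (b * H + b * \<kappa> * (2 / (g / l))) / (4 * l)"
    using l by (intro divide_right_mono) auto
  also have "\<dots> = b * H / (4 * l) + b * \<kappa> / (2 * g)"
    using l g_pos by (simp add: field_simps)
  finally show ?thesis by (simp add: P_lag_def)
qed

end

text \<open>\<open>kern\<close> sees \<open>v\<close> and \<open>q\<close> only through an integral,
  so it does not change at all. The exceptional set therefore comes from the remaining factor alone
  and is the same for all base points \<xi>.\<close>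

lemma P_integrand_cong_AE:
  assumes [measurable]: "v \<in> borel_measurable borel" "q \<in> borel_measurable borel" "v' \<in> borel_measurable borel" "q' \<in> borel_measurable borel"
    and eq: "AE \<xi> in lborel. v \<xi> = v' \<xi> \<and> q \<xi> = q' \<xi>"
  shows "AE \<xi>' in lborel. \<forall>\<xi>. P_integrand l v q \<xi> \<xi>' = P_integrand l v' q' \<xi> \<xi>'"
proof -
  have [measurable]: "qbar v q \<in> borel_measurable borel" "qbar v' q' \<in> borel_measurable borel"
    unfolding qbar_def[abs_def] by measurable
  have k: "kern l v q \<xi> \<xi>' = kern l v' q' \<xi> \<xi>'" for \<xi> \<xi>'
  proof -
    have "(LBINT s=ereal \<xi>..ereal \<xi>'. qbar v q s * (cos (v s / 2))\<^sup>2) = (LBINT s=ereal \<xi>..ereal \<xi>'. qbar v' q' s * (cos (v' s / 2))\<^sup>2)"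
    proof (rule interval_integral_cong_AE)
      show "AE x\<in>einterval (min (ereal \<xi>) (ereal \<xi>')) (max (ereal \<xi>) (ereal \<xi>')) in lborel.
          qbar v q x * (cos (v x / 2))\<^sup>2 = qbar v' q' x * (cos (v' x / 2))\<^sup>2"
        using eq by eventually_elim (simp add: qbar_def)
    qed measurable
    then show ?thesis by (simp add: kern_def)
  qed
  from eq show ?thesis
    by eventually_elim (simp add: P_integrand_def qbar_def k)
qed

lemma P_lag_cong_AE:
  assumes [measurable]: "v \<in> borel_measurable borel" "q \<in> borel_measurable borel" "v' \<in> borel_measurable borel" "q' \<in> borel_measurable borel"
    and eq: "AE \<xi> in lborel. v \<xi> = v' \<xi> \<and> q \<xi> = q' \<xi>"
    and meas [measurable]: "P_integrand l v q \<xi> \<in> borel_measurable borel" "P_integrand l v' q' \<xi> \<in> borel_measurable borel"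
  shows "P_lag l v q \<xi> = P_lag l v' q' \<xi>" and "Px_lag l v q \<xi> = Px_lag l v' q' \<xi>"
proof -
  have ae: "AE \<xi>' in lborel. P_integrand l v q \<xi> \<xi>' = P_integrand l v' q' \<xi> \<xi>'"
    using P_integrand_cong_AE[OF assms(1-5), of l] by eventually_elim auto
  have S: "(LBINT \<xi>':S. P_integrand l v q \<xi> \<xi>') = (LBINT \<xi>':S. P_integrand l v' q' \<xi> \<xi>')" if [measurable]: "S \<in> sets borel" for S
    unfolding set_lebesgue_integral_def by (rule integral_cong_AE) (use ae in \<open>auto elim!: eventually_mono\<close>)
  show "P_lag l v q \<xi> = P_lag l v' q' \<xi>"
    using S[of UNIV] by (simp add: P_lag_def set_lebesgue_integral_def)
  show "Px_lag l v q \<xi> = Px_lag l v' q' \<xi>"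
    by (simp add: Px_lag_def S)
qed

section \<open>The source term of a continuous profile\<close>

locale continuous_profile = profile +
  assumes v_cont: "continuous_on UNIV v" and q_cont: "continuous_on UNIV q"
    and v_le: "\<And>\<xi>. \<bar>v \<xi>\<bar> \<le> \<beta>" and q_ge: "\<And>\<xi>. a \<le> q \<xi>" and q_le: "\<And>\<xi>. q \<xi> \<le> b"
begin

lemma w_cont: "continuous_on UNIV w"
  unfolding w_def[abs_def] qbar_eq[OF v_le] by (intro continuous_intros v_cont q_cont) auto

lemma A_has_derivative: "(A has_real_derivative q \<xi> * (cos (v \<xi> / 2))\<^sup>2) (at \<xi>)"
proof -
  have "((\<lambda>u. LBINT y=0..ereal u. w y) has_vector_derivative w \<xi>) (at \<xi> within {min 0 \<xi> - 1..max 0 \<xi> + 1})"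
    using interval_integral_FTC2[of "min 0 \<xi> - 1" 0 "max 0 \<xi> + 1" w \<xi>] continuous_on_subset[OF w_cont]
    by (simp add: zero_ereal_def)
  then have "(A has_real_derivative w \<xi>) (at \<xi> within {min 0 \<xi> - 1..max 0 \<xi> + 1})"
    by (simp add: A_def[abs_def] has_real_derivative_iff_has_vector_derivative zero_ereal_def)
  then have "(A has_real_derivative w \<xi>) (at \<xi>)"
    by (subst (asm) at_within_Icc_at) auto
  then show ?thesis by (simp add: w_def qbar_eq[OF v_le])
qed

text \<open>Splitting the kernel as \<open>exp (A \<xi> / l) * exp (- A \<xi>' / l)\<close> on \<open>{\<xi>..}\<close>, and symmetrically
  on \<open>{..\<xi>}\<close>, reduces the differentiation to the fundamental theorem of calculus.\<close>

lemma Px_lag_has_derivative: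
  "((\<lambda>\<xi>. l\<^sup>2 * Px_lag l v q \<xi>) has_real_derivative
     q \<xi> * (cos (v \<xi> / 2))\<^sup>2 * P_lag l v q \<xi> - q \<xi> * (sin (v \<xi> / 2))\<^sup>2 / 2) (at \<xi>)"
proof -
  define f where "f \<xi> = q \<xi> * (sin (v \<xi> / 2))\<^sup>2" for \<xi>
  have f_cont: "continuous_on S f" for S
    unfolding f_def by (intro continuous_intros continuous_on_subset[OF v_cont] continuous_on_subset[OF q_cont]) auto
  have Pint: "P_integrand l v q \<xi> \<xi>' = exp (- (\<bar>A \<xi>' - A \<xi>\<bar> / l)) * f \<xi>'" for \<xi> \<xi>'
    by (simp add: P_integrand_def kern_eq f_def qbar_eq[OF v_le] mult.assoc)
  have A_mono: "A x \<le> A y" if "x \<le> y" for x y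
    using A_diff_bounds(1)[OF that] mult_nonneg_nonneg[of g "y - x"] g_pos that by linarith
  define r where "r \<xi> = exp (- (A \<xi> / l)) * f \<xi>" for \<xi>
  define s where "s \<xi> = exp (A \<xi> / l) * f \<xi>" for \<xi>
  have r_cont: "continuous_on S r" for S
    unfolding r_def by (intro continuous_intros A_continuous f_cont) (use l in auto)
  have s_cont: "continuous_on S s" for S
    unfolding s_def by (intro continuous_intros A_continuous f_cont) (use l in auto)
  have [measurable]: "r \<in> borel_measurable borel" "s \<in> borel_measurable borel"
    by (intro borel_measurable_continuous_onI r_cont s_cont)+
  have ev: "set_integrable lborel {x..} r" "(LBINT \<xi>':{x..}. P_integrand l v q x \<xi>') = exp (A x / l) * (LBINT \<xi>':{x..}. r \<xi>')" for x
  proof -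
    have e: "P_integrand l v q x \<xi>' = exp (A x / l) * r \<xi>'" if "\<xi>' \<ge> x" for \<xi>'
      using A_mono[OF that] by (simp add: Pint r_def diff_divide_distrib exp_diff exp_minus field_simps)
    have "set_integrable lborel {x..} (P_integrand l v q x)"
      unfolding set_integrable_def by (rule integrable_mult_indicator[OF _ P_integrand_integrable]) simp
    moreover have "set_integrable lborel {x..} (P_integrand l v q x) = set_integrable lborel {x..} (\<lambda>\<xi>'. exp (A x / l) * r \<xi>')"
      by (intro set_integrable_cong refl) (use e in auto)
    ultimately have "set_integrable lborel {x..} (\<lambda>\<xi>'. exp (A x / l) * r \<xi>')" by simp
    then show "set_integrable lborel {x..} r" by simp
    have "(LBINT \<xi>':{x..}. P_integrand l v q x \<xi>') = (LBINT \<xi>':{x..}. exp (A x / l) * r \<xi>')"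
      by (intro set_lebesgue_integral_cong) (use e in auto)
    then show "(LBINT \<xi>':{x..}. P_integrand l v q x \<xi>') = exp (A x / l) * (LBINT \<xi>':{x..}. r \<xi>')" by simp
  qed
  have ev': "set_integrable lborel {..x} s" "(LBINT \<xi>':{..x}. P_integrand l v q x \<xi>') = exp (- (A x / l)) * (LBINT \<xi>':{..x}. s \<xi>')" for x
  proof -
    have e: "P_integrand l v q x \<xi>' = exp (- (A x / l)) * s \<xi>'" if "\<xi>' \<le> x" for \<xi>'
      using A_mono[OF that] by (simp add: Pint s_def diff_divide_distrib exp_diff exp_minus field_simps)
    have "set_integrable lborel {..x} (P_integrand l v q x)"
      unfolding set_integrable_def by (rule integrable_mult_indicator[OF _ P_integrand_integrable]) simp
    moreover have "set_integrable lborel {..x} (P_integrand l v q x) = set_integrable lborel {..x} (\<lambda>\<xi>'. exp (- (A x / l)) * s \<xi>')"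
      by (intro set_integrable_cong refl) (use e in auto)
    ultimately have "set_integrable lborel {..x} (\<lambda>\<xi>'. exp (- (A x / l)) * s \<xi>')" by simp
    then show "set_integrable lborel {..x} s" by simp
    have "(LBINT \<xi>':{..x}. P_integrand l v q x \<xi>') = (LBINT \<xi>':{..x}. exp (- (A x / l)) * s \<xi>')"
      by (intro set_lebesgue_integral_cong) (use e in auto)
    then show "(LBINT \<xi>':{..x}. P_integrand l v q x \<xi>') = exp (- (A x / l)) * (LBINT \<xi>':{..x}. s \<xi>')" by simp
  qed
  define R where "R x = (LBINT \<xi>':{x..}. r \<xi>')" for x
  define L where "L x = (LBINT \<xi>':{..x}. s \<xi>')" for x
  have split: "R x = R y + integral {x..y} r" "L y = L x + integral {x..y} s" if "x \<le> y" for x y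
  proof -
    have sub: "set_integrable lborel {x..y} r" "set_integrable lborel {y<..} r"
      by (rule set_integrable_subset[OF ev(1)[of x]]; use that in auto)+
    have sub': "set_integrable lborel {x..y} s" "set_integrable lborel {..<x} s"
      by (rule set_integrable_subset[OF ev'(1)[of y]]; use that in auto)+
    have "(LBINT \<xi>':{x..y} \<union> {y<..}. r \<xi>') = (LBINT \<xi>':{x..y}. r \<xi>') + (LBINT \<xi>':{y<..}. r \<xi>')"
      by (intro set_integral_Un sub) auto
    moreover have "{x..y} \<union> {y<..} = {x..}" using that by auto
    moreover have "(LBINT \<xi>':{y<..}. r \<xi>') = R y"
    proof -
      have "AE \<xi>' in lborel. \<xi>' \<noteq> y" by (rule AE_lborel_singleton)
      then show ?thesis unfolding R_def
        by (intro set_integral_cong_set) (auto simp: set_borel_measurable_def elim!: eventually_mono)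
    qed
    ultimately show "R x = R y + integral {x..y} r"
      using set_borel_integral_eq_integral(2)[OF sub(1)] by (simp add: R_def)
    have "(LBINT \<xi>':{..<x} \<union> {x..y}. s \<xi>') = (LBINT \<xi>':{..<x}. s \<xi>') + (LBINT \<xi>':{x..y}. s \<xi>')"
      by (intro set_integral_Un sub') auto
    moreover have "{..<x} \<union> {x..y} = {..y}" using that by auto
    moreover have "(LBINT \<xi>':{..<x}. s \<xi>') = L x"
    proof -
      have "AE \<xi>' in lborel. \<xi>' \<noteq> x" by (rule AE_lborel_singleton)
      then show ?thesis unfolding L_def
        by (intro set_integral_cong_set) (auto simp: set_borel_measurable_def elim!: eventually_mono)
    qed
    ultimately show "L y = L x + integral {x..y} s"
      using set_borel_integral_eq_integral(2)[OF sub'(1)] by (simp add: L_def)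
  qed
  have R': "(R has_real_derivative - r \<xi>) (at \<xi>)"
  proof -
    have "((\<lambda>x. R (\<xi> + 1) + integral {x..\<xi> + 1} r) has_real_derivative 0 + - r \<xi>) (at \<xi> within {\<xi> - 1..\<xi> + 1})"
      by (intro DERIV_add DERIV_const integral_has_real_derivative' r_cont) auto
    then have "((\<lambda>x. R (\<xi> + 1) + integral {x..\<xi> + 1} r) has_real_derivative - r \<xi>) (at \<xi>)"
      by (subst (asm) at_within_Icc_at) auto
    then show ?thesis
    proof (rule has_field_derivative_transform_within_open[of _ _ _ "{..<\<xi> + 1}"])
      show "R (\<xi> + 1) + integral {x..\<xi> + 1} r = R x" if "x \<in> {..<\<xi> + 1}" for x
        by (rule split(1)[symmetric]) (use that in simp)
    qed auto
  qed
  have L': "(L has_real_derivative s \<xi>) (at \<xi>)"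
  proof -
    have "((\<lambda>x. L (\<xi> - 1) + integral {\<xi> - 1..x} s) has_real_derivative 0 + s \<xi>) (at \<xi> within {\<xi> - 1..\<xi> + 1})"
      by (intro DERIV_add DERIV_const integral_has_real_derivative s_cont) auto
    then have "((\<lambda>x. L (\<xi> - 1) + integral {\<xi> - 1..x} s) has_real_derivative s \<xi>) (at \<xi>)"
      by (subst (asm) at_within_Icc_at) auto
    then show ?thesis
    proof (rule has_field_derivative_transform_within_open[of _ _ _ "{\<xi> - 1<..}"])
      show "L (\<xi> - 1) + integral {\<xi> - 1..x} s = L x" if "x \<in> {\<xi> - 1<..}" for x
        by (rule split(2)[symmetric]) (use that in simp)
    qed auto
  qed
  define e where "e = exp (A \<xi> / l)"
  have e: "e > 0" "exp (- (A \<xi> / l)) = 1 / e" by (auto simp: e_def exp_minus field_simps)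
  have Px_eq: "(\<lambda>\<xi>. l\<^sup>2 * Px_lag l v q \<xi>) = (\<lambda>\<xi>. (exp (A \<xi> / l) * R \<xi> - exp (- (A \<xi> / l)) * L \<xi>) / 4)"
    using l by (intro ext) (simp add: Px_lag_def ev ev' R_def L_def)
  have total: "(LBINT \<xi>'. P_integrand l v q \<xi> \<xi>') = e * R \<xi> + 1 / e * L \<xi>"
  proof -
    have I: "set_integrable lborel S (P_integrand l v q \<xi>)" if "S \<in> sets borel" for S
      unfolding set_integrable_def by (rule integrable_mult_indicator[OF _ P_integrand_integrable]) (use that in simp)
    have "(LBINT \<xi>':{..\<xi>} \<union> {\<xi><..}. P_integrand l v q \<xi> \<xi>') = (LBINT \<xi>':{..\<xi>}. P_integrand l v q \<xi> \<xi>') + (LBINT \<xi>':{\<xi><..}. P_integrand l v q \<xi> \<xi>')"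
      by (intro set_integral_Un I) auto
    moreover have "{..\<xi>} \<union> {\<xi><..} = UNIV" by auto
    moreover have "(LBINT \<xi>':{\<xi><..}. P_integrand l v q \<xi> \<xi>') = (LBINT \<xi>':{\<xi>..}. P_integrand l v q \<xi> \<xi>')"
    proof -
      have "AE \<xi>' in lborel. \<xi>' \<noteq> \<xi>" by (rule AE_lborel_singleton)
      then show ?thesis
        by (intro set_integral_cong_set) (auto simp: set_borel_measurable_def elim!: eventually_mono)
    qed
    ultimately have "(LBINT \<xi>':UNIV. P_integrand l v q \<xi> \<xi>') = exp (- (A \<xi> / l)) * L \<xi> + exp (A \<xi> / l) * R \<xi>"
      by (simp only: ev(2) ev'(2) R_def L_def)
    then show ?thesis
      unfolding e_def[symmetric] e(2) by (simp add: set_lebesgue_integral_def add.commute)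
  qed
  have A': "(A has_real_derivative w \<xi>) (at \<xi>)"
    using A_has_derivative[of \<xi>] by (simp add: w_def qbar_eq[OF v_le])
  have e1: "((\<lambda>\<xi>. exp (A \<xi> / l)) has_real_derivative e * (w \<xi> / l)) (at \<xi>)"
    unfolding e_def using DERIV_fun_exp[OF DERIV_cdivide[OF A']] .
  have e2: "((\<lambda>\<xi>. exp (- (A \<xi> / l))) has_real_derivative 1 / e * - (w \<xi> / l)) (at \<xi>)"
    unfolding e(2)[symmetric] using DERIV_fun_exp[OF DERIV_minus[OF DERIV_cdivide[OF A']]] .
  have "((\<lambda>\<xi>. l\<^sup>2 * Px_lag l v q \<xi>) has_real_derivative
      ((e * (w \<xi> / l) * R \<xi> + e * - r \<xi>) - (1 / e * - (w \<xi> / l) * L \<xi> + 1 / e * s \<xi>)) / 4) (at \<xi>)"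
    unfolding Px_eq using DERIV_cdivide[OF DERIV_diff[OF DERIV_mult[OF e1 R'] DERIV_mult[OF e2 L']], of 4]
    by (simp only: e_def[symmetric] e(2) mult.commute)
  \<comment> \<open>Both half lines contribute - f through their moving endpoint, since the left one
    is subtracted; divided by 4 this is the local term - f / 2. The derivative of the exponential
    factors is w / l times the sum of both half lines, and that sum is the integral in P.\<close>
  moreover have "e * r \<xi> = f \<xi>" "1 / e * s \<xi> = f \<xi>" by (auto simp: e_def r_def s_def exp_minus)
  then have "((e * (w \<xi> / l) * R \<xi> + e * - r \<xi>) - (1 / e * - (w \<xi> / l) * L \<xi> + 1 / e * s \<xi>)) / 4
    = w \<xi> / (4 * l) * (e * R \<xi> + 1 / e * L \<xi>) - f \<xi> / 2"
    using l by (simp add: field_simps)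
  moreover have "w \<xi> / (4 * l) * (e * R \<xi> + 1 / e * L \<xi>) = q \<xi> * (cos (v \<xi> / 2))\<^sup>2 * P_lag l v q \<xi>"
    by (simp add: P_lag_def total w_def qbar_eq[OF v_le])
  ultimately show ?thesis unfolding f_def[symmetric] by (simp only: f_def times_divide_eq_right)
qed

end

section \<open>The initial datum\<close>

lemma interval_integral_tendsto:
  fixes f :: "nat \<Rightarrow> real \<Rightarrow> real"
  assumes [measurable]: "\<And>n. f n \<in> borel_measurable borel" "F \<in> borel_measurable borel"
    and bound: "\<And>n. AE s in lborel. \<bar>f n s\<bar> \<le> B"
    and lim: "AE s in lborel. (\<lambda>n. f n s) \<longlonglongrightarrow> F s"
  shows "(\<lambda>n. LBINT s=ereal x..ereal y. f n s) \<longlonglongrightarrow> (LBINT s=ereal x..ereal y. F s)"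
proof -
  have *: "(\<lambda>n. LBINT s:{c..d}. f n s) \<longlonglongrightarrow> (LBINT s:{c..d}. F s)" for c d
    unfolding set_lebesgue_integral_def
  proof (rule integral_dominated_convergence[where w = "\<lambda>s. indicator {c..d} s * B"])
    have "set_integrable lborel {c..d} (\<lambda>_. B)"
      by (intro borel_integrable_atLeastAtMost' continuous_intros)
    then show "integrable lborel (\<lambda>s. indicator {c..d} s * B)" by (simp add: set_integrable_def)
    show "AE s in lborel. (\<lambda>n. indicat_real {c..d} s *\<^sub>R f n s) \<longlonglongrightarrow> indicat_real {c..d} s *\<^sub>R F s"
      using lim by eventually_elim (intro tendsto_intros)
    show "AE s in lborel. norm (indicat_real {c..d} s *\<^sub>R f n s) \<le> indicator {c..d} s * B" for n
      using bound[of n] by eventually_elim (auto simp: indicator_def)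
  qed measurable
  show ?thesis
  proof (cases "x \<le> y")
    case True
    then show ?thesis using *[of x y] by (simp add: interval_integral_Icc)
  next
    case False
    then have "(LBINT s=ereal x..ereal y. h s) = - (LBINT s:{y..x}. h s)" for h :: "real \<Rightarrow> real"
      by (subst interval_integral_endpoints_reverse) (simp add: interval_integral_Icc)
    then show ?thesis using tendsto_minus[OF *[of y x]] by simp
  qed
qed

text \<open>All profiles share the bounds \<open>a\<close>, \<open>b\<close> and
  \<open>\<beta>\<close>, hence one decay rate \<open>g / l\<close> of the kernels and one
  dominating function. This will make \<open>P\<close> and \<open>Px\<close> continuous in
  time.\<close>

lemma profile_tendsto:
  assumes pn: "\<And>n. profile l a b \<beta> (v n) (q n)" and p: "profile l a b \<beta> V Q"
    and lim: "AE \<xi> in lborel. (\<lambda>n. v n \<xi>) \<longlonglongrightarrow> V \<xi> \<and> (\<lambda>n. q n \<xi>) \<longlonglongrightarrow> Q \<xi>"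
  shows "(\<lambda>n. P_lag l (v n) (q n) \<xi>) \<longlonglongrightarrow> P_lag l V Q \<xi>"
    and "(\<lambda>n. Px_lag l (v n) (q n) \<xi>) \<longlonglongrightarrow> Px_lag l V Q \<xi>"
proof -
  interpret V: profile l a b \<beta> V Q by (rule p)
  have AEn: "AE \<xi> in lborel. \<forall>n. \<bar>v n \<xi>\<bar> \<le> \<beta> \<and> a \<le> q n \<xi> \<and> q n \<xi> \<le> b"
    using profile.bounds[OF pn] by (simp add: AE_all_countable)
  have qlim: "AE \<xi> in lborel. (\<lambda>n. qbar (v n) (q n) \<xi>) \<longlonglongrightarrow> qbar V Q \<xi>"
    using AEn V.bounds lim
  proof eventually_elim
    case (elim \<xi>)
    then show ?case by (simp add: V.qbar_eq profile.qbar_eq[OF pn])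
  qed
  note wm = profile.w_meas[OF pn, unfolded profile.w_def[OF pn]]
  have kern: "(\<lambda>n. kern l (v n) (q n) \<xi> \<xi>') \<longlonglongrightarrow> kern l V Q \<xi> \<xi>'" for \<xi>'
    unfolding kern_def
  proof (intro tendsto_intros interval_integral_tendsto[where B = b])
    show "AE s in lborel. \<bar>qbar (v n) (q n) s * (cos (v n s / 2))\<^sup>2\<bar> \<le> b" for n
      using profile.w_bounds[OF pn[of n]]
    proof eventually_elim
      case (elim s)
      then show ?case using profile.g_pos[OF pn[of n]] by (simp add: profile.w_def[OF pn])
    qed
    show "AE s in lborel. (\<lambda>n. qbar (v n) (q n) s * (cos (v n s / 2))\<^sup>2) \<longlonglongrightarrow> qbar V Q s * (cos (V s / 2))\<^sup>2"
      using qlim lim by eventually_elim (intro tendsto_intros, auto)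
  qed (use wm V.w_meas[unfolded V.w_def] in auto)
  have Plim: "AE \<xi>' in lborel. (\<lambda>n. P_integrand l (v n) (q n) \<xi> \<xi>') \<longlonglongrightarrow> P_integrand l V Q \<xi> \<xi>'"
    using qlim lim unfolding P_integrand_def
    by eventually_elim (intro tendsto_intros kern, auto)
  have S: "(\<lambda>n. LBINT \<xi>':S. P_integrand l (v n) (q n) \<xi> \<xi>') \<longlonglongrightarrow> (LBINT \<xi>':S. P_integrand l V Q \<xi> \<xi>')"
    if [measurable]: "S \<in> sets borel" for S
    unfolding set_lebesgue_integral_def
  proof (rule integral_dominated_convergence[where w = "\<lambda>\<xi>'. b * exp (- (V.g / l * \<bar>\<xi>' - \<xi>\<bar>))"])
    show "AE \<xi>' in lborel. (\<lambda>n. indicat_real S \<xi>' *\<^sub>R P_integrand l (v n) (q n) \<xi> \<xi>') \<longlonglongrightarrow> indicat_real S \<xi>' *\<^sub>R P_integrand l V Q \<xi> \<xi>'"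
      using Plim by eventually_elim (intro tendsto_intros)
    show "AE \<xi>' in lborel. norm (indicat_real S \<xi>' *\<^sub>R P_integrand l (v n) (q n) \<xi> \<xi>') \<le> b * exp (- (V.g / l * \<bar>\<xi>' - \<xi>\<bar>))" for n
      using profile.P_integrand_le_exp[OF pn[of n]]
    proof eventually_elim
      case (elim \<xi>')
      have "0 \<le> b * exp (- (V.g / l * \<bar>\<xi>' - \<xi>\<bar>))" using V.b_pos by simp
      then show ?case using elim[rule_format, of \<xi>] by (auto simp: indicator_def)
    qed
  qed (use V.exp_integrable profile.P_integrand_meas[OF pn] V.P_integrand_meas in auto)
  show "(\<lambda>n. P_lag l (v n) (q n) \<xi>) \<longlonglongrightarrow> P_lag l V Q \<xi>"
    using S[of UNIV] unfolding P_lag_def by (intro tendsto_intros) (simp add: set_lebesgue_integral_def)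
  show "(\<lambda>n. Px_lag l (v n) (q n) \<xi>) \<longlonglongrightarrow> Px_lag l V Q \<xi>"
    unfolding Px_lag_def by (intro tendsto_intros S) auto
qed

section \<open>Comparison of integral curves\<close>

lemma has_integral_imp_continuous_on:
  fixes x f :: "real \<Rightarrow> real"
  assumes "\<And>t. t \<in> {0..\<tau>} \<Longrightarrow> (f has_integral x t - x 0) {0..t}"
  shows "continuous_on {0..\<tau>} x"
proof (cases "\<tau> \<ge> 0")
  case True
  have eq: "x t = x 0 + integral {0..t} f" if "t \<in> {0..\<tau>}" for t
    using integral_unique[OF assms[OF that]] by simp
  have "f integrable_on {0..\<tau>}" using assms[of \<tau>] True by (auto simp: integrable_on_def)
  then have "continuous_on {0..\<tau>} (\<lambda>t. x 0 + integral {0..t} f)"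
    by (intro continuous_intros indefinite_integral_continuous_1)
  then show ?thesis by (rule continuous_on_eq) (rule eq[symmetric])
qed simp

text \<open>\<open>f\<close> and \<open>h\<close> are integrands along two given curves, not vector
  fields. Right-hand sides with jumps, curves of different equations and curves of different labels
  are thus all covered; \<open>c\<close> measures the mismatch of the equations.\<close>

lemma ode_stability:
  fixes x y f h :: "real \<Rightarrow> real"
  assumes f: "\<And>t. t \<in> {0..\<tau>} \<Longrightarrow> (f has_integral x t - x 0) {0..t}"
    and h: "\<And>t. t \<in> {0..\<tau>} \<Longrightarrow> (h has_integral y t - y 0) {0..t}"
    and le: "\<And>t. t \<in> {0..\<tau>} \<Longrightarrow> \<bar>f t - h t\<bar> \<le> c + L * \<bar>x t - y t\<bar>"
    and c: "c \<ge> 0" and "L \<ge> 0" and t: "t \<in> {0..\<tau>}"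
  shows "\<bar>x t - y t\<bar> \<le> (\<bar>x 0 - y 0\<bar> + c * t) * exp (L * t)"
proof -
  have cont: "continuous_on {0..\<tau>} (\<lambda>t. \<bar>x t - y t\<bar>)"
    by (intro continuous_intros has_integral_imp_continuous_on[OF f] has_integral_imp_continuous_on[OF h])
  show ?thesis
  proof (rule gronwall[where T = t])
    show "continuous_on {0..t} (\<lambda>t. \<bar>x t - y t\<bar>)"
      by (rule continuous_on_subset[OF cont]) (use t in auto)
    fix r assume r: "r \<in> {0..t}"
    then have r': "r \<in> {0..\<tau>}" using t by auto
    have int: "(\<lambda>t. \<bar>x t - y t\<bar>) integrable_on {0..r}"
      by (intro integrable_continuous_real continuous_on_subset[OF cont]) (use r' in auto)
    have d: "((\<lambda>t. f t - h t) has_integral (x r - x 0) - (y r - y 0)) {0..r}"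
      by (intro has_integral_diff f h r')
    have "norm (integral {0..r} (\<lambda>t. f t - h t)) \<le> integral {0..r} (\<lambda>t. c + L * \<bar>x t - y t\<bar>)"
      by (rule integral_norm_bound_integral)
        (use d int r' le in \<open>auto intro!: integrable_add integrable_on_mult_right simp: integrable_on_def[of "\<lambda>t. f t - h t"]\<close>)
    also have "\<dots> = c * r + L * integral {0..r} (\<lambda>t. \<bar>x t - y t\<bar>)"
      using int r by (subst Henstock_Kurzweil_Integration.integral_add) (auto intro!: integrable_on_mult_right)
    also have "c * r \<le> c * t" using r c by (intro mult_left_mono) auto
    finally show "\<bar>x r - y r\<bar> \<le> (\<bar>x 0 - y 0\<bar> + c * t) + L * integral {0..r} (\<lambda>t. \<bar>x t - y t\<bar>)"
      using integral_unique[OF d] by simp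
  qed (use t \<open>L \<ge> 0\<close> in auto)
qed

text \<open>Gronwall in both directions of time: a rate of at most L allows neither growth beyond
  exp (L * t) nor decay below exp (- L * t).\<close>

lemma exponential_bounds:
  fixes q f :: "real \<Rightarrow> real"
  assumes f: "\<And>t. t \<in> {0..\<tau>} \<Longrightarrow> (f has_integral q t - q 0) {0..t}"
    and le: "\<And>t. t \<in> {0..\<tau>} \<Longrightarrow> \<bar>f t\<bar> \<le> L * \<bar>q t\<bar>"
    and L: "L \<ge> 0" and t: "t \<in> {0..\<tau>}"
  shows "\<bar>q t\<bar> \<le> \<bar>q 0\<bar> * exp (L * t)" and "\<bar>q 0\<bar> \<le> \<bar>q t\<bar> * exp (L * t)"
proof -
  have cont: "continuous_on {0..\<tau>} (\<lambda>t. \<bar>q t\<bar>)"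
    by (intro continuous_intros has_integral_imp_continuous_on[OF f])
  have diff: "\<bar>q r - q s\<bar> \<le> L * integral {s..r} (\<lambda>t. \<bar>q t\<bar>)" if "0 \<le> s" "s \<le> r" "r \<le> \<tau>" for s r
  proof -
    have int0: "f integrable_on {0..r}" using f[of r] that by (auto simp: integrable_on_def)
    then have int: "f integrable_on {s..r}" by (rule integrable_subinterval_real) (use that in auto)
    have "integral {0..s} f + integral {s..r} f = integral {0..r} f"
      using int0 that by (intro Henstock_Kurzweil_Integration.integral_combine) auto
    then have eq: "integral {s..r} f = q r - q s"
      using integral_unique[OF f[of s]] integral_unique[OF f[of r]] that by simp
    have absint: "(\<lambda>t. \<bar>q t\<bar>) integrable_on {s..r}"
      by (intro integrable_continuous_real continuous_on_subset[OF cont]) (use that in auto)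
    have "norm (integral {s..r} f) \<le> integral {s..r} (\<lambda>t. L * \<bar>q t\<bar>)"
      by (rule Henstock_Kurzweil_Integration.integral_norm_bound_integral[OF int])
        (use absint le that in \<open>auto intro!: integrable_on_mult_right\<close>)
    then show ?thesis by (simp add: eq)
  qed
  show "\<bar>q t\<bar> \<le> \<bar>q 0\<bar> * exp (L * t)"
  proof (rule gronwall[where T = \<tau>])
    show "\<bar>q r\<bar> \<le> \<bar>q 0\<bar> + L * integral {0..r} (\<lambda>t. \<bar>q t\<bar>)" if "r \<in> {0..\<tau>}" for r
      using diff[of 0 r] that by auto
  qed (use cont L t in auto)
  show "\<bar>q 0\<bar> \<le> \<bar>q t\<bar> * exp (L * t)"
  proof (rule gronwall_backward)
    show "continuous_on {0..t} (\<lambda>t. \<bar>q t\<bar>)"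
      by (rule continuous_on_subset[OF cont]) (use t in auto)
    show "\<bar>q s\<bar> \<le> \<bar>q t\<bar> + L * integral {s..t} (\<lambda>t. \<bar>q t\<bar>)" if "s \<in> {0..t}" for s
      using diff[of s t] that t by auto
  qed (use L t in auto)
qed

text \<open>The label derivative of the datum is x / (1 + x^2) at x = \<open>w0\<close>. Being
  1-Lipschitz in x, it inherits the Lipschitz bound of \<open>w0\<close>, which
  \<open>integral_abs_derivative_le_variation\<close> asks for.\<close>

lemma abs_diff_over_one_plus_square_le:
  fixes x y :: real
  shows "\<bar>x / (1 + x\<^sup>2) - y / (1 + y\<^sup>2)\<bar> \<le> \<bar>x - y\<bar>"
proof -
  have pos: "(1 + x\<^sup>2) * (1 + y\<^sup>2) > 0" "1 + x\<^sup>2 > 0" "1 + y\<^sup>2 > 0"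
    by (auto simp: add_pos_nonneg)
  have "\<bar>1 - x * y\<bar> \<le> (1 + x\<^sup>2) * (1 + y\<^sup>2)"
  proof -
    have "x * y \<le> x\<^sup>2 + y\<^sup>2" "- (x * y) \<le> x\<^sup>2 + y\<^sup>2"
      using sum_squares_bound[of x y] sum_squares_bound[of x "- y"] zero_le_power2[of x] zero_le_power2[of y]
      by (simp_all del: zero_le_power2)
    then have "\<bar>1 - x * y\<bar> \<le> 1 + (x\<^sup>2 + y\<^sup>2)" by linarith
    also have "\<dots> \<le> (1 + x\<^sup>2) * (1 + y\<^sup>2)" by (simp add: algebra_simps)
    finally show ?thesis .
  qed
  then have "\<bar>x - y\<bar> * \<bar>1 - x * y\<bar> \<le> \<bar>x - y\<bar> * ((1 + x\<^sup>2) * (1 + y\<^sup>2))"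
    by (intro mult_left_mono) auto
  moreover have "x / (1 + x\<^sup>2) - y / (1 + y\<^sup>2) = (x - y) * (1 - x * y) / ((1 + x\<^sup>2) * (1 + y\<^sup>2))"
    using pos by (simp add: field_simps power2_eq_square)
  ultimately show ?thesis using pos(1) by (simp add: abs_mult divide_le_eq)
qed

section \<open>The initial slope as a function of the label\<close>

locale initial_datum =
  fixes u0 D y0 :: "real \<Rightarrow> real" and M \<Lambda> V T :: real
  assumes D: "\<And>x. (u0 has_real_derivative D x) (at x)"
    and D_bound: "\<And>x. \<bar>D x\<bar> \<le> M"
    and D_Lipschitz: "\<And>x y. \<bar>D x - D y\<bar> \<le> \<Lambda> * \<bar>x - y\<bar>"
    and variation: "total_variation u0 \<le> ennreal V" and V_nonneg: "V \<ge> 0"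
    and T: "T > 0" "M * T < 1"
    and label: "initial_label u0 y0"
begin

definition w0 where "w0 \<xi> = D (y0 \<xi>)"

lemma M_nonneg: "M \<ge> 0" using D_bound[of 0] by linarith

lemma \<Lambda>_nonneg: "\<Lambda> \<ge> 0" using D_Lipschitz[of 0 1] by simp

lemma deriv_u0: "deriv u0 = D"
  using D by (auto intro: DERIV_imp_deriv)

lemma D_cont: "continuous_on S D"
proof -
  have "\<Lambda>-lipschitz_on S D"
    using D_Lipschitz \<Lambda>_nonneg by (auto simp: lipschitz_on_def dist_real_def)
  then show ?thesis by (rule lipschitz_on_continuous_on)
qed

definition Y where "Y x = (LBINT z=ereal 0..ereal x. 1 + (D z)\<^sup>2)"

lemma Y_y0: "Y (y0 \<xi>) = \<xi>"
  using label by (simp add: initial_label_def Y_def deriv_u0)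

lemma Y_has_derivative: "(Y has_real_derivative 1 + (D x)\<^sup>2) (at x)"
proof -
  have "((\<lambda>u. LBINT y=0..ereal u. 1 + (D y)\<^sup>2) has_vector_derivative 1 + (D x)\<^sup>2) (at x within {min 0 x - 1..max 0 x + 1})"
    using interval_integral_FTC2[of "min 0 x - 1" 0 "max 0 x + 1" "\<lambda>y. 1 + (D y)\<^sup>2" x]
    by (simp add: zero_ereal_def continuous_intros D_cont)
  then have "(Y has_real_derivative 1 + (D x)\<^sup>2) (at x within {min 0 x - 1..max 0 x + 1})"
    by (simp add: Y_def[abs_def] has_real_derivative_iff_has_vector_derivative zero_ereal_def)
  then show ?thesis by (subst (asm) at_within_Icc_at) auto
qed

text \<open>The density 1 + D^2 is at least 1. As \<open>Y\<close> undoes \<open>y0\<close>, this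
  makes \<open>y0\<close> monotone and 1-Lipschitz.\<close>

lemma Y_expanding:
  assumes "x \<le> y"
  shows "y - x \<le> Y y - Y x"
proof (cases "x = y")
  case False
  then have "x < y" using assms by simp
  then obtain z where "Y y - Y x = (y - x) * (1 + (D z)\<^sup>2)"
    using MVT2[of x y Y "\<lambda>x. 1 + (D x)\<^sup>2"] Y_has_derivative by blast
  moreover have "(y - x) * 1 \<le> (y - x) * (1 + (D z)\<^sup>2)"
    using assms by (intro mult_left_mono) auto
  ultimately show ?thesis by simp
qed simp

lemma y0_mono: "mono y0"
proof (rule monoI, rule ccontr)
  fix \<xi> \<eta> assume "\<xi> \<le> \<eta>" "\<not> y0 \<xi> \<le> y0 \<eta>"
  then show False using Y_expanding[of "y0 \<eta>" "y0 \<xi>"] by (simp add: Y_y0)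
qed

lemma y0_Lipschitz: "\<bar>y0 \<xi> - y0 \<eta>\<bar> \<le> \<bar>\<xi> - \<eta>\<bar>"
  using Y_expanding[of "y0 \<eta>" "y0 \<xi>"] Y_expanding[of "y0 \<xi>" "y0 \<eta>"]
  by (cases "y0 \<eta> \<le> y0 \<xi>") (auto simp: Y_y0)

lemma y0_cont: "continuous_on S y0"
proof -
  have "1-lipschitz_on S y0"
    using y0_Lipschitz by (auto simp: lipschitz_on_def dist_real_def)
  then show ?thesis by (rule lipschitz_on_continuous_on)
qed

lemma y0_has_derivative: "(y0 has_real_derivative 1 / (1 + (w0 \<xi>)\<^sup>2)) (at \<xi>)"
proof -
  have "(y0 has_real_derivative inverse (1 + (D (y0 \<xi>))\<^sup>2)) (at \<xi>)"
  proof (rule DERIV_inverse_function[where f = Y and a = "\<xi> - 1" and b = "\<xi> + 1"])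
    show "(Y has_real_derivative 1 + (D (y0 \<xi>))\<^sup>2) (at (y0 \<xi>))" by (rule Y_has_derivative)
    show "1 + (D (y0 \<xi>))\<^sup>2 \<noteq> 0" by (simp add: add_nonneg_eq_0_iff)
    show "isCont y0 \<xi>" using y0_cont[of UNIV] by (simp add: continuous_on_eq_continuous_at)
  qed (auto simp: Y_y0)
  then show ?thesis by (simp add: w0_def inverse_eq_divide)
qed

lemma u0_y0_has_derivative: "((\<lambda>\<xi>. u0 (y0 \<xi>)) has_real_derivative w0 \<xi> / (1 + (w0 \<xi>)\<^sup>2)) (at \<xi>)"
  using DERIV_chain2[OF D y0_has_derivative] by (simp add: w0_def)

lemma w0_bound: "\<bar>w0 \<xi>\<bar> \<le> M"
  by (simp add: w0_def D_bound)

lemma w0_Lipschitz: "\<bar>w0 \<xi> - w0 \<eta>\<bar> \<le> \<Lambda> * \<bar>\<xi> - \<eta>\<bar>"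
  using D_Lipschitz[of "y0 \<xi>" "y0 \<eta>"] mult_left_mono[OF y0_Lipschitz \<Lambda>_nonneg, of \<xi> \<eta>]
  by (simp add: w0_def)

lemma w0_cont: "continuous_on S w0"
proof -
  have "\<Lambda>-lipschitz_on S w0"
    using w0_Lipschitz \<Lambda>_nonneg by (auto simp: lipschitz_on_def dist_real_def)
  then show ?thesis by (rule lipschitz_on_continuous_on)
qed

lemma w0_meas [measurable]: "w0 \<in> borel_measurable borel"
  by (rule borel_measurable_continuous_onI[OF w0_cont])

definition E where "E = M * (1 + M\<^sup>2) * V"

text \<open>Let f' = w0 / (1 + w0^2), the derivative of \<open>u0\<close> composed with
  \<open>y0\<close>. Then w0^2 = |w0| * (1 + w0^2) * |f'|, which is at most M * (1 + M^2) * |f'|,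
  and the integral of |f'| is at most the total variation of \<open>u0\<close>. Bounded variation
  thus yields a finite energy in the label.\<close>

lemma w0_square_integrable: "integrable lborel (\<lambda>\<xi>. (w0 \<xi>)\<^sup>2)" "(LBINT \<xi>. (w0 \<xi>)\<^sup>2) \<le> E"
proof -
  define f' where "f' \<xi> = w0 \<xi> / (1 + (w0 \<xi>)\<^sup>2)" for \<xi>
  have f'_lip: "\<bar>f' \<xi> - f' \<eta>\<bar> \<le> \<Lambda> * \<bar>\<xi> - \<eta>\<bar>" for \<xi> \<eta>
    unfolding f'_def using abs_diff_over_one_plus_square_le w0_Lipschitz order_trans by blast
  have f'_cont: "continuous_on S f'" for S
    unfolding f'_def by (intro continuous_intros w0_cont) (simp add: add_nonneg_eq_0_iff)
  have [measurable]: "f' \<in> borel_measurable borel" by (rule borel_measurable_continuous_onI[OF f'_cont])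
  have tv: "total_variation (\<lambda>\<xi>. u0 (y0 \<xi>)) \<le> ennreal V"
    using total_variation_compose_mono[OF y0_mono, of u0] variation by (rule order_trans)
  have int: "integral {c..d} (\<lambda>\<xi>. \<bar>f' \<xi>\<bar>) \<le> V" if "c \<le> d" for c d
    using integral_abs_derivative_le_variation[OF _ f'_lip tv V_nonneg that] u0_y0_has_derivative
    by (simp add: f'_def)
  have n: "(\<integral>\<^sup>+\<xi>. ennreal \<bar>f' \<xi>\<bar> * indicator {- real n..real n} \<xi> \<partial>lborel) \<le> ennreal V" for n
  proof -
    have si: "set_integrable lborel {- real n..real n} (\<lambda>\<xi>. \<bar>f' \<xi>\<bar>)"
      by (intro borel_integrable_atLeastAtMost' continuous_intros f'_cont)
    have "(\<integral>\<^sup>+\<xi>. ennreal \<bar>f' \<xi>\<bar> * indicator {- real n..real n} \<xi> \<partial>lborel)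
        = (\<integral>\<^sup>+\<xi>. ennreal (indicator {- real n..real n} \<xi> *\<^sub>R \<bar>f' \<xi>\<bar>) \<partial>lborel)"
      by (intro nn_integral_cong) (auto simp: indicator_def)
    also have "\<dots> = ennreal (LBINT \<xi>:{- real n..real n}. \<bar>f' \<xi>\<bar>)"
      unfolding set_lebesgue_integral_def
      by (intro nn_integral_eq_integral) (use si in \<open>auto simp: set_integrable_def\<close>)
    also have "(LBINT \<xi>:{- real n..real n}. \<bar>f' \<xi>\<bar>) = integral {- real n..real n} (\<lambda>\<xi>. \<bar>f' \<xi>\<bar>)"
      by (rule set_borel_integral_eq_integral(2)[OF si])
    finally show ?thesis using int[of "- real n" "real n"] V_nonneg by (simp add: ennreal_le_iff)
  qed
  have "(\<integral>\<^sup>+\<xi>. ennreal \<bar>f' \<xi>\<bar> \<partial>lborel) = (\<integral>\<^sup>+\<xi>. (SUP n. ennreal \<bar>f' \<xi>\<bar> * indicator {- real n..real n} \<xi>) \<partial>lborel)"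
  proof (intro nn_integral_cong antisym)
    fix \<xi>
    obtain n :: nat where "\<bar>\<xi>\<bar> \<le> real n" using real_arch_simple by blast
    then have "ennreal \<bar>f' \<xi>\<bar> = ennreal \<bar>f' \<xi>\<bar> * indicator {- real n..real n} \<xi>" by (auto simp: indicator_def)
    also have "\<dots> \<le> (SUP n. ennreal \<bar>f' \<xi>\<bar> * indicator {- real n..real n} \<xi>)" by (rule SUP_upper) simp
    finally show "ennreal \<bar>f' \<xi>\<bar> \<le> (SUP n. ennreal \<bar>f' \<xi>\<bar> * indicator {- real n..real n} \<xi>)" .
    show "(SUP n. ennreal \<bar>f' \<xi>\<bar> * indicator {- real n..real n} \<xi>) \<le> ennreal \<bar>f' \<xi>\<bar>"
      by (rule SUP_least) (auto simp: indicator_def)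
  qed
  also have "\<dots> = (SUP n. (\<integral>\<^sup>+\<xi>. ennreal \<bar>f' \<xi>\<bar> * indicator {- real n..real n} \<xi> \<partial>lborel))"
    by (rule nn_integral_monotone_convergence_SUP) (auto simp: incseq_def le_fun_def indicator_def)
  also have "\<dots> \<le> ennreal V" by (rule SUP_least) (rule n)
  finally have nn: "(\<integral>\<^sup>+\<xi>. ennreal \<bar>f' \<xi>\<bar> \<partial>lborel) \<le> ennreal V" .
  have absint: "integrable lborel (\<lambda>\<xi>. \<bar>f' \<xi>\<bar>)"
    using nn by (intro integrableI_nonneg) (auto simp: le_less_trans)
  have absle: "(LBINT \<xi>. \<bar>f' \<xi>\<bar>) \<le> V"
    using nn V_nonneg by (subst (asm) nn_integral_eq_integral[OF absint]) (auto simp: ennreal_le_iff)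
  have ptw: "(w0 \<xi>)\<^sup>2 \<le> M * (1 + M\<^sup>2) * \<bar>f' \<xi>\<bar>" for \<xi>
  proof -
    have pos: "1 + (w0 \<xi>)\<^sup>2 > 0" by (simp add: add_pos_nonneg)
    have sq: "(w0 \<xi>)\<^sup>2 \<le> M\<^sup>2" using w0_bound[of \<xi>] M_nonneg by (metis abs_of_nonneg abs_le_square_iff)
    have "(w0 \<xi>)\<^sup>2 = (\<bar>w0 \<xi>\<bar> * (1 + (w0 \<xi>)\<^sup>2)) * \<bar>f' \<xi>\<bar>"
      using pos by (simp add: f'_def abs_mult abs_divide power2_eq_square)
    also have "\<dots> \<le> (M * (1 + M\<^sup>2)) * \<bar>f' \<xi>\<bar>"
      using w0_bound M_nonneg sq by (intro mult_right_mono mult_mono) auto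
    finally show ?thesis .
  qed
  show I: "integrable lborel (\<lambda>\<xi>. (w0 \<xi>)\<^sup>2)"
  proof (rule Bochner_Integration.integrable_bound[OF integrable_mult_right[OF absint, of "M * (1 + M\<^sup>2)"]])
    show "AE \<xi> in lborel. norm ((w0 \<xi>)\<^sup>2) \<le> norm (M * (1 + M\<^sup>2) * \<bar>f' \<xi>\<bar>)"
      using ptw M_nonneg by (auto simp: abs_mult)
  qed simp
  have "(LBINT \<xi>. (w0 \<xi>)\<^sup>2) \<le> (LBINT \<xi>. M * (1 + M\<^sup>2) * \<bar>f' \<xi>\<bar>)"
    by (intro integral_mono I integrable_mult_right absint ptw)
  also have "\<dots> \<le> E"
    using absle M_nonneg by (simp add: E_def mult_left_mono)
  finally show "(LBINT \<xi>. (w0 \<xi>)\<^sup>2) \<le> E" .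
qed

end

section \<open>Comparison with the limiting profile\<close>

lemma abs_cos_diff_le: "\<bar>cos x - cos y\<bar> \<le> \<bar>x - y\<bar>" for x y :: real
proof -
  have "\<bar>cos x - cos y\<bar> = 2 * (\<bar>sin ((x + y) / 2)\<bar> * \<bar>sin ((y - x) / 2)\<bar>)"
    by (simp add: cos_diff_cos abs_mult)
  also have "\<dots> \<le> 2 * (1 * \<bar>(y - x) / 2\<bar>)"
    by (intro mult_left_mono mult_mono abs_sin_x_le_abs_x) auto
  finally show ?thesis by simp
qed

lemma abs_sin_diff_le: "\<bar>sin x - sin y\<bar> \<le> \<bar>x - y\<bar>" for x y :: real
proof -
  have "\<bar>sin x - sin y\<bar> = 2 * (\<bar>sin ((x - y) / 2)\<bar> * \<bar>cos ((x + y) / 2)\<bar>)"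
    by (simp add: sin_diff_sin abs_mult)
  also have "\<dots> \<le> 2 * (\<bar>(x - y) / 2\<bar> * 1)"
    by (intro mult_left_mono mult_mono abs_sin_x_le_abs_x) auto
  finally show ?thesis by simp
qed

lemma sin_half_square: "(sin (x / 2))\<^sup>2 = (1 - cos x) / 2" for x :: real
  using cos_double_sin[of "x / 2"] by simp

lemma abs_sin_half_square_diff_le: "\<bar>(sin (x / 2))\<^sup>2 - (sin (y / 2))\<^sup>2\<bar> \<le> \<bar>x - y\<bar>" for x y :: real
proof -
  have "(sin (x / 2))\<^sup>2 - (sin (y / 2))\<^sup>2 = (cos y - cos x) / 2"
    by (simp add: sin_half_square field_simps)
  then show ?thesis using abs_cos_diff_le[of x y] by (simp add: abs_if split: if_splits)
qed

lemma sin_arctan_square: "(sin (arctan x))\<^sup>2 = x\<^sup>2 / (1 + x\<^sup>2)"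
  by (simp add: sin_arctan power_divide add_nonneg_nonneg)

text \<open>The complement of the closure is open and null, hence empty. This is how identities that
  are known for almost every label reach all labels.\<close>

lemma AE_lborel_closure:
  fixes S :: "real set"
  assumes "AE x in lborel. x \<in> S"
  shows "closure S = UNIV"
proof (rule ccontr)
  assume "closure S \<noteq> UNIV"
  then have ne: "- closure S \<noteq> {}" by auto
  have "AE x in lborel. x \<notin> - closure S"
    using assms by eventually_elim (use closure_subset in auto)
  then have "- closure S \<in> null_sets lborel"
    by (subst AE_iff_null_sets) auto
  then have "negligible (- closure S)"
    by (simp add: negligible_iff_null_sets null_sets_completionI)
  then show False using open_not_negligible[of "- closure S"] ne by auto
qed

context initial_datum
begin

text \<open>The deviation \<open>\<delta>\<close> of \<open>v\<close> from the limiting profile below forces \<open>P\<close> to be at most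
  \<open>2 * qmax * E / l + qmax * \<delta>\<^sup>2 / (4 * rate)\<close>, and by Gronwall this gives back
  \<open>\<delta> \<le> K1 / l + K2 * \<delta>\<^sup>2\<close>.  The threshold \<open>eta l\<close> is chosen so that this inequality improves
  \<open>\<delta> \<le> eta l\<close> to \<open>\<delta> \<le> 3 / 4 * eta l\<close> for large \<open>l\<close>.\<close>

definition qmin where "qmin = exp (- (T + 1))"
definition qmax where "qmax = exp (T + 1)"
text \<open>The limiting profile is bounded by 2 * arctan (2 * M), and the improved bounds for
  \<open>q\<close> are exp (- T) and exp T. The 1 added here, like those in the exponents of
  \<open>qmin\<close> and \<open>qmax\<close>, leaves the gap that the bootstrap needs.\<close>

definition vmax where "vmax = 2 * arctan (2 * M + 1)"
definition rate where "rate = qmin * (cos (vmax / 2))\<^sup>2"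
definition K1 where "K1 = 4 * qmax * T * E * exp T"
definition K2 where "K2 = qmax * T * exp T / (2 * rate)"
definition eta where "eta l = 4 * (K1 + 1) / l"
definition Pmax where "Pmax l = 2 * qmax * E / l + qmax * (eta l)\<^sup>2 / (4 * rate)"

text \<open>In turn, the conditions make Lipschitz constants free of \<open>l\<close>, keep
  \<open>v\<close> within \<open>vmax\<close>, absorb the quadratic term of the bootstrap, and bound
  the growth rate of \<open>q\<close> by 1.\<close>

definition large where
  "large l \<longleftrightarrow> l \<ge> 1 \<and> eta l \<le> vmax - 2 * arctan (2 * M) \<and> K2 * eta l \<le> 1 / 2 \<and> Pmax l \<le> 1 / 2"

lemma vmax_bounds: "0 \<le> vmax" "vmax < pi"
  using M_nonneg arctan_ubound[of "2 * M + 1"] by (auto simp: vmax_def)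

lemma rate_pos: "rate > 0"
proof -
  have "cos (vmax / 2) > 0" using vmax_bounds by (intro cos_gt_zero_pi) auto
  then show ?thesis by (simp add: rate_def qmin_def)
qed

lemma E_nonneg: "E \<ge> 0"
  using M_nonneg V_nonneg by (simp add: E_def)

lemma K1_nonneg: "K1 \<ge> 0"
  using E_nonneg T by (simp add: K1_def qmax_def)

lemma eventually_large: "\<forall>\<^sub>F l in at_top. large l"
proof -
  have inv: "((\<lambda>l::real. c / l) \<longlongrightarrow> 0) at_top" for c
    by (rule tendsto_divide_0[OF tendsto_const filterlim_at_top_imp_at_infinity[OF filterlim_ident]])
  have e: "(eta \<longlongrightarrow> 0) at_top" unfolding eta_def by (rule inv)
  have "((\<lambda>l. K2 * eta l) \<longlongrightarrow> K2 * 0) at_top" by (intro tendsto_intros e)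
  then have k: "\<forall>\<^sub>F l in at_top. K2 * eta l < 1 / 2" by (rule order_tendstoD) simp
  have "(Pmax \<longlongrightarrow> 0 + qmax * 0\<^sup>2 / (4 * rate)) at_top"
    unfolding Pmax_def using rate_pos by (intro tendsto_intros inv e) auto
  then have p: "\<forall>\<^sub>F l in at_top. Pmax l < 1 / 2" by (rule order_tendstoD) simp
  have "2 * arctan (2 * M) < vmax" by (simp add: vmax_def arctan_less_iff)
  then have "\<forall>\<^sub>F l in at_top. eta l < vmax - 2 * arctan (2 * M)"
    by (intro order_tendstoD(2)[OF e]) simp
  with k p eventually_ge_at_top[of 1] show ?thesis
    by eventually_elim (simp add: large_def)
qed

text \<open>The solution of \<open>v\<^sub>t = - sin\<^sup>2 (v / 2)\<close>, the limiting equation in which \<open>P = 0\<close>.\<close>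

definition vinf where "vinf t \<xi> = 2 * arctan (w0 \<xi> / (1 + w0 \<xi> * t / 2))"

text \<open>The condition \<open>M * T < 1\<close> enters here. The profile cannot break before time
  2 / M, twice the admissible time, so at least half of the denominator is left.\<close>

lemma denominator_ge:
  assumes "t \<in> {0..T}"
  shows "1 + w0 \<xi> * t / 2 \<ge> 1 / 2"
proof -
  have "\<bar>w0 \<xi> * t\<bar> \<le> M * T"
    unfolding abs_mult using assms w0_bound M_nonneg by (intro mult_mono) auto
  then show ?thesis using T by simp
qed

lemma vinf_arg_le:
  assumes "t \<in> {0..T}"
  shows "\<bar>w0 \<xi> / (1 + w0 \<xi> * t / 2)\<bar> \<le> 2 * \<bar>w0 \<xi>\<bar>"
proof -
  have d: "1 + w0 \<xi> * t / 2 \<ge> 1 / 2" by (rule denominator_ge[OF assms])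
  have "\<bar>w0 \<xi>\<bar> / (1 + w0 \<xi> * t / 2) \<le> \<bar>w0 \<xi>\<bar> / (1 / 2)"
    using d by (intro divide_left_mono) auto
  then show ?thesis using d by (simp add: abs_divide)
qed

lemma vinf_bound:
  assumes "t \<in> {0..T}"
  shows "\<bar>vinf t \<xi>\<bar> \<le> 2 * arctan (2 * M)"
proof -
  have "\<bar>w0 \<xi> / (1 + w0 \<xi> * t / 2)\<bar> \<le> 2 * M"
    using vinf_arg_le[OF assms, of \<xi>] w0_bound[of \<xi>] by linarith
  then have "arctan \<bar>w0 \<xi> / (1 + w0 \<xi> * t / 2)\<bar> \<le> arctan (2 * M)" by (simp add: arctan_le_iff)
  moreover have "\<bar>arctan x\<bar> = arctan \<bar>x\<bar>" for x by (cases "x \<ge> 0") (auto simp: arctan_minus)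
  ultimately show ?thesis by (simp add: vinf_def abs_mult)
qed

lemma sin_vinf_square_le:
  assumes "t \<in> {0..T}"
  shows "(sin (vinf t \<xi> / 2))\<^sup>2 \<le> 4 * (w0 \<xi>)\<^sup>2"
proof -
  define W where "W = w0 \<xi> / (1 + w0 \<xi> * t / 2)"
  have "(sin (vinf t \<xi> / 2))\<^sup>2 = W\<^sup>2 / (1 + W\<^sup>2)"
    by (simp add: vinf_def W_def[symmetric] sin_arctan_square)
  also have "\<dots> \<le> W\<^sup>2 / 1" by (intro divide_left_mono) (auto simp: add_pos_nonneg)
  also have "W\<^sup>2 \<le> (2 * w0 \<xi>)\<^sup>2"
  proof -
    have "\<bar>W\<bar> \<le> \<bar>2 * w0 \<xi>\<bar>" using vinf_arg_le[OF assms, of \<xi>] by (simp add: W_def abs_mult)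
    then show ?thesis by (simp only: abs_le_square_iff)
  qed
  finally show ?thesis by (simp add: power_mult_distrib)
qed

lemma vinf_has_derivative:
  assumes "t \<in> {0..T}"
  shows "((\<lambda>t. vinf t \<xi>) has_real_derivative - (sin (vinf t \<xi> / 2))\<^sup>2) (at t within S)"
proof -
  define d where "d = 1 + w0 \<xi> * t / 2"
  define W where "W = w0 \<xi> / d"
  have d: "d > 0" using denominator_ge[OF assms, of \<xi>] by (simp add: d_def)
  have "(sin (vinf t \<xi> / 2))\<^sup>2 = W\<^sup>2 / (1 + W\<^sup>2)"
    by (simp add: vinf_def W_def[symmetric] d_def[symmetric] sin_arctan_square)
  moreover have "((\<lambda>t. w0 \<xi> / (1 + w0 \<xi> * t / 2)) has_real_derivative - (W\<^sup>2 / 2)) (at t within S)"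
  proof -
    have dd: "((\<lambda>t. 1 + w0 \<xi> * t / 2) has_real_derivative w0 \<xi> / 2) (at t within S)"
      by (auto intro!: derivative_eq_intros)
    have "(0 * d - w0 \<xi> * (w0 \<xi> / 2)) / (d * d) = - (W\<^sup>2 / 2)"
      using d by (simp add: W_def power2_eq_square)
    moreover have "((\<lambda>t. w0 \<xi> / (1 + w0 \<xi> * t / 2)) has_real_derivative (0 * d - w0 \<xi> * (w0 \<xi> / 2)) / (d * d)) (at t within S)"
      unfolding d_def using d by (intro DERIV_divide DERIV_const dd) (simp add: d_def)
    ultimately show ?thesis by (simp only:)
  qed
  then have "((\<lambda>t. 2 * arctan (w0 \<xi> / (1 + w0 \<xi> * t / 2))) has_real_derivative 2 * (inverse (1 + W\<^sup>2) * - (W\<^sup>2 / 2))) (at t within S)"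
    unfolding W_def d_def by (intro DERIV_cmult DERIV_chain2[OF DERIV_arctan])
  moreover have "2 * (inverse (1 + W\<^sup>2) * - (W\<^sup>2 / 2)) = - (W\<^sup>2 / (1 + W\<^sup>2))"
    by (simp only: divide_inverse) simp
  ultimately show ?thesis by (simp only: vinf_def)
qed

lemma vinf_has_integral:
  assumes "t \<in> {0..T}"
  shows "((\<lambda>s. - (sin (vinf s \<xi> / 2))\<^sup>2) has_integral vinf t \<xi> - vinf 0 \<xi>) {0..t}"
  using assms vinf_has_derivative
  by (intro fundamental_theorem_of_calculus) (auto simp flip: has_real_derivative_iff_has_vector_derivative)

lemma vinf_time_Lipschitz:
  assumes "s \<in> {0..T}" "t \<in> {0..T}"
  shows "\<bar>vinf s \<xi> - vinf t \<xi>\<bar> \<le> \<bar>s - t\<bar>"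
proof -
  have "norm (vinf s \<xi> - vinf t \<xi>) \<le> 1 * norm (s - t)"
    by (rule field_differentiable_bound[where f' = "\<lambda>t. - (sin (vinf t \<xi> / 2))\<^sup>2" and S = "{0..T}"])
      (use assms vinf_has_derivative in \<open>auto simp: abs_square_le_1\<close>)
  then show ?thesis by simp
qed

lemma vinf_meas [measurable]: "vinf t \<in> borel_measurable borel"
  unfolding vinf_def[abs_def] by measurable

end

section \<open>The bootstrap for one solution\<close>

locale lagrangian_flow = initial_datum +
  fixes l :: real and v q :: "real \<Rightarrow> real \<Rightarrow> real"
  assumes large: "large l" and solution: "lagrangian_solution l u0 y0 v q"
begin

lemma l_ge_1: "l \<ge> 1" and eta_le: "eta l \<le> vmax - 2 * arctan (2 * M)"
  and K2_eta: "K2 * eta l \<le> 1 / 2" and Pmax_le: "Pmax l \<le> 1 / 2"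
  using large by (auto simp: large_def)

lemma eta_pos: "eta l > 0"
  using K1_nonneg l_ge_1 by (simp add: eta_def)

lemma v_meas: "t \<ge> 0 \<Longrightarrow> v t \<in> borel_measurable borel"
  and q_meas: "t \<ge> 0 \<Longrightarrow> q t \<in> borel_measurable borel"
  using solution by (auto simp: lagrangian_solution_def C_Linf_def)

definition good where
  "good \<xi> \<longleftrightarrow> v 0 \<xi> = 2 * arctan (w0 \<xi>) \<and> q 0 \<xi> = 1 \<and>
     (\<forall>t\<ge>0. ((\<lambda>s. v_rhs l (v s) (q s) \<xi>) has_integral (v t \<xi> - v 0 \<xi>)) {0..t} \<and>
            ((\<lambda>s. q_rhs l (v s) (q s) \<xi>) has_integral (q t \<xi> - q 0 \<xi>)) {0..t})"

lemma AE_good: "AE \<xi> in lborel. good \<xi>"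
proof -
  have "AE \<xi> in lborel. v 0 \<xi> = 2 * arctan (deriv u0 (y0 \<xi>)) \<and> q 0 \<xi> = 1"
    and "AE \<xi> in lborel. \<forall>t\<ge>0. ((\<lambda>s. v_rhs l (v s) (q s) \<xi>) has_integral (v t \<xi> - v 0 \<xi>)) {0..t} \<and>
            ((\<lambda>s. q_rhs l (v s) (q s) \<xi>) has_integral (q t \<xi> - q 0 \<xi>)) {0..t}"
    using solution by (auto simp: lagrangian_solution_def)
  then show ?thesis by eventually_elim (auto simp: good_def deriv_u0 w0_def)
qed

text \<open>The bootstrap hypothesis at a single time, with a null set that may depend on the time.
  \<open>bounded_upto\<close> is its counterpart for a single label and all times at once.\<close>

definition near where
  "near t \<longleftrightarrow> (AE \<xi> in lborel. \<bar>v t \<xi> - vinf t \<xi>\<bar> \<le> eta l \<and> qmin \<le> q t \<xi> \<and> q t \<xi> \<le> qmax)"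

lemma v_bound_if_close:
  assumes "t \<in> {0..T}" "\<bar>v t \<xi> - vinf t \<xi>\<bar> \<le> eta l"
  shows "\<bar>v t \<xi>\<bar> \<le> vmax"
  using vinf_bound[OF assms(1), of \<xi>] assms(2) eta_le by linarith

lemma near_profile:
  assumes "near t" "t \<in> {0..T}"
  shows "profile l qmin qmax vmax (v t) (q t)"
proof
  show "AE \<xi> in lborel. \<bar>v t \<xi>\<bar> \<le> vmax \<and> qmin \<le> q t \<xi> \<and> q t \<xi> \<le> qmax"
    using assms(1) unfolding near_def
    by eventually_elim (use v_bound_if_close[OF assms(2)] in auto)
qed (use l_ge_1 vmax_bounds v_meas q_meas assms in \<open>auto simp: qmin_def\<close>)

text \<open>For x = sin (v / 2) and y = sin (vinf / 2), x^2 is at most 2 * (x - y)^2 + 2 * y^2. The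
  first term is at most eta^2 / 2 and the second at most 8 * w0^2, which is integrable.
  \<open>P_lag_le\<close> with these two parts gives exactly \<open>Pmax\<close>.\<close>

lemma near_P_lag:
  assumes "near t" "t \<in> {0..T}"
  shows "0 \<le> P_lag l (v t) (q t) \<xi>" "P_lag l (v t) (q t) \<xi> \<le> Pmax l"
proof -
  interpret P: profile l qmin qmax vmax "v t" "q t" by (rule near_profile[OF assms])
  show "0 \<le> P_lag l (v t) (q t) \<xi>" by (rule P.P_lag_nonneg)
  have "P_lag l (v t) (q t) \<xi> \<le> qmax * (8 * E) / (4 * l) + qmax * ((eta l)\<^sup>2 / 2) / (2 * P.g)"
  proof (rule P.P_lag_le[where h = "\<lambda>\<xi>. 8 * (w0 \<xi>)\<^sup>2"])
    show "AE \<xi> in lborel. (sin (v t \<xi> / 2))\<^sup>2 \<le> 8 * (w0 \<xi>)\<^sup>2 + (eta l)\<^sup>2 / 2"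
      using assms(1) unfolding near_def
    proof eventually_elim
      case (elim \<xi>)
      define x y where "x = sin (v t \<xi> / 2)" and "y = sin (vinf t \<xi> / 2)"
      have "\<bar>x - y\<bar> \<le> eta l / 2"
        using abs_sin_diff_le[of "v t \<xi> / 2" "vinf t \<xi> / 2"] elim
        by (simp add: x_def y_def flip: diff_divide_distrib)
      then have 1: "(x - y)\<^sup>2 \<le> (eta l / 2)\<^sup>2"
        using eta_pos by (simp flip: abs_le_square_iff)
      have "0 \<le> (x - 2 * y)\<^sup>2" by simp
      then have "x\<^sup>2 \<le> 2 * (x - y)\<^sup>2 + 2 * y\<^sup>2"
        by (simp add: power2_diff power_mult_distrib)
      also have "\<dots> \<le> 2 * (eta l / 2)\<^sup>2 + 2 * (4 * (w0 \<xi>)\<^sup>2)"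
        using 1 sin_vinf_square_le[OF assms(2), of \<xi>] by (auto simp: y_def)
      finally show ?case by (simp add: x_def power_divide)
    qed
    show "(LBINT \<xi>. 8 * (w0 \<xi>)\<^sup>2) \<le> 8 * E" using w0_square_integrable by simp
  qed (use w0_square_integrable in auto)
  also have "P.g = rate" by (simp add: P.g_def rate_def)
  finally show "P_lag l (v t) (q t) \<xi> \<le> Pmax l" by (simp add: Pmax_def)
qed

definition bounded_upto where
  "bounded_upto \<tau> \<xi> \<longleftrightarrow> good \<xi> \<and>
     (\<forall>s\<in>{0..\<tau>}. \<bar>v s \<xi> - vinf s \<xi>\<bar> \<le> eta l \<and> qmin \<le> q s \<xi> \<and> q s \<xi> \<le> qmax)"

lemma good_continuous:
  assumes "good \<xi>"
  shows "continuous_on {0..\<tau>} (\<lambda>t. v t \<xi>)" "continuous_on {0..\<tau>} (\<lambda>t. q t \<xi>)"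
  using assms unfolding good_def
  by (auto intro!: has_integral_imp_continuous_on[of \<tau> _ "\<lambda>t. v t \<xi>"] has_integral_imp_continuous_on[of \<tau> _ "\<lambda>t. q t \<xi>"])

text \<open>One null set for all times: countably many times that are dense in the interval have a
  common null set, and for a good label the curves are continuous in time, so the closed bounds
  extend to the remaining times.\<close>

lemma AE_bounded_upto:
  assumes near: "\<And>s. s \<in> {0..\<tau>} \<Longrightarrow> near s" and \<tau>: "\<tau> \<in> {0..T}"
  shows "AE \<xi> in lborel. bounded_upto \<tau> \<xi>"
proof -
  \<comment> \<open>The point 0 is inserted for the case \<open>\<tau> = 0\<close>, in which the
    open interval is empty.\<close>
  define C where "C = insert 0 ({0<..<\<tau>} \<inter> \<rat>)"
  have count: "countable C" unfolding C_def using countable_rat by (auto intro: countable_subset)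
  have sub: "C \<subseteq> {0..\<tau>}" using \<tau> by (auto simp: C_def)
  have cl: "{0..\<tau>} \<subseteq> closure C"
  proof (cases "\<tau> = 0")
    case True
    then show ?thesis using closure_subset[of C] by (auto simp: C_def)
  next
    case False
    have "closure ({0<..<\<tau>} \<inter> \<rat>) = closure {0<..<\<tau>}"
      by (rule closure_open_Int_superset) (auto simp: Rats_closure_real)
    moreover have "closure {0<..<\<tau>} = {0..\<tau>}" using False \<tau> by (intro closure_greaterThanLessThan) auto
    ultimately show ?thesis using closure_mono[of "{0<..<\<tau>} \<inter> \<rat>" C] by (auto simp: C_def)
  qed
  have "AE \<xi> in lborel. \<forall>s\<in>C. \<bar>v s \<xi> - vinf s \<xi>\<bar> \<le> eta l \<and> qmin \<le> q s \<xi> \<and> q s \<xi> \<le> qmax"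
    using near sub by (subst AE_ball_countable[OF count]) (auto simp: near_def)
  then show ?thesis using AE_good
  proof eventually_elim
    case (elim \<xi>)
    have clsub: "closure C \<subseteq> {0..\<tau>}" using closure_minimal[OF sub] by simp
    have vc: "continuous_on (closure C) (\<lambda>s. v s \<xi>)" and qc: "continuous_on (closure C) (\<lambda>s. q s \<xi>)"
      using good_continuous[OF elim(2)] continuous_on_subset clsub by blast+
    have ic: "continuous_on (closure C) (\<lambda>s. vinf s \<xi>)"
      by (rule continuous_on_subset[OF _ clsub], rule has_integral_imp_continuous_on, rule vinf_has_integral) (use \<tau> in auto)
    have "\<bar>v s \<xi> - vinf s \<xi>\<bar> \<le> eta l \<and> qmin \<le> q s \<xi> \<and> q s \<xi> \<le> qmax" if "s \<in> {0..\<tau>}" for s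
    proof (intro conjI)
      have s: "s \<in> closure C" using that cl by auto
      show "\<bar>v s \<xi> - vinf s \<xi>\<bar> \<le> eta l"
        by (rule continuous_le_on_closure[OF _ s, where f = "\<lambda>s. \<bar>v s \<xi> - vinf s \<xi>\<bar>"])
          (use vc ic elim(1) in \<open>auto intro!: continuous_intros\<close>)
      show "q s \<xi> \<le> qmax"
        by (rule continuous_le_on_closure[OF qc s]) (use elim(1) in auto)
      show "qmin \<le> q s \<xi>"
        by (rule continuous_ge_on_closure[OF qc s]) (use elim(1) in auto)
    qed
    then show ?case using elim(2) by (simp add: bounded_upto_def)
  qed
qed

text \<open>The curve of \<open>v\<close> is compared with that of \<open>vinf\<close>, which starts
  at the same value; the terms with P are the mismatch, at most 2 * Pmax. Gronwall then gives 2 *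
  Pmax * T * exp T = K1 / l + K2 * eta^2, the origin of \<open>K1\<close> and \<open>K2\<close>. The
  logarithmic rate of \<open>q\<close> is at most 1 because P lies between 0 and 1/2.\<close>

lemma improved_bounds:
  assumes near: "\<And>s. s \<in> {0..\<tau>} \<Longrightarrow> near s" and \<tau>: "\<tau> \<in> {0..T}"
    and \<xi>: "bounded_upto \<tau> \<xi>" and t: "t \<in> {0..\<tau>}"
  shows "\<bar>v t \<xi> - vinf t \<xi>\<bar> \<le> 3 / 4 * eta l" "exp (- T) \<le> q t \<xi>" "q t \<xi> \<le> exp T"
proof -
  have good: "good \<xi>" using \<xi> by (simp add: bounded_upto_def)
  have int: "((\<lambda>s. v_rhs l (v s) (q s) \<xi>) has_integral (v r \<xi> - v 0 \<xi>)) {0..r}"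
    "((\<lambda>s. q_rhs l (v s) (q s) \<xi>) has_integral (q r \<xi> - q 0 \<xi>)) {0..r}" if "r \<in> {0..\<tau>}" for r
    using good that by (auto simp: good_def)
  have P: "0 \<le> P_lag l (v s) (q s) \<xi>" "P_lag l (v s) (q s) \<xi> \<le> Pmax l" if "s \<in> {0..\<tau>}" for s
    using near_P_lag[OF near[OF that], of \<xi>] that \<tau> by auto
  have vgt: "v s \<xi> > - pi" if "s \<in> {0..\<tau>}" for s
    using v_bound_if_close[of s \<xi>] \<xi> that \<tau> vmax_bounds by (force simp: bounded_upto_def)
  have Pm: "Pmax l \<ge> 0" using P[OF t] by linarith
  have "\<bar>v t \<xi> - vinf t \<xi>\<bar> \<le> (\<bar>v 0 \<xi> - vinf 0 \<xi>\<bar> + 2 * Pmax l * t) * exp (1 * t)"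
  proof (rule ode_stability[OF int(1) vinf_has_integral])
    fix s assume s: "s \<in> {0..\<tau>}"
    have eq: "v_rhs l (v s) (q s) \<xi> - - (sin (vinf s \<xi> / 2))\<^sup>2
      = - (P_lag l (v s) (q s) \<xi> * (1 + cos (v s \<xi>))) - ((sin (v s \<xi> / 2))\<^sup>2 - (sin (vinf s \<xi> / 2))\<^sup>2)"
      using vgt[OF s] by (simp add: v_rhs_def)
    have "\<bar>P_lag l (v s) (q s) \<xi> * (1 + cos (v s \<xi>))\<bar> \<le> Pmax l * 2"
      
    proof -
      have "\<bar>1 + cos (v s \<xi>)\<bar> \<le> 2"
        using cos_ge_minus_one[of "v s \<xi>"] cos_le_one[of "v s \<xi>"] by linarith
      then show ?thesis unfolding abs_mult using P[OF s] Pm by (intro mult_mono) auto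
    qed
    then show "\<bar>v_rhs l (v s) (q s) \<xi> - - (sin (vinf s \<xi> / 2))\<^sup>2\<bar> \<le> 2 * Pmax l + 1 * \<bar>v s \<xi> - vinf s \<xi>\<bar>"
      unfolding eq mult_1 mult.commute[of 2]
      by (intro order_trans[OF abs_triangle_ineq4] add_mono abs_sin_half_square_diff_le) (simp only: abs_minus_cancel)
  qed (use \<tau> t Pm in auto)
  also have "\<dots> = 2 * Pmax l * t * exp t"
    using good by (simp add: good_def vinf_def)
  also have "\<dots> \<le> 2 * Pmax l * T * exp T"
    using t \<tau> Pm by (intro mult_mono) auto
  also have "\<dots> = K1 / l + K2 * (eta l)\<^sup>2"
    using l_ge_1 rate_pos by (simp add: Pmax_def K1_def K2_def field_simps)
  \<comment> \<open>In \<open>eta l = 4 * (K1 + 1) / l\<close> the factor 4 makes the first term a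
    quarter of \<open>eta\<close>, and the summand 1 keeps \<open>eta\<close> positive when
    \<open>K1 = 0\<close>. The second term uses \<open>K2 * eta l \<le> 1 / 2\<close>.\<close>
  also have "\<dots> \<le> eta l / 4 + eta l / 2"
  proof (rule add_mono)
    have e: "eta l / 4 = (K1 + 1) / l" unfolding eta_def by (metis divide_divide_eq_left' nonzero_mult_div_cancel_left times_divide_eq_right zero_neq_numeral)
    show "K1 / l \<le> eta l / 4" unfolding e using l_ge_1 by (intro divide_right_mono) auto
    have "(K2 * eta l) * eta l \<le> 1 / 2 * eta l"
      using K2_eta eta_pos by (intro mult_right_mono) auto
    then show "K2 * (eta l)\<^sup>2 \<le> eta l / 2" by (simp add: power2_eq_square)
  qed
  finally show "\<bar>v t \<xi> - vinf t \<xi>\<bar> \<le> 3 / 4 * eta l" by simp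
  have qpos: "q t \<xi> > 0"
    using \<xi> t by (auto simp: bounded_upto_def qmin_def intro: less_le_trans[OF exp_gt_zero])
  have rhs: "\<bar>q_rhs l (v s) (q s) \<xi>\<bar> \<le> 1 * \<bar>q s \<xi>\<bar>" if s: "s \<in> {0..\<tau>}" for s
  proof -
    have "\<bar>(1 / 2 - P_lag l (v s) (q s) \<xi>) * sin (v s \<xi>)\<bar> \<le> 1 * 1"
      unfolding abs_mult using P[OF s] Pmax_le by (intro mult_mono) auto
    then have "\<bar>q s \<xi>\<bar> * \<bar>(1 / 2 - P_lag l (v s) (q s) \<xi>) * sin (v s \<xi>)\<bar> \<le> \<bar>q s \<xi>\<bar> * 1"
      by (intro mult_left_mono) auto
    then show ?thesis using vgt[OF s] by (simp add: q_rhs_def abs_mult mult.assoc)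
  qed
  have q0: "q 0 \<xi> = 1" using good by (simp add: good_def)
  have "exp t \<le> exp T" using t \<tau> by simp
  moreover have "q t \<xi> \<le> exp t" "1 \<le> q t \<xi> * exp t"
    using exponential_bounds[OF int(2) rhs _ t] q0 qpos by auto
  moreover have "q t \<xi> * exp t \<le> q t \<xi> * exp T" using \<open>exp t \<le> exp T\<close> qpos by (intro mult_left_mono) auto
  ultimately show "q t \<xi> \<le> exp T" "exp (- T) \<le> q t \<xi>"
    by (linarith, simp add: exp_minus field_simps)
qed

text \<open>Continuity argument: \<open>\<sigma>\<close> is the supremum of the times up to which the bounds hold, and the
  improved bounds carry them past \<open>\<sigma>\<close> because \<open>v\<close> and \<open>q\<close> are continuous in time with values in \<open>L\<^sup>\<infinity>\<close>.\<close>

lemma near_all: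
  assumes "t \<in> {0..T}"
  shows "near t"
proof -
  define S where "S = {\<tau> \<in> {0..T}. \<forall>s\<in>{0..\<tau>}. near s}"
  have qm: "qmin \<le> exp (- T)" "exp T \<le> qmax" by (auto simp: qmin_def qmax_def)
  have "near 0"
    unfolding near_def using AE_good
  proof eventually_elim
    case (elim \<xi>)
    then show ?case using eta_pos T by (auto simp: good_def vinf_def qmin_def qmax_def)
  qed
  then have S0: "0 \<in> S" using T by (auto simp: S_def)
  have bdd: "bdd_above S" by (auto simp: S_def intro!: bdd_aboveI[of _ T])
  define \<sigma> where "\<sigma> = Sup S"
  have \<sigma>: "0 \<le> \<sigma>" "\<sigma> \<le> T"
  proof -
    show "0 \<le> \<sigma>" unfolding \<sigma>_def using S0 bdd by (rule cSup_upper)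
    have "S \<noteq> {}" using S0 by auto
    then show "\<sigma> \<le> T" unfolding \<sigma>_def by (rule cSup_least) (auto simp: S_def)
  qed
  \<comment> \<open>Going from \<tau> to s by way of \<sigma> costs 2 * \<epsilon> in
    \<open>v\<close> and in \<open>q\<close>, and 2 * \<delta> in \<open>vinf\<close>. With these
    choices the loss in \<open>v\<close> is at most 3/16 of \<open>eta\<close>, less than the
    quarter gained by the improved bounds, and the loss in \<open>q\<close> fits into the gaps to
    \<open>qmin\<close> and \<open>qmax\<close>.\<close>
  define \<epsilon> where "\<epsilon> = min (eta l / 16) (min ((exp (- T) - qmin) / 2) ((qmax - exp T) / 2))"
  have "qmin < exp (- T)" "exp T < qmax" by (auto simp: qmin_def qmax_def)
  then have \<epsilon>: "\<epsilon> > 0" using eta_pos by (simp add: \<epsilon>_def)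
  have Linf: "\<exists>\<delta>>0. \<forall>s\<ge>0. \<bar>s - \<sigma>\<bar> < \<delta> \<longrightarrow> (AE \<xi> in lborel. \<bar>w s \<xi> - w \<sigma> \<xi>\<bar> \<le> \<epsilon>)" if "C_Linf w" for w
    using that \<sigma> \<epsilon> unfolding C_Linf_def by blast
  obtain \<delta>1 where \<delta>1: "\<delta>1 > 0" "\<And>s. s \<ge> 0 \<Longrightarrow> \<bar>s - \<sigma>\<bar> < \<delta>1 \<Longrightarrow> AE \<xi> in lborel. \<bar>v s \<xi> - v \<sigma> \<xi>\<bar> \<le> \<epsilon>"
    using Linf[of v] solution by (auto simp: lagrangian_solution_def)
  obtain \<delta>2 where \<delta>2: "\<delta>2 > 0" "\<And>s. s \<ge> 0 \<Longrightarrow> \<bar>s - \<sigma>\<bar> < \<delta>2 \<Longrightarrow> AE \<xi> in lborel. \<bar>q s \<xi> - q \<sigma> \<xi>\<bar> \<le> \<epsilon>"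
    using Linf[of q] solution by (auto simp: lagrangian_solution_def)
  define \<delta> where "\<delta> = min (min \<delta>1 \<delta>2) (eta l / 32)"
  have \<delta>: "\<delta> > 0" using \<delta>1 \<delta>2 eta_pos by (simp add: \<delta>_def)
  \<comment> \<open>The supremum \<sigma> is not known to belong to \<open>S\<close>. A nearby
    \<tau> that does carries the improved bounds, and continuity in L^infinity at \<sigma> connects
    it with the times beyond \<sigma>.\<close>
  obtain \<tau> where \<tau>: "\<tau> \<in> S" "\<sigma> - \<delta> < \<tau>"
    using less_cSupD[of S "\<sigma> - \<delta>"] S0 \<delta> unfolding \<sigma>_def by auto
  have \<tau>\<sigma>: "\<tau> \<le> \<sigma>" unfolding \<sigma>_def using \<tau>(1) bdd by (rule cSup_upper)
  have \<tau>T: "\<tau> \<in> {0..T}" and near_\<tau>: "\<And>s. s \<in> {0..\<tau>} \<Longrightarrow> near s" using \<tau> by (auto simp: S_def)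
  have AE_b: "AE \<xi> in lborel. bounded_upto \<tau> \<xi>" by (rule AE_bounded_upto[OF near_\<tau> \<tau>T])
  have extend: "near s" if s: "s \<in> {0..T}" "s < \<sigma> + \<delta>" for s
  proof (cases "s \<le> \<tau>")
    case True
    then show ?thesis using near_\<tau> s by auto
  next
    case False
    then have ds: "\<bar>s - \<sigma>\<bar> < \<delta>" and d\<tau>: "\<bar>\<tau> - \<sigma>\<bar> < \<delta>" using s \<tau> \<tau>\<sigma> by auto
    have "AE \<xi> in lborel. \<bar>v s \<xi> - v \<sigma> \<xi>\<bar> \<le> \<epsilon>" "AE \<xi> in lborel. \<bar>v \<tau> \<xi> - v \<sigma> \<xi>\<bar> \<le> \<epsilon>"
      "AE \<xi> in lborel. \<bar>q s \<xi> - q \<sigma> \<xi>\<bar> \<le> \<epsilon>" "AE \<xi> in lborel. \<bar>q \<tau> \<xi> - q \<sigma> \<xi>\<bar> \<le> \<epsilon>"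
      using \<delta>1(2) \<delta>2(2) ds d\<tau> s \<tau>T by (auto simp: \<delta>_def)
    then show "near s"
      unfolding near_def using AE_b
    proof eventually_elim
      case (elim \<xi>)
      have imp: "\<bar>v \<tau> \<xi> - vinf \<tau> \<xi>\<bar> \<le> 3 / 4 * eta l" "exp (- T) \<le> q \<tau> \<xi>" "q \<tau> \<xi> \<le> exp T"
        using improved_bounds[OF near_\<tau> \<tau>T elim(5), of \<tau>] \<tau>T by auto
      have "\<bar>vinf s \<xi> - vinf \<tau> \<xi>\<bar> \<le> 2 * \<delta>"
        using vinf_time_Lipschitz[OF s(1) \<tau>T, of \<xi>] ds d\<tau> by linarith
      moreover have "v \<tau> \<xi> - vinf \<tau> \<xi> \<le> 3 / 4 * eta l" "- (v \<tau> \<xi> - vinf \<tau> \<xi>) \<le> 3 / 4 * eta l"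
        using imp(1) unfolding abs_le_iff by blast+
      moreover have "2 * \<delta> \<le> eta l / 16" "2 * \<epsilon> \<le> eta l / 8" "2 * \<epsilon> \<le> exp (- T) - qmin" "2 * \<epsilon> \<le> qmax - exp T"
        by (auto simp: \<delta>_def \<epsilon>_def min_def)
      ultimately show ?case using elim(1-4) imp(2,3) by (auto simp: abs_le_iff)
    qed
  qed
  have "\<sigma> = T"
  proof (rule ccontr)
    assume "\<sigma> \<noteq> T"
    then have "min T (\<sigma> + \<delta> / 2) \<in> S" using extend \<sigma> \<delta> by (auto simp: S_def)
    then have "min T (\<sigma> + \<delta> / 2) \<le> \<sigma>" unfolding \<sigma>_def using bdd by (rule cSup_upper)
    then show False using \<open>\<sigma> \<noteq> T\<close> \<sigma> \<delta> by (auto simp: min_def split: if_splits)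
  qed
  then show ?thesis using extend[OF assms] assms \<delta> by auto
qed

end

section \<open>Lipschitz continuity in the label\<close>

lemma integral_curve_Lipschitz:
  fixes x f :: "real \<Rightarrow> real"
  assumes f: "\<And>t. t \<in> {0..\<tau>} \<Longrightarrow> (f has_integral x t - x 0) {0..t}"
    and le: "\<And>t. t \<in> {0..\<tau>} \<Longrightarrow> \<bar>f t\<bar> \<le> B"
    and st: "s \<in> {0..\<tau>}" "t \<in> {0..\<tau>}"
  shows "\<bar>x s - x t\<bar> \<le> B * \<bar>s - t\<bar>"
proof -
  have *: "\<bar>x r - x s\<bar> \<le> B * (r - s)" if "0 \<le> s" "s \<le> r" "r \<le> \<tau>" for s r
  proof -
    have int0: "f integrable_on {0..r}" using f[of r] that by (auto simp: integrable_on_def)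
    have int: "f integrable_on {s..r}" using int0 by (rule integrable_subinterval_real) (use that in auto)
    have "integral {0..s} f + integral {s..r} f = integral {0..r} f"
      using int0 that by (intro Henstock_Kurzweil_Integration.integral_combine) auto
    then have eq: "integral {s..r} f = x r - x s"
      using integral_unique[OF f[of s]] integral_unique[OF f[of r]] that by simp
    have "norm (integral {s..r} f) \<le> integral {s..r} (\<lambda>t. B)"
      by (rule Henstock_Kurzweil_Integration.integral_norm_bound_integral[OF int]) (use le that in auto)
    then show ?thesis using that by (simp add: eq mult.commute)
  qed
  show ?thesis using *[of s t] *[of t s] st by (cases "s \<le> t") (auto simp: abs_minus_commute)
qed

lemma abs_arctan_diff_le: "\<bar>arctan x - arctan y\<bar> \<le> \<bar>x - y\<bar>" for x y :: real
proof -
  have "norm (arctan x - arctan y) \<le> 1 * norm (x - y)"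
  proof (rule field_differentiable_bound[where f' = "\<lambda>x. inverse (1 + x\<^sup>2)" and S = UNIV])
    fix z :: real
    show "(arctan has_real_derivative inverse (1 + z\<^sup>2)) (at z within UNIV)" by (rule DERIV_arctan)
    have "inverse (1 + z\<^sup>2) \<le> inverse 1" by (intro le_imp_inverse_le) auto
    then show "norm (inverse (1 + z\<^sup>2)) \<le> 1" by simp
  qed auto
  then show ?thesis by simp
qed

lemma exp_minus_one_le: "exp x - 1 \<le> x * exp x" for x :: real
proof -
  have "(1 + - x) * exp x \<le> exp (- x) * exp x"
    by (intro mult_right_mono exp_ge_add_one_self) auto
  then show ?thesis by (simp add: algebra_simps flip: exp_add)
qed

lemma cos_half_square: "(cos (x / 2))\<^sup>2 = (1 + cos x) / 2" for x :: real
  using cos_double_cos[of "x / 2"] by simp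

section \<open>Functions on a strip of times and labels\<close>

lemma continuous_on_strip_slice:
  fixes f :: "real \<Rightarrow> real \<Rightarrow> real"
  assumes c: "continuous_on ({0..T} \<times> UNIV) (\<lambda>z. f (fst z) (snd z))"
  shows "continuous_on {0..T} (\<lambda>t. f t \<xi>)"
    and "t \<in> {0..T} \<Longrightarrow> continuous_on UNIV (f t)"
    and "t \<in> {0..T} \<Longrightarrow> continuous_on (UNIV \<times> {0..t}) (\<lambda>(\<xi>, s). f s \<xi>)"
proof -
  have a: "continuous_on {0..T} (\<lambda>t. (t, \<xi>))" "continuous_on UNIV (\<lambda>\<xi>. (t, \<xi>))"
    and b: "continuous_on (UNIV \<times> {0..t}) (\<lambda>z :: real \<times> real. (snd z, fst z))" for t \<xi>
    by (intro continuous_intros)+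
  show "continuous_on {0..T} (\<lambda>t. f t \<xi>)"
    using continuous_on_compose2[OF c a(1)] by auto
  show "continuous_on UNIV (f t)" if "t \<in> {0..T}"
    using continuous_on_compose2[OF c a(2)[of t]] that by (auto simp: image_subset_iff)
  show "continuous_on (UNIV \<times> {0..t}) (\<lambda>(\<xi>, s). f s \<xi>)" if "t \<in> {0..T}"
    using continuous_on_compose2[OF c b[of t]] that by (force simp: case_prod_beta)
qed

lemma continuous_on_strip_integral:
  fixes f :: "real \<Rightarrow> real \<Rightarrow> real"
  assumes c: "continuous_on ({0..T} \<times> UNIV) (\<lambda>z. f (fst z) (snd z))" and t: "t \<in> {0..T}"
  shows "continuous_on UNIV (\<lambda>\<xi>. integral {0..t} (\<lambda>s. f s \<xi>))"
  using integral_continuous_on_param[of UNIV 0 t "\<lambda>\<xi> s. f s \<xi>"] continuous_on_strip_slice(3)[OF c t] by simp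

text \<open>The Lipschitz bound in the second variable is uniform in time; this equicontinuity
  upgrades separate continuity to joint continuity. Used for P, and later for the solutions in
  Eulerian coordinates.\<close>

lemma continuous_on_stripI:
  fixes f :: "real \<Rightarrow> real \<Rightarrow> real"
  assumes lip: "\<And>t \<xi> \<eta>. t \<in> {0..T} \<Longrightarrow> \<bar>f t \<xi> - f t \<eta>\<bar> \<le> C * \<bar>\<xi> - \<eta>\<bar>"
    and cont: "\<And>\<xi>. continuous_on {0..T} (\<lambda>t. f t \<xi>)"
  shows "continuous_on ({0..T} \<times> UNIV) (\<lambda>z. f (fst z) (snd z))"
proof (rule continuous_on_sequentiallyI)
  fix u and z :: "real \<times> real"
  assume u: "\<forall>n. u n \<in> {0..T} \<times> UNIV" and z: "z \<in> {0..T} \<times> UNIV" and lim: "u \<longlonglongrightarrow> z"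
  have f1: "(\<lambda>n. fst (u n)) \<longlonglongrightarrow> fst z" and f2: "(\<lambda>n. snd (u n)) \<longlonglongrightarrow> snd z"
    using lim by (auto intro: tendsto_intros)
  have "(\<lambda>n. f (fst (u n)) (snd z)) \<longlonglongrightarrow> f (fst z) (snd z)"
    by (rule continuous_on_tendsto_compose[OF cont f1]) (use u z in \<open>auto simp: mem_Times_iff\<close>)
  moreover have "(\<lambda>n. f (fst (u n)) (snd (u n)) - f (fst (u n)) (snd z)) \<longlonglongrightarrow> 0"
  proof (rule Lim_null_comparison)
    show "\<forall>\<^sub>F n in sequentially. norm (f (fst (u n)) (snd (u n)) - f (fst (u n)) (snd z)) \<le> C * \<bar>snd (u n) - snd z\<bar>"
      using lip u by (auto simp: mem_Times_iff intro!: always_eventually)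
    have "(\<lambda>n. C * \<bar>snd (u n) - snd z\<bar>) \<longlonglongrightarrow> C * \<bar>snd z - snd z\<bar>"
      by (intro tendsto_intros f2)
    then show "(\<lambda>n. C * \<bar>snd (u n) - snd z\<bar>) \<longlonglongrightarrow> 0" by simp
  qed
  ultimately have "(\<lambda>n. (f (fst (u n)) (snd (u n)) - f (fst (u n)) (snd z)) + f (fst (u n)) (snd z)) \<longlonglongrightarrow> 0 + f (fst z) (snd z)"
    by (intro tendsto_add)
  then show "(\<lambda>n. f (fst (u n)) (snd (u n))) \<longlonglongrightarrow> f (fst z) (snd z)" by simp
qed

lemma eq_on_dense:
  fixes f g :: "real \<Rightarrow> real"
  assumes "closure S = UNIV" "continuous_on UNIV f" "continuous_on UNIV g" "\<And>x. x \<in> S \<Longrightarrow> f x = g x"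
  shows "f x = g x"
proof -
  have "f x - g x = 0"
    by (rule continuous_constant_on_closure[of S "\<lambda>x. f x - g x"])
      (use assms in \<open>auto intro!: continuous_intros\<close>)
  then show ?thesis by simp
qed

context initial_datum
begin

text \<open>Lipschitz constants in \<open>\<xi>\<close> of \<open>P\<close>, \<open>v\<close> and \<open>q\<close>; it matters that they do not depend on \<open>l\<close>.\<close>

definition CP where "CP = qmax * exp qmax"
definition Cv where "Cv = (2 * \<Lambda> + 2 * CP * T) * exp (2 * T)"
definition Cq where "Cq = qmax * (CP + Cv) * T * exp T"

lemma qmax_ge_1: "qmax \<ge> 1"
  using T by (simp add: qmax_def)

lemma CP_ge_1: "CP \<ge> 1"
proof -
  have "1 * 1 \<le> qmax * exp qmax" using qmax_ge_1 by (intro mult_mono) auto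
  then show ?thesis by (simp add: CP_def)
qed

lemma Cv_nonneg: "Cv \<ge> 0"
  using \<Lambda>_nonneg CP_ge_1 T by (simp add: Cv_def)

lemma Cq_nonneg: "Cq \<ge> 0"
  using Cv_nonneg CP_ge_1 qmax_ge_1 T by (simp add: Cq_def)

end

section \<open>Lipschitz bounds uniform in \<open>l\<close>\<close>

context lagrangian_flow
begin

abbreviation P where "P t \<xi> \<equiv> P_lag l (v t) (q t) \<xi>"
abbreviation X where "X t \<xi> \<equiv> l\<^sup>2 * Px_lag l (v t) (q t) \<xi>"

definition regular where "regular = {\<xi>. bounded_upto T \<xi>}"

lemma AE_regular: "AE \<xi> in lborel. \<xi> \<in> regular"
  unfolding regular_def mem_Collect_eq
  by (rule AE_bounded_upto) (use near_all T in auto)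

lemma closure_regular: "closure regular = UNIV"
  by (rule AE_lborel_closure[OF AE_regular])

lemma profile_at: "t \<in> {0..T} \<Longrightarrow> profile l qmin qmax vmax (v t) (q t)"
  by (intro near_profile near_all)

lemma P_bounds:
  assumes "t \<in> {0..T}"
  shows "0 \<le> P t \<xi>" "P t \<xi> \<le> 1 / 2"
  using near_P_lag[OF near_all[OF assms] assms, of \<xi>] Pmax_le by auto

text \<open>For labels at distance at most 1, \<open>P_lag_shift\<close> and exp x - 1 <= x * exp x
  with x <= qmax * |\<xi> - \<eta>| give the constant qmax * exp qmax. For larger distances the
  bound of P by 1/2 is enough, since \<open>CP\<close> is at least 1.\<close>

lemma P_Lipschitz:
  assumes t: "t \<in> {0..T}"
  shows "\<bar>P t \<xi> - P t \<eta>\<bar> \<le> CP * \<bar>\<xi> - \<eta>\<bar>"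
proof -
  interpret p: profile l qmin qmax vmax "v t" "q t" by (rule profile_at[OF t])
  have *: "P t \<xi> - P t \<eta> \<le> CP * \<bar>\<xi> - \<eta>\<bar>" for \<xi> \<eta>
  proof (cases "\<bar>\<xi> - \<eta>\<bar> \<le> 1")
    case True
    define x where "x = qmax / l * \<bar>\<xi> - \<eta>\<bar>"
    have c: "0 \<le> qmax / l" "qmax / l \<le> qmax"
      using qmax_ge_1 l_ge_1 by (auto simp: divide_le_eq mult_le_cancel_left1)
    have x0: "x \<ge> 0" unfolding x_def using c by (intro mult_nonneg_nonneg) auto
    have x1: "x \<le> qmax * \<bar>\<xi> - \<eta>\<bar>" unfolding x_def using c by (intro mult_right_mono) auto
    have x2: "x \<le> qmax * 1" using x1 True qmax_ge_1 by (meson mult_left_mono order_trans zero_le_one)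
    have "P t \<xi> - P t \<eta> \<le> (exp x - 1) * P t \<eta>"
      using p.P_lag_shift[of \<xi> \<eta>] by (simp add: x_def algebra_simps)
    also have "\<dots> \<le> (exp x - 1) * 1"
      using P_bounds[OF t, of \<eta>] x0 by (intro mult_left_mono) auto
    also have "\<dots> \<le> x * exp x" using exp_minus_one_le by simp
    also have "\<dots> \<le> (qmax * \<bar>\<xi> - \<eta>\<bar>) * exp qmax"
      using x0 x1 x2 by (intro mult_mono) auto
    finally show ?thesis by (simp add: CP_def mult_ac)
  next
    case False
    have "P t \<xi> - P t \<eta> \<le> 1 * 1" using P_bounds[OF t, of \<xi>] P_bounds[OF t, of \<eta>] by linarith
    also have "\<dots> \<le> CP * \<bar>\<xi> - \<eta>\<bar>" using CP_ge_1 False by (intro mult_mono) auto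
    finally show ?thesis .
  qed
  show ?thesis using *[of \<xi> \<eta>] *[of \<eta> \<xi>] by (simp add: abs_le_iff abs_minus_commute)
qed

lemma regularD:
  assumes "\<xi> \<in> regular"
  shows "v 0 \<xi> = 2 * arctan (w0 \<xi>)" "q 0 \<xi> = 1"
    and "t \<in> {0..T} \<Longrightarrow> \<bar>v t \<xi>\<bar> \<le> vmax"
    and "t \<in> {0..T} \<Longrightarrow> qmin \<le> q t \<xi>" "t \<in> {0..T} \<Longrightarrow> q t \<xi> \<le> qmax"
    and "t \<in> {0..T} \<Longrightarrow> v_rhs l (v t) (q t) \<xi> = - P t \<xi> * (1 + cos (v t \<xi>)) - (sin (v t \<xi> / 2))\<^sup>2"
    and "t \<in> {0..T} \<Longrightarrow> q_rhs l (v t) (q t) \<xi> = q t \<xi> * (1 / 2 - P t \<xi>) * sin (v t \<xi>)"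
    and "t \<in> {0..T} \<Longrightarrow> ((\<lambda>s. v_rhs l (v s) (q s) \<xi>) has_integral (v t \<xi> - v 0 \<xi>)) {0..t}"
    and "t \<in> {0..T} \<Longrightarrow> ((\<lambda>s. q_rhs l (v s) (q s) \<xi>) has_integral (q t \<xi> - q 0 \<xi>)) {0..t}"
proof -
  have b: "bounded_upto T \<xi>" using assms by (simp add: regular_def)
  then have good: "good \<xi>" by (simp add: bounded_upto_def)
  show "v 0 \<xi> = 2 * arctan (w0 \<xi>)" "q 0 \<xi> = 1" using good by (auto simp: good_def)
  show vb: "\<bar>v t \<xi>\<bar> \<le> vmax" if "t \<in> {0..T}" for t
    using b that by (intro v_bound_if_close) (auto simp: bounded_upto_def)
  show "t \<in> {0..T} \<Longrightarrow> qmin \<le> q t \<xi>" "t \<in> {0..T} \<Longrightarrow> q t \<xi> \<le> qmax"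
    using b by (auto simp: bounded_upto_def)
  have "v t \<xi> > - pi" if "t \<in> {0..T}" for t using vb[OF that] vmax_bounds by linarith
  then show "t \<in> {0..T} \<Longrightarrow> v_rhs l (v t) (q t) \<xi> = - P t \<xi> * (1 + cos (v t \<xi>)) - (sin (v t \<xi> / 2))\<^sup>2"
    "t \<in> {0..T} \<Longrightarrow> q_rhs l (v t) (q t) \<xi> = q t \<xi> * (1 / 2 - P t \<xi>) * sin (v t \<xi>)"
    by (auto simp: v_rhs_def q_rhs_def)
  show "t \<in> {0..T} \<Longrightarrow> ((\<lambda>s. v_rhs l (v s) (q s) \<xi>) has_integral (v t \<xi> - v 0 \<xi>)) {0..t}"
    "t \<in> {0..T} \<Longrightarrow> ((\<lambda>s. q_rhs l (v s) (q s) \<xi>) has_integral (q t \<xi> - q 0 \<xi>)) {0..t}"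
    using good by (auto simp: good_def)
qed

text \<open>Two labels are compared as two curves of \<open>ode_stability\<close>, the difference of
  P being the mismatch. There is no circularity: the Lipschitz bound of P required no regularity of
  \<open>v\<close> or \<open>q\<close> in the label.\<close>

lemma v_Lipschitz:
  assumes r: "\<xi> \<in> regular" "\<eta> \<in> regular" and t: "t \<in> {0..T}"
  shows "\<bar>v t \<xi> - v t \<eta>\<bar> \<le> Cv * \<bar>\<xi> - \<eta>\<bar>"
proof -
  have "\<bar>v t \<xi> - v t \<eta>\<bar> \<le> (\<bar>v 0 \<xi> - v 0 \<eta>\<bar> + 2 * CP * \<bar>\<xi> - \<eta>\<bar> * t) * exp (2 * t)"
  proof (rule ode_stability[OF regularD(8)[OF r(1)] regularD(8)[OF r(2)]])
    fix s assume s: "s \<in> {0..T}"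
    have "\<bar>P s \<xi> * (1 + cos (v s \<xi>)) - P s \<eta> * (1 + cos (v s \<eta>))\<bar>
      \<le> \<bar>(P s \<xi> - P s \<eta>) * (1 + cos (v s \<xi>))\<bar> + \<bar>P s \<eta> * (cos (v s \<xi>) - cos (v s \<eta>))\<bar>"
    proof -
      have "P s \<xi> * (1 + cos (v s \<xi>)) - P s \<eta> * (1 + cos (v s \<eta>))
        = (P s \<xi> - P s \<eta>) * (1 + cos (v s \<xi>)) + P s \<eta> * (cos (v s \<xi>) - cos (v s \<eta>))"
        by (simp add: algebra_simps)
      then show ?thesis using abs_triangle_ineq by metis
    qed
    also have "\<dots> \<le> (CP * \<bar>\<xi> - \<eta>\<bar>) * 2 + 1 * \<bar>v s \<xi> - v s \<eta>\<bar>"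
    proof -
      have "\<bar>1 + cos (v s \<xi>)\<bar> \<le> 2"
        using cos_ge_minus_one[of "v s \<xi>"] cos_le_one[of "v s \<xi>"] by linarith
      then show ?thesis
        unfolding abs_mult using P_Lipschitz[OF s, of \<xi> \<eta>] P_bounds[OF s, of \<eta>] abs_cos_diff_le[of "v s \<xi>" "v s \<eta>"]
        by (intro add_mono mult_mono) auto
    qed
    finally show "\<bar>v_rhs l (v s) (q s) \<xi> - v_rhs l (v s) (q s) \<eta>\<bar> \<le> 2 * CP * \<bar>\<xi> - \<eta>\<bar> + 2 * \<bar>v s \<xi> - v s \<eta>\<bar>"
      using abs_sin_half_square_diff_le[of "v s \<xi>" "v s \<eta>"]
      unfolding regularD(6)[OF r(1) s] regularD(6)[OF r(2) s] by (simp add: abs_if split: if_splits)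
  qed (use t CP_ge_1 in auto)
  also have "\<dots> \<le> (2 * \<Lambda> * \<bar>\<xi> - \<eta>\<bar> + 2 * CP * \<bar>\<xi> - \<eta>\<bar> * T) * exp (2 * T)"
  proof (intro mult_mono add_mono)
    have "v 0 \<xi> - v 0 \<eta> = 2 * (arctan (w0 \<xi>) - arctan (w0 \<eta>))"
      using regularD(1)[OF r(1)] regularD(1)[OF r(2)] by simp
    then have "\<bar>v 0 \<xi> - v 0 \<eta>\<bar> = 2 * \<bar>arctan (w0 \<xi>) - arctan (w0 \<eta>)\<bar>"
      by (simp only: abs_mult abs_numeral)
    also have "\<dots> \<le> 2 * (\<Lambda> * \<bar>\<xi> - \<eta>\<bar>)"
      using order_trans[OF abs_arctan_diff_le w0_Lipschitz[of \<xi> \<eta>]] by (rule mult_left_mono) simp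
    finally show "\<bar>v 0 \<xi> - v 0 \<eta>\<bar> \<le> 2 * \<Lambda> * \<bar>\<xi> - \<eta>\<bar>" by simp
  qed (use t CP_ge_1 \<Lambda>_nonneg in auto)
  also have "\<dots> = Cv * \<bar>\<xi> - \<eta>\<bar>" by (simp add: Cv_def algebra_simps)
  finally show ?thesis by simp
qed

lemma q_Lipschitz:
  assumes r: "\<xi> \<in> regular" "\<eta> \<in> regular" and t: "t \<in> {0..T}"
  shows "\<bar>q t \<xi> - q t \<eta>\<bar> \<le> Cq * \<bar>\<xi> - \<eta>\<bar>"
proof -
  have "\<bar>q t \<xi> - q t \<eta>\<bar> \<le> (\<bar>q 0 \<xi> - q 0 \<eta>\<bar> + qmax * (CP + Cv) * \<bar>\<xi> - \<eta>\<bar> * t) * exp (1 * t)"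
  proof (rule ode_stability[OF regularD(9)[OF r(1)] regularD(9)[OF r(2)]])
    fix s assume s: "s \<in> {0..T}"
    define a where "a \<xi> = (1 / 2 - P s \<xi>) * sin (v s \<xi>)" for \<xi>
    have "\<bar>1 / 2 - P s \<xi>\<bar> * \<bar>sin (v s \<xi>)\<bar> \<le> 1 * 1"
      using P_bounds[OF s, of \<xi>] by (intro mult_mono) auto
    then have a1: "\<bar>a \<xi>\<bar> \<le> 1" by (simp add: a_def abs_mult)
    have "a \<xi> - a \<eta> = (P s \<eta> - P s \<xi>) * sin (v s \<xi>) + (1 / 2 - P s \<eta>) * (sin (v s \<xi>) - sin (v s \<eta>))"
      by (simp add: a_def algebra_simps)
    then have "\<bar>a \<xi> - a \<eta>\<bar> \<le> \<bar>P s \<eta> - P s \<xi>\<bar> * \<bar>sin (v s \<xi>)\<bar> + \<bar>1 / 2 - P s \<eta>\<bar> * \<bar>sin (v s \<xi>) - sin (v s \<eta>)\<bar>"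
      using abs_triangle_ineq by (metis abs_mult)
    also have "\<dots> \<le> (CP * \<bar>\<xi> - \<eta>\<bar>) * 1 + 1 * (Cv * \<bar>\<xi> - \<eta>\<bar>)"
    proof (intro add_mono mult_mono)
      show "\<bar>P s \<eta> - P s \<xi>\<bar> \<le> CP * \<bar>\<xi> - \<eta>\<bar>" using P_Lipschitz[OF s, of \<xi> \<eta>] by (simp add: abs_minus_commute)
      show "\<bar>sin (v s \<xi>) - sin (v s \<eta>)\<bar> \<le> Cv * \<bar>\<xi> - \<eta>\<bar>"
        using abs_sin_diff_le v_Lipschitz[OF r s] by (rule order_trans)
      show "\<bar>1 / 2 - P s \<eta>\<bar> \<le> 1" using P_bounds[OF s, of \<eta>] by (simp add: abs_le_iff)
    qed (use CP_ge_1 in auto)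
    finally have a2: "\<bar>a \<xi> - a \<eta>\<bar> \<le> (CP + Cv) * \<bar>\<xi> - \<eta>\<bar>" by (simp add: algebra_simps)
    have "q s \<xi> * a \<xi> - q s \<eta> * a \<eta> = (q s \<xi> - q s \<eta>) * a \<xi> + q s \<eta> * (a \<xi> - a \<eta>)"
      by (simp add: algebra_simps)
    then have "\<bar>q s \<xi> * a \<xi> - q s \<eta> * a \<eta>\<bar> \<le> \<bar>q s \<xi> - q s \<eta>\<bar> * \<bar>a \<xi>\<bar> + \<bar>q s \<eta>\<bar> * \<bar>a \<xi> - a \<eta>\<bar>"
      using abs_triangle_ineq by (metis abs_mult)
    also have "\<dots> \<le> \<bar>q s \<xi> - q s \<eta>\<bar> * 1 + qmax * ((CP + Cv) * \<bar>\<xi> - \<eta>\<bar>)"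
    proof (intro add_mono mult_mono a1 a2)
      have "qmin > 0" by (simp add: qmin_def)
      then show "\<bar>q s \<eta>\<bar> \<le> qmax" using regularD(4,5)[OF r(2) s] by auto
    qed (use qmax_ge_1 in auto)
    finally show "\<bar>q_rhs l (v s) (q s) \<xi> - q_rhs l (v s) (q s) \<eta>\<bar> \<le> qmax * (CP + Cv) * \<bar>\<xi> - \<eta>\<bar> + 1 * \<bar>q s \<xi> - q s \<eta>\<bar>"
      unfolding regularD(7)[OF r(1) s] regularD(7)[OF r(2) s] by (simp add: a_def mult.assoc)
  qed (use t CP_ge_1 Cv_nonneg qmax_ge_1 in auto)
  also have "\<dots> = qmax * (CP + Cv) * \<bar>\<xi> - \<eta>\<bar> * t * exp t"
    using regularD(2)[OF r(1)] regularD(2)[OF r(2)] by simp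
  also have "\<dots> \<le> qmax * (CP + Cv) * \<bar>\<xi> - \<eta>\<bar> * T * exp T"
    using t CP_ge_1 Cv_nonneg qmax_ge_1 by (intro mult_mono) auto
  finally show ?thesis by (simp add: Cq_def mult_ac)
qed

lemma v_time_Lipschitz:
  assumes r: "\<xi> \<in> regular" and st: "s \<in> {0..T}" "t \<in> {0..T}"
  shows "\<bar>v s \<xi> - v t \<xi>\<bar> \<le> 2 * \<bar>s - t\<bar>"
proof (rule integral_curve_Lipschitz[OF regularD(8)[OF r] _ st])
  fix s assume s: "s \<in> {0..T}"
  have "\<bar>1 + cos (v s \<xi>)\<bar> \<le> 2"
    using cos_ge_minus_one[of "v s \<xi>"] cos_le_one[of "v s \<xi>"] by linarith
  then have "\<bar>P s \<xi>\<bar> * \<bar>1 + cos (v s \<xi>)\<bar> \<le> 1 / 2 * 2"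
    using P_bounds[OF s, of \<xi>] by (intro mult_mono) auto
  then have "\<bar>P s \<xi> * (1 + cos (v s \<xi>))\<bar> \<le> 1" by (simp add: abs_mult)
  moreover have "(sin (v s \<xi> / 2))\<^sup>2 \<le> 1" "0 \<le> (sin (v s \<xi> / 2))\<^sup>2" by (simp_all add: abs_square_le_1)
  ultimately show "\<bar>v_rhs l (v s) (q s) \<xi>\<bar> \<le> 2"
    using abs_triangle_ineq4[of "- (P s \<xi> * (1 + cos (v s \<xi>)))" "(sin (v s \<xi> / 2))\<^sup>2"]
    unfolding regularD(6)[OF r s] mult_minus_left abs_minus_cancel by simp
qed

lemma q_time_Lipschitz:
  assumes r: "\<xi> \<in> regular" and st: "s \<in> {0..T}" "t \<in> {0..T}"
  shows "\<bar>q s \<xi> - q t \<xi>\<bar> \<le> qmax * \<bar>s - t\<bar>"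
proof (rule integral_curve_Lipschitz[OF regularD(9)[OF r] _ st])
  fix s assume s: "s \<in> {0..T}"
  have "\<bar>q s \<xi>\<bar> * \<bar>1 / 2 - P s \<xi>\<bar> * \<bar>sin (v s \<xi>)\<bar> \<le> qmax * 1 * 1"
  proof (intro mult_mono)
    have "qmin > 0" by (simp add: qmin_def)
    then show "\<bar>q s \<xi>\<bar> \<le> qmax" using regularD(4,5)[OF r s] by auto
    show "\<bar>1 / 2 - P s \<xi>\<bar> \<le> 1" using P_bounds[OF s, of \<xi>] by (simp add: abs_le_iff)
  qed (use qmax_ge_1 in auto)
  then show "\<bar>q_rhs l (v s) (q s) \<xi>\<bar> \<le> qmax"
    unfolding regularD(7)[OF r s] by (simp add: abs_mult)
qed

end

section \<open>Differentiability of the flow\<close>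

context lagrangian_flow
begin

text \<open>The evolution equations hold only for almost every label.  The Lipschitz extensions \<open>vx\<close>, \<open>qx\<close> of
  \<open>v\<close>, \<open>q\<close> from the regular labels leave \<open>P\<close> and \<open>Px\<close> unchanged, and identities between continuous
  functions carry over from the regular labels to all labels.\<close>

definition extension :: "real \<Rightarrow> (real \<Rightarrow> real \<Rightarrow> real) \<Rightarrow> real \<times> real \<Rightarrow> real" where
  "extension C f = (SOME g. C-lipschitz_on ({0..T} \<times> UNIV) g \<and> (\<forall>t\<in>{0..T}. \<forall>\<xi>\<in>regular. g (t, \<xi>) = f t \<xi>))"

lemma extension:
  assumes C: "A \<ge> 0" "B \<ge> 0"
    and time: "\<And>s t \<xi>. \<xi> \<in> regular \<Longrightarrow> s \<in> {0..T} \<Longrightarrow> t \<in> {0..T} \<Longrightarrow> \<bar>f s \<xi> - f t \<xi>\<bar> \<le> A * \<bar>s - t\<bar>"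
    and space: "\<And>t \<xi> \<eta>. \<xi> \<in> regular \<Longrightarrow> \<eta> \<in> regular \<Longrightarrow> t \<in> {0..T} \<Longrightarrow> \<bar>f t \<xi> - f t \<eta>\<bar> \<le> B * \<bar>\<xi> - \<eta>\<bar>"
  shows "(A + B)-lipschitz_on ({0..T} \<times> UNIV) (extension (A + B) f)"
    and "t \<in> {0..T} \<Longrightarrow> \<xi> \<in> regular \<Longrightarrow> extension (A + B) f (t, \<xi>) = f t \<xi>"
proof -
  have "(A + B)-lipschitz_on ({0..T} \<times> regular) (\<lambda>z. f (fst z) (snd z))"
  proof (rule lipschitz_onI)
    fix y z assume "y \<in> {0..T} \<times> regular" "z \<in> {0..T} \<times> regular"
    then have yz: "fst y \<in> {0..T}" "fst z \<in> {0..T}" "snd y \<in> regular" "snd z \<in> regular" by auto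
    have "A * \<bar>fst y - fst z\<bar> \<le> A * dist y z" "B * \<bar>snd y - snd z\<bar> \<le> B * dist y z"
      using mult_left_mono[OF dist_fst_le C(1), of y z] mult_left_mono[OF dist_snd_le C(2), of y z]
      by (simp_all add: dist_real_def)
    then have "\<bar>f (fst y) (snd y) - f (fst z) (snd y)\<bar> \<le> A * dist y z" "\<bar>f (fst z) (snd y) - f (fst z) (snd z)\<bar> \<le> B * dist y z"
      using time[OF yz(3,1,2)] space[OF yz(3,4,2)] by linarith+
    then show "dist (f (fst y) (snd y)) (f (fst z) (snd z)) \<le> (A + B) * dist y z"
      by (simp add: dist_real_def distrib_right)
  qed (use C in auto)
  then obtain g where "(A + B)-lipschitz_on (closure ({0..T} \<times> regular)) g" "\<And>z. z \<in> {0..T} \<times> regular \<Longrightarrow> g z = f (fst z) (snd z)"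
    using lipschitz_extend_closure by blast
  then have "\<exists>g. (A + B)-lipschitz_on ({0..T} \<times> UNIV) g \<and> (\<forall>t\<in>{0..T}. \<forall>\<xi>\<in>regular. g (t, \<xi>) = f t \<xi>)"
    by (intro exI[of _ g]) (auto simp: closure_Times closure_regular)
  note * = someI_ex[OF this, folded extension_def]
  show "(A + B)-lipschitz_on ({0..T} \<times> UNIV) (extension (A + B) f)" using * by blast
  show "t \<in> {0..T} \<Longrightarrow> \<xi> \<in> regular \<Longrightarrow> extension (A + B) f (t, \<xi>) = f t \<xi>" using * by blast
qed

definition vx where "vx t \<xi> = extension (2 + Cv) v (t, \<xi>)"
definition qx where "qx t \<xi> = extension (qmax + Cq) q (t, \<xi>)"

lemma vx_eq: "t \<in> {0..T} \<Longrightarrow> \<xi> \<in> regular \<Longrightarrow> vx t \<xi> = v t \<xi>"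
  unfolding vx_def by (rule extension(2)) (use Cv_nonneg v_time_Lipschitz v_Lipschitz in auto)

lemma qx_eq: "t \<in> {0..T} \<Longrightarrow> \<xi> \<in> regular \<Longrightarrow> qx t \<xi> = q t \<xi>"
  unfolding qx_def by (rule extension(2)) (use Cq_nonneg qmax_ge_1 q_time_Lipschitz q_Lipschitz in auto)

lemma vx_lipschitz_on: "(2 + Cv)-lipschitz_on ({0..T} \<times> UNIV) (extension (2 + Cv) v)"
  by (rule extension(1)) (use Cv_nonneg v_time_Lipschitz v_Lipschitz in auto)

lemma vx_cont: "continuous_on ({0..T} \<times> UNIV) (\<lambda>z. vx (fst z) (snd z))"
  using lipschitz_on_continuous_on[OF vx_lipschitz_on] by (simp add: vx_def)

lemma qx_cont: "continuous_on ({0..T} \<times> UNIV) (\<lambda>z. qx (fst z) (snd z))"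
proof -
  have "(qmax + Cq)-lipschitz_on ({0..T} \<times> UNIV) (extension (qmax + Cq) q)"
    by (rule extension(1)) (use Cq_nonneg qmax_ge_1 q_time_Lipschitz q_Lipschitz in auto)
  from lipschitz_on_continuous_on[OF this] show ?thesis by (simp add: qx_def)
qed

lemma vx_Lipschitz:
  assumes "t \<in> {0..T}"
  shows "\<bar>vx t \<xi> - vx t \<eta>\<bar> \<le> (2 + Cv) * \<bar>\<xi> - \<eta>\<bar>"
  using lipschitz_onD[OF vx_lipschitz_on, of "(t, \<xi>)" "(t, \<eta>)"] assms
  by (simp add: vx_def dist_Pair_Pair dist_real_def)

lemma ext_bounds:
  assumes t: "t \<in> {0..T}"
  shows "\<bar>vx t \<xi>\<bar> \<le> vmax" "qmin \<le> qx t \<xi>" "qx t \<xi> \<le> qmax"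
proof -
  have x: "\<xi> \<in> closure regular" by (simp add: closure_regular)
  have c: "continuous_on (closure regular) (vx t)" "continuous_on (closure regular) (qx t)"
    using continuous_on_strip_slice(2)[OF vx_cont t] continuous_on_strip_slice(2)[OF qx_cont t]
    by (simp_all add: closure_regular)
  show "\<bar>vx t \<xi>\<bar> \<le> vmax"
    by (rule continuous_le_on_closure[OF _ x, where f = "\<lambda>\<xi>. \<bar>vx t \<xi>\<bar>"])
      (use c t regularD(3) vx_eq in \<open>auto intro!: continuous_intros\<close>)
  show "qmin \<le> qx t \<xi>"
    by (rule continuous_ge_on_closure[OF c(2) x]) (use t regularD(4) qx_eq in auto)
  show "qx t \<xi> \<le> qmax"
    by (rule continuous_le_on_closure[OF c(2) x]) (use t regularD(5) qx_eq in auto)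
qed

lemma continuous_profile_at:
  assumes t: "t \<in> {0..T}"
  shows "continuous_profile l qmin qmax vmax (vx t) (qx t)"
proof
  have c: "continuous_on UNIV (vx t)" "continuous_on UNIV (qx t)"
    using continuous_on_strip_slice(2)[OF vx_cont t] continuous_on_strip_slice(2)[OF qx_cont t] by simp_all
  then show "continuous_on UNIV (vx t)" "continuous_on UNIV (qx t)"
    "vx t \<in> borel_measurable borel" "qx t \<in> borel_measurable borel"
    by (auto intro: borel_measurable_continuous_onI)
qed (use l_ge_1 vmax_bounds ext_bounds[OF t] in \<open>auto simp: qmin_def\<close>)

lemma P_lag_ext:
  assumes t: "t \<in> {0..T}"
  shows "P_lag l (v t) (q t) \<xi> = P_lag l (vx t) (qx t) \<xi>" "Px_lag l (v t) (q t) \<xi> = Px_lag l (vx t) (qx t) \<xi>"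
proof -
  interpret p: profile l qmin qmax vmax "v t" "q t" by (rule profile_at[OF t])
  interpret c: continuous_profile l qmin qmax vmax "vx t" "qx t" by (rule continuous_profile_at[OF t])
  have ae: "AE \<xi> in lborel. v t \<xi> = vx t \<xi> \<and> q t \<xi> = qx t \<xi>"
    using AE_regular by eventually_elim (simp add: vx_eq[OF t] qx_eq[OF t])
  show "P_lag l (v t) (q t) \<xi> = P_lag l (vx t) (qx t) \<xi>" "Px_lag l (v t) (q t) \<xi> = Px_lag l (vx t) (qx t) \<xi>"
    by (rule P_lag_cong_AE[OF p.v_meas p.q_meas c.v_meas c.q_meas ae p.P_integrand_meas c.P_integrand_meas])+
qed

text \<open>The extensions are continuous in time for every label, and all times share the same
  profile bounds. So \<open>profile_tendsto\<close> applies along any convergent sequence of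
  times.\<close>

lemma P_X_time_continuous:
  shows "continuous_on {0..T} (\<lambda>t. P t \<xi>)" "continuous_on {0..T} (\<lambda>t. X t \<xi>)"
proof -
  have *: "(\<lambda>n. P (u n) \<xi>) \<longlonglongrightarrow> P t \<xi> \<and> (\<lambda>n. X (u n) \<xi>) \<longlonglongrightarrow> X t \<xi>"
    if u: "\<And>n. u n \<in> {0..T}" and t: "t \<in> {0..T}" and lim: "u \<longlonglongrightarrow> t" for u t
  proof -
    have "AE \<xi> in lborel. (\<lambda>n. vx (u n) \<xi>) \<longlonglongrightarrow> vx t \<xi> \<and> (\<lambda>n. qx (u n) \<xi>) \<longlonglongrightarrow> qx t \<xi>"
      by (intro AE_I2 conjI
          continuous_on_tendsto_compose[OF continuous_on_strip_slice(1)[OF vx_cont] lim t]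
          continuous_on_tendsto_compose[OF continuous_on_strip_slice(1)[OF qx_cont] lim t] always_eventually allI u)
    note lim = profile_tendsto[where v = "\<lambda>n. vx (u n)" and q = "\<lambda>n. qx (u n)",
        OF continuous_profile.axioms(1)[OF continuous_profile_at[OF u]] continuous_profile.axioms(1)[OF continuous_profile_at[OF t]] this]
    then show ?thesis by (simp add: P_lag_ext[OF u] P_lag_ext[OF t] tendsto_mult_left)
  qed
  show "continuous_on {0..T} (\<lambda>t. P t \<xi>)" "continuous_on {0..T} (\<lambda>t. X t \<xi>)"
    by (rule continuous_on_sequentiallyI; use * in blast)+
qed

text \<open>The derivatives in \<open>\<xi>\<close> of \<open>y_lag\<close>, \<open>u_lag\<close> and \<open>l\<^sup>2 * Px_lag\<close> will turn out to be \<open>c\<close>, \<open>m\<close> and \<open>h\<close>.\<close>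

definition c where "c t \<xi> = qx t \<xi> * (1 + cos (vx t \<xi>)) / 2"
definition m where "m t \<xi> = qx t \<xi> * sin (vx t \<xi>) / 2"
definition h where "h t \<xi> = c t \<xi> * P t \<xi> - qx t \<xi> * (1 - cos (vx t \<xi>)) / 4"

lemma strip_cont:
  shows "continuous_on ({0..T} \<times> UNIV) (\<lambda>z. c (fst z) (snd z))"
    and "continuous_on ({0..T} \<times> UNIV) (\<lambda>z. m (fst z) (snd z))"
    and "continuous_on ({0..T} \<times> UNIV) (\<lambda>z. h (fst z) (snd z))"
proof -
  have P: "continuous_on ({0..T} \<times> UNIV) (\<lambda>z. P (fst z) (snd z))"
    by (rule continuous_on_stripI[where f = P, OF P_Lipschitz P_X_time_continuous(1)])
  show "continuous_on ({0..T} \<times> UNIV) (\<lambda>z. c (fst z) (snd z))"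
    "continuous_on ({0..T} \<times> UNIV) (\<lambda>z. m (fst z) (snd z))"
    "continuous_on ({0..T} \<times> UNIV) (\<lambda>z. h (fst z) (snd z))"
    unfolding c_def m_def h_def by (intro continuous_intros vx_cont qx_cont P; simp)+
qed

lemma X_has_derivative:
  assumes t: "t \<in> {0..T}"
  shows "((\<lambda>\<xi>. X t \<xi>) has_real_derivative h t \<xi>) (at \<xi>)"
proof -
  interpret c: continuous_profile l qmin qmax vmax "vx t" "qx t" by (rule continuous_profile_at[OF t])
  have "h t \<xi> = qx t \<xi> * (cos (vx t \<xi> / 2))\<^sup>2 * P_lag l (vx t) (qx t) \<xi> - qx t \<xi> * (sin (vx t \<xi> / 2))\<^sup>2 / 2"
    by (simp add: h_def c_def P_lag_ext[OF t] cos_half_square sin_half_square)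
  then show ?thesis using c.Px_lag_has_derivative[of \<xi>] by (simp add: P_lag_ext[OF t])
qed

lemma ext_time_derivative:
  assumes \<xi>: "\<xi> \<in> regular" and t: "t \<in> {0..T}"
  shows "((\<lambda>t. vx t \<xi>) has_real_derivative - P t \<xi> * (1 + cos (vx t \<xi>)) - (1 - cos (vx t \<xi>)) / 2) (at t within {0..T})"
    and "((\<lambda>t. qx t \<xi>) has_real_derivative qx t \<xi> * (1 / 2 - P t \<xi>) * sin (vx t \<xi>)) (at t within {0..T})"
proof -
  have *: "(x has_real_derivative f t) (at t within {0..T})"
    if cont: "continuous_on {0..T} f" and int: "\<And>s. s \<in> {0..T} \<Longrightarrow> (f has_integral x s - x 0) {0..s}" for x f :: "real \<Rightarrow> real"
  proof -
    have "((\<lambda>s. x 0 + integral {0..s} f) has_real_derivative 0 + f t) (at t within {0..T})"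
      by (intro DERIV_add DERIV_const integral_has_real_derivative cont t)
    then have "((\<lambda>s. x 0 + integral {0..s} f) has_real_derivative f t) (at t within {0..T})" by simp
    then show ?thesis
    proof (rule has_field_derivative_transform_within[OF _ zero_less_one t])
      show "x 0 + integral {0..s} f = x s" if "s \<in> {0..T}" for s
        using integral_unique[OF int[OF that]] by simp
    qed
  qed
  have V: "continuous_on {0..T} (\<lambda>t. vx t \<xi>)" "continuous_on {0..T} (\<lambda>t. qx t \<xi>)"
    using continuous_on_strip_slice(1)[OF vx_cont] continuous_on_strip_slice(1)[OF qx_cont] by auto
  have T0: "0 \<in> {0..T}" using T by simp
  show "((\<lambda>t. vx t \<xi>) has_real_derivative - P t \<xi> * (1 + cos (vx t \<xi>)) - (1 - cos (vx t \<xi>)) / 2) (at t within {0..T})"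
  proof (rule *)
    show "continuous_on {0..T} (\<lambda>t. - P t \<xi> * (1 + cos (vx t \<xi>)) - (1 - cos (vx t \<xi>)) / 2)"
      by (intro continuous_intros V P_X_time_continuous) auto
    fix s assume s: "s \<in> {0..T}"
    show "((\<lambda>t. - P t \<xi> * (1 + cos (vx t \<xi>)) - (1 - cos (vx t \<xi>)) / 2) has_integral vx s \<xi> - vx 0 \<xi>) {0..s}"
      unfolding vx_eq[OF s \<xi>] vx_eq[OF T0 \<xi>]
      by (rule has_integral_eq[OF _ regularD(8)[OF \<xi> s]])
        (use s in \<open>auto simp: regularD(6)[OF \<xi>] vx_eq[OF _ \<xi>] sin_half_square\<close>)
  qed
  show "((\<lambda>t. qx t \<xi>) has_real_derivative qx t \<xi> * (1 / 2 - P t \<xi>) * sin (vx t \<xi>)) (at t within {0..T})"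
  proof (rule *)
    show "continuous_on {0..T} (\<lambda>t. qx t \<xi> * (1 / 2 - P t \<xi>) * sin (vx t \<xi>))"
      by (intro continuous_intros V P_X_time_continuous)
    fix s assume s: "s \<in> {0..T}"
    show "((\<lambda>t. qx t \<xi> * (1 / 2 - P t \<xi>) * sin (vx t \<xi>)) has_integral qx s \<xi> - qx 0 \<xi>) {0..s}"
      unfolding qx_eq[OF s \<xi>] qx_eq[OF T0 \<xi>]
      by (rule has_integral_eq[OF _ regularD(9)[OF \<xi> s]])
        (use s in \<open>auto simp: regularD(7)[OF \<xi>] vx_eq[OF _ \<xi>] qx_eq[OF _ \<xi>]\<close>)
  qed
qed

text \<open>These are u_t = - l^2 P_x and y_t = u differentiated in the label. For a regular label
  they follow from the equations of \<open>v\<close> and \<open>q\<close> by the product rule and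
  sin^2 + cos^2 = 1. Both sides are continuous in the label, and the regular labels are
  dense.\<close>

lemma m_c_eq:
  assumes t: "t \<in> {0..T}"
  shows "m t \<xi> = m 0 \<xi> - integral {0..t} (\<lambda>s. h s \<xi>)" "c t \<xi> = c 0 \<xi> + integral {0..t} (\<lambda>s. m s \<xi>)"
proof -
  have T0: "0 \<in> {0..T}" using T by simp
  note cont = continuous_on_strip_slice(2)[OF strip_cont(1)] continuous_on_strip_slice(2)[OF strip_cont(2)]
    continuous_on_strip_integral[OF strip_cont(2) t] continuous_on_strip_integral[OF strip_cont(3) t]
  have m_reg: "m t \<xi> = m 0 \<xi> - integral {0..t} (\<lambda>s. h s \<xi>)"
    and c_reg: "c t \<xi> = c 0 \<xi> + integral {0..t} (\<lambda>s. m s \<xi>)" if \<xi>: "\<xi> \<in> regular" for \<xi>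
  proof -
    have dm: "((\<lambda>t. m t \<xi>) has_real_derivative - h s \<xi>) (at s within {0..t})"
      and dc: "((\<lambda>t. c t \<xi>) has_real_derivative m s \<xi>) (at s within {0..t})" if "s \<in> {0..t}" for s
    proof -
      have s: "s \<in> {0..T}" using that t by auto
      define p k n Q where "p = P s \<xi>" and "k = cos (vx s \<xi>)" and "n = sin (vx s \<xi>)" and "Q = qx s \<xi>"
      have dv: "((\<lambda>t. vx t \<xi>) has_real_derivative - p * (1 + k) - (1 - k) / 2) (at s within {0..t})"
        and dq: "((\<lambda>t. qx t \<xi>) has_real_derivative Q * (1 / 2 - p) * n) (at s within {0..t})"
        using ext_time_derivative[OF \<xi> s] t
        by (auto simp: p_def k_def n_def Q_def intro: DERIV_subset)
      have n2: "n * n = 1 - k * k" using sin_squared_eq[of "vx s \<xi>"] by (simp add: n_def k_def power2_eq_square)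
      have ds: "((\<lambda>t. sin (vx t \<xi>)) has_real_derivative k * (- p * (1 + k) - (1 - k) / 2)) (at s within {0..t})"
        and dk: "((\<lambda>t. cos (vx t \<xi>)) has_real_derivative - n * (- p * (1 + k) - (1 - k) / 2)) (at s within {0..t})"
        unfolding k_def n_def using DERIV_chain2[OF DERIV_sin dv[unfolded k_def]] DERIV_chain2[OF DERIV_cos dv[unfolded k_def]] by auto
      have "((\<lambda>t. m t \<xi>) has_real_derivative (Q * (1 / 2 - p) * n * n + k * (- p * (1 + k) - (1 - k) / 2) * Q) / 2) (at s within {0..t})"
        unfolding m_def using DERIV_cdivide[OF DERIV_mult[OF dq ds], of 2] by (simp add: n_def Q_def)
      also have "(Q * (1 / 2 - p) * n * n + k * (- p * (1 + k) - (1 - k) / 2) * Q) / 2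
          = Q * ((1 / 2 - p) * (n * n) + k * (- p * (1 + k) - (1 - k) / 2)) / 2" by (simp add: algebra_simps)
      also have "\<dots> = - h s \<xi>"
        unfolding n2 by (simp add: h_def c_def p_def[symmetric] k_def[symmetric] Q_def[symmetric] field_simps)
      finally show "((\<lambda>t. m t \<xi>) has_real_derivative - h s \<xi>) (at s within {0..t})" .
      have "((\<lambda>t. c t \<xi>) has_real_derivative (Q * (1 / 2 - p) * n * (1 + k) + (0 + - n * (- p * (1 + k) - (1 - k) / 2)) * Q) / 2) (at s within {0..t})"
        unfolding c_def using DERIV_cdivide[OF DERIV_mult[OF dq DERIV_add[OF DERIV_const dk]], of 1 2]
        by (simp add: k_def Q_def)
      also have "(Q * (1 / 2 - p) * n * (1 + k) + (0 + - n * (- p * (1 + k) - (1 - k) / 2)) * Q) / 2 = m s \<xi>"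
        by (simp add: m_def n_def[symmetric] Q_def[symmetric] field_simps)
      finally show "((\<lambda>t. c t \<xi>) has_real_derivative m s \<xi>) (at s within {0..t})" .
    qed
    have t0: "0 \<le> t" using t by simp
    have "((\<lambda>s. - h s \<xi>) has_integral m t \<xi> - m 0 \<xi>) {0..t}"
      using fundamental_theorem_of_calculus[OF t0, of "\<lambda>s. m s \<xi>" "\<lambda>s. - h s \<xi>"] dm
      by (simp add: has_real_derivative_iff_has_vector_derivative)
    from integral_unique[OF this] show "m t \<xi> = m 0 \<xi> - integral {0..t} (\<lambda>s. h s \<xi>)"
      by simp
    have "((\<lambda>s. m s \<xi>) has_integral c t \<xi> - c 0 \<xi>) {0..t}"
      using fundamental_theorem_of_calculus[OF t0, of "\<lambda>s. c s \<xi>" "\<lambda>s. m s \<xi>"] dc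
      by (simp add: has_real_derivative_iff_has_vector_derivative)
    from integral_unique[OF this] show "c t \<xi> = c 0 \<xi> + integral {0..t} (\<lambda>s. m s \<xi>)"
      by simp
  qed
  show "m t \<xi> = m 0 \<xi> - integral {0..t} (\<lambda>s. h s \<xi>)"
    by (rule eq_on_dense[OF closure_regular cont(2)[OF t] continuous_on_diff[OF cont(2)[OF T0] cont(4)] m_reg])
  show "c t \<xi> = c 0 \<xi> + integral {0..t} (\<lambda>s. m s \<xi>)"
    by (rule eq_on_dense[OF closure_regular cont(1)[OF t] continuous_on_add[OF cont(1)[OF T0] cont(3)] c_reg])
qed

text \<open>These are the label derivatives of \<open>u0\<close> composed with \<open>y0\<close> and
  of \<open>y0\<close> itself, so that the initial values in \<open>m_c_eq\<close> match the initial
  terms of \<open>u_lag\<close> and \<open>y_lag\<close>.\<close>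

lemma m_c_initial: "m 0 \<xi> = w0 \<xi> / (1 + (w0 \<xi>)\<^sup>2)" "c 0 \<xi> = 1 / (1 + (w0 \<xi>)\<^sup>2)"
proof -
  have T0: "0 \<in> {0..T}" using T by simp
  have pos: "1 + (w0 \<xi>)\<^sup>2 \<noteq> 0" for \<xi> by (simp add: add_nonneg_eq_0_iff)
  have trig: "sin (2 * arctan x) / 2 = x / (1 + x\<^sup>2)" "(1 + cos (2 * arctan x)) / 2 = 1 / (1 + x\<^sup>2)" for x
  proof -
    have s: "sqrt (1 + x\<^sup>2) * sqrt (1 + x\<^sup>2) = 1 + x\<^sup>2" by (simp add: add_nonneg_nonneg)
    have "sin (2 * arctan x) = 2 * (x / (1 + x\<^sup>2))"
      by (simp add: sin_double sin_arctan cos_arctan s)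
    then show "sin (2 * arctan x) / 2 = x / (1 + x\<^sup>2)" by (simp only: nonzero_mult_div_cancel_left zero_neq_numeral not_False_eq_True)
    show "(1 + cos (2 * arctan x)) / 2 = 1 / (1 + x\<^sup>2)"
      using cos_half_square[of "2 * arctan x"] by (simp add: cos_arctan power_divide add_nonneg_nonneg)
  qed
  show "m 0 \<xi> = w0 \<xi> / (1 + (w0 \<xi>)\<^sup>2)"
  proof (rule eq_on_dense[OF closure_regular continuous_on_strip_slice(2)[OF strip_cont(2) T0]])
    show "continuous_on UNIV (\<lambda>\<xi>. w0 \<xi> / (1 + (w0 \<xi>)\<^sup>2))" by (intro continuous_intros w0_cont) (use pos in auto)
    show "m 0 \<xi> = w0 \<xi> / (1 + (w0 \<xi>)\<^sup>2)" if "\<xi> \<in> regular" for \<xi>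
      by (simp only: m_def vx_eq[OF T0 that] qx_eq[OF T0 that] regularD(1,2)[OF that] mult_1 trig)
  qed
  show "c 0 \<xi> = 1 / (1 + (w0 \<xi>)\<^sup>2)"
  proof (rule eq_on_dense[OF closure_regular continuous_on_strip_slice(2)[OF strip_cont(1) T0]])
    show "continuous_on UNIV (\<lambda>\<xi>. 1 / (1 + (w0 \<xi>)\<^sup>2))" by (intro continuous_intros w0_cont) (use pos in auto)
    show "c 0 \<xi> = 1 / (1 + (w0 \<xi>)\<^sup>2)" if "\<xi> \<in> regular" for \<xi>
      by (simp only: c_def vx_eq[OF T0 that] qx_eq[OF T0 that] regularD(1,2)[OF that] mult_1 trig)
  qed
qed

section \<open>Label derivatives of the flow\<close>

abbreviation uL where "uL \<equiv> u_lag l u0 y0 v q"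
abbreviation yL where "yL \<equiv> y_lag l u0 y0 v q"

lemma interval_integral_from_0:
  fixes f :: "real \<Rightarrow> real"
  assumes "continuous_on {0..T} f" "t \<in> {0..T}"
  shows "(LBINT s=ereal 0..ereal t. f s) = integral {0..t} f"
proof (rule interval_integral_eq_integral)
  show "set_integrable lborel {0..t} f"
    by (intro borel_integrable_atLeastAtMost' continuous_on_subset[OF assms(1)]) (use assms in auto)
qed (use assms in auto)

lemma uL_eq:
  assumes t: "t \<in> {0..T}"
  shows "uL t \<xi> = u0 (y0 \<xi>) - integral {0..t} (\<lambda>s. X s \<xi>)"
  using interval_integral_from_0[OF P_X_time_continuous(2) t, of \<xi>] by (simp add: u_lag_def)

text \<open>Differentiation under the time integral yields the initial slope minus the integral of
  \<open>h\<close>, and \<open>m_c_eq\<close> recognises this as \<open>m\<close>. The same happens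
  for \<open>yL\<close> with \<open>m\<close> and \<open>c\<close>.\<close>

lemma uL_has_derivative:
  assumes t: "t \<in> {0..T}"
  shows "(uL t has_real_derivative m t \<xi>) (at \<xi>)"
proof -
  have "((\<lambda>\<xi>. integral (cbox 0 t) (\<lambda>s. X s \<xi>)) has_real_derivative integral (cbox 0 t) (\<lambda>s. h s \<xi>)) (at \<xi> within UNIV)"
  proof (rule leibniz_rule_field_derivative)
    show "((\<lambda>\<xi>. X s \<xi>) has_real_derivative h s \<xi>) (at \<xi> within UNIV)" if "s \<in> cbox 0 t" for s \<xi>
      using X_has_derivative that t by simp
    show "(\<lambda>s. X s \<xi>) integrable_on cbox 0 t" for \<xi>
      using continuous_on_subset[OF P_X_time_continuous(2), of "{0..t}" \<xi>] t
      by (auto intro: integrable_continuous_real)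
    show "continuous_on (UNIV \<times> cbox 0 t) (\<lambda>(\<xi>, s). h s \<xi>)"
      using continuous_on_strip_slice(3)[OF strip_cont(3) t] by simp
  qed auto
  then have "((\<lambda>\<xi>. u0 (y0 \<xi>) - integral {0..t} (\<lambda>s. X s \<xi>)) has_real_derivative w0 \<xi> / (1 + (w0 \<xi>)\<^sup>2) - integral {0..t} (\<lambda>s. h s \<xi>)) (at \<xi>)"
    by (intro DERIV_diff u0_y0_has_derivative) simp
  then show ?thesis by (simp add: uL_eq[OF t, abs_def] m_c_eq(1)[OF t] m_c_initial)
qed

lemma uL_time_continuous: "continuous_on {0..T} (\<lambda>t. uL t \<xi>)"
proof -
  have "continuous_on {0..T} (\<lambda>t. u0 (y0 \<xi>) - integral {0..t} (\<lambda>s. X s \<xi>))"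
    by (intro continuous_intros indefinite_integral_continuous_1 integrable_continuous_real P_X_time_continuous)
  then show ?thesis by (rule continuous_on_eq) (simp add: uL_eq)
qed

lemma yL_has_derivative:
  assumes t: "t \<in> {0..T}"
  shows "(yL t has_real_derivative c t \<xi>) (at \<xi>)"
proof -
  have eq: "yL t \<xi> = y0 \<xi> + integral {0..t} (\<lambda>s. uL s \<xi>)" for \<xi>
    using interval_integral_from_0[OF uL_time_continuous t, of \<xi>] by (simp add: y_lag_def)
  have "((\<lambda>\<xi>. integral (cbox 0 t) (\<lambda>s. uL s \<xi>)) has_real_derivative integral (cbox 0 t) (\<lambda>s. m s \<xi>)) (at \<xi> within UNIV)"
  proof (rule leibniz_rule_field_derivative)
    show "((\<lambda>\<xi>. uL s \<xi>) has_real_derivative m s \<xi>) (at \<xi> within UNIV)" if "s \<in> cbox 0 t" for s \<xi>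
      using uL_has_derivative that t by simp
    show "(\<lambda>s. uL s \<xi>) integrable_on cbox 0 t" for \<xi>
      using continuous_on_subset[OF uL_time_continuous, of "{0..t}" \<xi>] t
      by (auto intro: integrable_continuous_real)
    show "continuous_on (UNIV \<times> cbox 0 t) (\<lambda>(\<xi>, s). m s \<xi>)"
      using continuous_on_strip_slice(3)[OF strip_cont(2) t] by simp
  qed auto
  then have "((\<lambda>\<xi>. y0 \<xi> + integral {0..t} (\<lambda>s. uL s \<xi>)) has_real_derivative 1 / (1 + (w0 \<xi>)\<^sup>2) + integral {0..t} (\<lambda>s. m s \<xi>)) (at \<xi>)"
    by (intro DERIV_add y0_has_derivative) simp
  then show ?thesis by (simp add: eq[abs_def] m_c_eq(2)[OF t] m_c_initial)
qed

end

section \<open>Derivative bounds in Eulerian coordinates\<close>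

context initial_datum
begin

text \<open>A product of three Lipschitz constants: of tan (x / 2) on the range of \<open>v\<close>,
  of \<open>vx\<close> in the label, and of the inverse of \<open>yL\<close>.\<close>

definition CL where "CL = (1 + (2 * M + 1)\<^sup>2) / 2 * (2 + Cv) / rate"

lemma tan_half_bound:
  assumes "\<bar>x\<bar> \<le> vmax"
  shows "\<bar>tan (x / 2)\<bar> \<le> 2 * M + 1" "cos (x / 2) > 0"
proof -
  have v: "vmax / 2 = arctan (2 * M + 1)" by (simp add: vmax_def)
  have range: "- (pi / 2) < x / 2" "x / 2 < pi / 2" using assms vmax_bounds by auto
  then show "cos (x / 2) > 0" by (intro cos_gt_zero_pi) auto
  have "tan (x / 2) \<le> tan (arctan (2 * M + 1))"
    using assms range arctan_ubound[of "2 * M + 1"] v by (subst tan_mono_le_eq) auto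
  moreover have "tan (- arctan (2 * M + 1)) \<le> tan (x / 2)"
    using assms range arctan_ubound[of "2 * M + 1"] v by (subst tan_mono_le_eq) auto
  ultimately show "\<bar>tan (x / 2)\<bar> \<le> 2 * M + 1" by (simp add: tan_arctan abs_le_iff)
qed

lemma tan_half_Lipschitz:
  assumes "\<bar>x\<bar> \<le> vmax" "\<bar>y\<bar> \<le> vmax"
  shows "\<bar>tan (x / 2) - tan (y / 2)\<bar> \<le> (1 + (2 * M + 1)\<^sup>2) / 2 * \<bar>x - y\<bar>"
proof -
  have "norm (tan (x / 2) - tan (y / 2)) \<le> (1 + (2 * M + 1)\<^sup>2) / 2 * norm (x - y)"
  proof (rule field_differentiable_bound[where f' = "\<lambda>z. (1 + (tan (z / 2))\<^sup>2) / 2" and S = "{- vmax..vmax}"])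
    fix z assume "z \<in> {- vmax..vmax}"
    then have z: "\<bar>z\<bar> \<le> vmax" by auto
    have c: "cos (z / 2) \<noteq> 0" using tan_half_bound(2)[OF z] by simp
    have "((\<lambda>z. tan (z / 2)) has_real_derivative inverse ((cos (z / 2))\<^sup>2) * (1 / 2)) (at z)"
      using DERIV_chain2[OF DERIV_tan[OF c] DERIV_cdivide[OF DERIV_ident]] by simp
    then have "((\<lambda>z. tan (z / 2)) has_real_derivative (1 + (tan (z / 2))\<^sup>2) / 2) (at z)"
      using tan_sec[OF c] by (simp add: power_inverse)
    then show "((\<lambda>z. tan (z / 2)) has_real_derivative (1 + (tan (z / 2))\<^sup>2) / 2) (at z within {- vmax..vmax})"
      by (rule DERIV_subset) simp
    have "(tan (z / 2))\<^sup>2 \<le> (2 * M + 1)\<^sup>2"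
      using tan_half_bound(1)[OF z] M_nonneg by (simp flip: abs_le_square_iff)
    then show "norm ((1 + (tan (z / 2))\<^sup>2) / 2) \<le> (1 + (2 * M + 1)\<^sup>2) / 2"
      by (simp add: add_nonneg_nonneg)
  qed (use assms in auto)
  then show ?thesis by simp
qed

end

context lagrangian_flow
begin

lemma c_ge_rate:
  assumes t: "t \<in> {0..T}"
  shows "rate \<le> c t \<xi>"
proof -
  interpret p: continuous_profile l qmin qmax vmax "vx t" "qx t" by (rule continuous_profile_at[OF t])
  have "qmin * (cos (vmax / 2))\<^sup>2 \<le> qx t \<xi> * (cos (vx t \<xi> / 2))\<^sup>2"
    using p.a p.q_ge p.v_le by (intro mult_mono p.cos_half_ge) (auto intro: order_trans[OF less_imp_le])
  then show ?thesis by (simp add: rate_def c_def cos_half_square)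
qed

lemma m_over_c:
  assumes t: "t \<in> {0..T}"
  shows "m t \<xi> / c t \<xi> = tan (vx t \<xi> / 2)"
proof -
  have c: "cos (vx t \<xi> / 2) > 0" by (rule tan_half_bound(2)[OF ext_bounds(1)[OF t]])
  have q: "qx t \<xi> > 0" using ext_bounds(2)[OF t, of \<xi>] by (simp add: qmin_def less_le_trans[OF exp_gt_zero])
  have "m t \<xi> = qx t \<xi> * sin (vx t \<xi> / 2) * cos (vx t \<xi> / 2)"
    using sin_double[of "vx t \<xi> / 2"] by (simp add: m_def)
  moreover have "c t \<xi> = qx t \<xi> * cos (vx t \<xi> / 2) * cos (vx t \<xi> / 2)"
    using cos_half_square[of "vx t \<xi>"] by (simp add: c_def power2_eq_square)
  ultimately show ?thesis using c q by (simp add: tan_def)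
qed

text \<open>As y_xi = \<open>c\<close> is at least \<open>rate > 0\<close>, the map
  \<open>yL t\<close> is onto the line and has a Lipschitz inverse z. Hence w is \<open>uL t\<close>
  composed with z, and its derivative m / c = tan (vx / 2), taken at z, inherits bound and Lipschitz
  constant from \<open>vx\<close>.\<close>

theorem eulerian_derivative:
  assumes t: "t \<in> {0..T}" and w: "\<And>\<xi>. w (yL t \<xi>) = uL t \<xi>"
  obtains d where "\<And>x. (w has_real_derivative d x) (at x)" "\<And>x. \<bar>d x\<bar> \<le> 2 * M + 1"
    "\<And>x y. \<bar>d x - d y\<bar> \<le> CL * \<bar>x - y\<bar>"
proof -
  have expand: "rate * (\<eta> - \<xi>) \<le> yL t \<eta> - yL t \<xi>" if "\<xi> \<le> \<eta>" for \<xi> \<eta>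
  proof (cases "\<xi> = \<eta>")
    case False
    then have "\<xi> < \<eta>" using that by simp
    then obtain z where "yL t \<eta> - yL t \<xi> = (\<eta> - \<xi>) * c t z"
      using MVT2[of \<xi> \<eta> "yL t" "c t"] yL_has_derivative[OF t] by blast
    then show ?thesis using mult_left_mono[OF c_ge_rate[OF t, of z], of "\<eta> - \<xi>"] that by (simp add: mult.commute)
  qed simp
  have y_cont: "continuous_on S (yL t)" for S
    using yL_has_derivative[OF t] by (intro continuous_at_imp_continuous_on ballI DERIV_isCont)
  have surj: "\<exists>\<xi>. yL t \<xi> = x" for x
  proof -
    define r where "r = \<bar>x - yL t 0\<bar> / rate"
    have r: "r \<ge> 0" "rate * r = \<bar>x - yL t 0\<bar>" using rate_pos by (auto simp: r_def)
    have "yL t (- r) \<le> x" using expand[of "- r" 0] r by simp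
    moreover have "x \<le> yL t r" using expand[of 0 r] r by simp
    ultimately show ?thesis using IVT'[of "yL t" "- r" x r] y_cont r by auto
  qed
  define z where "z x = (SOME \<xi>. yL t \<xi> = x)" for x
  have yz: "yL t (z x) = x" for x using someI_ex[OF surj[of x]] by (simp add: z_def)
  have zlip: "\<bar>z x - z y\<bar> \<le> \<bar>x - y\<bar> / rate" for x y
  proof -
    have "rate * \<bar>z x - z y\<bar> \<le> \<bar>x - y\<bar>"
      using expand[of "z x" "z y"] expand[of "z y" "z x"] unfolding yz by (cases "z x \<le> z y") (auto simp: abs_if)
    then show ?thesis using rate_pos by (simp add: field_simps)
  qed
  have z_cont: "isCont z x" for x
  proof -
    have "(1 / rate)-lipschitz_on UNIV z"
      using zlip rate_pos by (auto simp: lipschitz_on_def dist_real_def)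
    from lipschitz_on_continuous_on[OF this] show ?thesis by (simp add: continuous_on_eq_continuous_at)
  qed
  have z': "(z has_real_derivative inverse (c t (z x))) (at x)" for x
    by (rule DERIV_inverse_function[where f = "yL t" and a = "x - 1" and b = "x + 1"])
      (use yL_has_derivative[OF t] c_ge_rate[OF t, of "z x"] rate_pos z_cont yz in auto)
  define d where "d x = tan (vx t (z x) / 2)" for x
  have "(w has_real_derivative d x) (at x)" for x
  proof -
    have "((\<lambda>x. uL t (z x)) has_real_derivative m t (z x) * inverse (c t (z x))) (at x)"
      by (rule DERIV_chain2[OF uL_has_derivative[OF t] z'])
    moreover have "(\<lambda>x. uL t (z x)) = w"
    proof (rule ext)
      show "uL t (z x) = w x" for x using w[of "z x"] by (simp add: yz)
    qed
    ultimately have "(w has_real_derivative m t (z x) * inverse (c t (z x))) (at x)" by (simp only:)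
    moreover have "m t (z x) * inverse (c t (z x)) = d x"
      using m_over_c[OF t, of "z x"] by (simp only: d_def divide_inverse)
    ultimately show ?thesis by (simp only:)
  qed
  moreover have "\<bar>d x\<bar> \<le> 2 * M + 1" for x
    unfolding d_def by (rule tan_half_bound(1)[OF ext_bounds(1)[OF t]])
  moreover have "\<bar>d x - d y\<bar> \<le> CL * \<bar>x - y\<bar>" for x y
  proof -
    have "\<bar>d x - d y\<bar> \<le> (1 + (2 * M + 1)\<^sup>2) / 2 * \<bar>vx t (z x) - vx t (z y)\<bar>"
      unfolding d_def by (rule tan_half_Lipschitz[OF ext_bounds(1)[OF t] ext_bounds(1)[OF t]])
    also have "\<dots> \<le> (1 + (2 * M + 1)\<^sup>2) / 2 * ((2 + Cv) * (\<bar>x - y\<bar> / rate))"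
    proof (intro mult_left_mono)
      have "\<bar>vx t (z x) - vx t (z y)\<bar> \<le> (2 + Cv) * \<bar>z x - z y\<bar>" by (rule vx_Lipschitz[OF t])
      also have "\<dots> \<le> (2 + Cv) * (\<bar>x - y\<bar> / rate)"
        using zlip Cv_nonneg by (intro mult_left_mono) auto
      finally show "\<bar>vx t (z x) - vx t (z y)\<bar> \<le> (2 + Cv) * (\<bar>x - y\<bar> / rate)" .
    qed (simp add: add_nonneg_nonneg)
    finally show ?thesis by (simp add: CL_def mult_ac)
  qed
  ultimately show thesis by (rule that)
qed

end

theorem dissipative_solution_derivative_bounds:
  fixes u0 D :: "real \<Rightarrow> real"
  assumes D: "\<And>x. (u0 has_real_derivative D x) (at x)" "\<And>x. \<bar>D x\<bar> \<le> M" "\<And>x y. \<bar>D x - D y\<bar> \<le> \<Lambda> * \<bar>x - y\<bar>"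
    and var: "total_variation u0 \<le> ennreal V" "V \<ge> 0" and T: "T > 0" "M * T < 1"
  obtains l0 C where "\<And>l w t. l \<ge> l0 \<Longrightarrow> dissipative_solution l u0 w \<Longrightarrow> t \<in> {0..T} \<Longrightarrow>
    \<exists>d. (\<forall>x. (w t has_real_derivative d x) (at x)) \<and> (\<forall>x. \<bar>d x\<bar> \<le> C) \<and> (\<forall>x y. \<bar>d x - d y\<bar> \<le> C * \<bar>x - y\<bar>)"
proof (cases "\<exists>y0. initial_label u0 y0")
  \<comment> \<open>Without a label map there is no dissipative solution, and the claim is
    empty.\<close>
  case False
  then show thesis using that by (auto simp: dissipative_solution_def)
next
  case True
  have datum: "initial_datum u0 D y0 M \<Lambda> V T" if "initial_label u0 y0" for y0
    using assms that by unfold_locales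
  \<comment> \<open>Each dissipative solution brings its own label map, but the threshold for
    \<open>l\<close> and all constants depend only on \<open>M\<close>, \<open>\<Lambda>\<close>,
    \<open>V\<close> and \<open>T\<close>. Those obtained from \<open>y1\<close> therefore serve
    every solution.\<close>
  from True obtain y1 where y1: "initial_label u0 y1" by blast
  interpret d1: initial_datum u0 D y1 M \<Lambda> V T by (rule datum[OF y1])
  obtain l0 where l0: "\<And>l. l \<ge> l0 \<Longrightarrow> d1.large l"
    using d1.eventually_large by (auto simp: eventually_at_top_linorder)
  define C where "C = max (2 * M + 1) d1.CL"
  show thesis
  proof (rule that[of l0 C])
    fix l w t assume l: "l \<ge> l0" and w: "dissipative_solution l u0 w" and t: "t \<in> {0..T}"
    obtain y0 v q where y0: "initial_label u0 y0" and sol: "lagrangian_solution l u0 y0 v q"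
      and wy: "\<And>t \<xi>. t \<ge> 0 \<Longrightarrow> w t (y_lag l u0 y0 v q t \<xi>) = u_lag l u0 y0 v q t \<xi>"
      using w by (auto simp: dissipative_solution_def)
    interpret d: initial_datum u0 D y0 M \<Lambda> V T by (rule datum[OF y0])
    interpret f: lagrangian_flow u0 D y0 M \<Lambda> V T l v q
      using l0[OF l] sol by unfold_locales
    obtain d where d: "\<And>x. (w t has_real_derivative d x) (at x)" "\<And>x. \<bar>d x\<bar> \<le> 2 * M + 1"
      "\<And>x y. \<bar>d x - d y\<bar> \<le> d.CL * \<bar>x - y\<bar>"
      using f.eulerian_derivative[OF t, of "w t"] wy t by (metis atLeastAtMost_iff)
    have "\<bar>d x - d y\<bar> \<le> C * \<bar>x - y\<bar>" for x y
    proof -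
      have "d.CL * \<bar>x - y\<bar> \<le> C * \<bar>x - y\<bar>" by (intro mult_right_mono) (auto simp: C_def)
      then show ?thesis using d(3)[of x y] by linarith
    qed
    moreover have "\<bar>d x\<bar> \<le> C" for x using d(2)[of x] by (simp add: C_def)
    ultimately show "\<exists>d. (\<forall>x. (w t has_real_derivative d x) (at x)) \<and> (\<forall>x. \<bar>d x\<bar> \<le> C) \<and> (\<forall>x y. \<bar>d x - d y\<bar> \<le> C * \<bar>x - y\<bar>)"
      using d(1) by blast
  qed
qed

section \<open>From weak limits to pointwise identities\<close>

text \<open>A continuous minorant of the indicator of the open interval, with ramps of slope n.
  Slope and endpoints are separate parameters, so that rational endpoints give a countable
  family.\<close>

definition trapezoid :: "real \<Rightarrow> real \<Rightarrow> nat \<Rightarrow> real \<Rightarrow> real" where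
  "trapezoid a b n x = max 0 (min 1 (real n * min (x - a) (b - x)))"

lemma trapezoid_bounds: "0 \<le> trapezoid a b n x" "trapezoid a b n x \<le> 1"
  by (auto simp: trapezoid_def)

lemma trapezoid_outside: "x \<notin> {a<..<b} \<Longrightarrow> trapezoid a b n x = 0"
proof -
  assume "x \<notin> {a<..<b}"
  then have "min (x - a) (b - x) \<le> 0" by auto
  then have "real n * min (x - a) (b - x) \<le> 0" by (intro mult_nonneg_nonpos) auto
  then show ?thesis by (simp add: trapezoid_def)
qed

lemma trapezoid_continuous: "continuous_on S (trapezoid a b n)"
  unfolding trapezoid_def by (intro continuous_intros)

lemma trapezoid_meas [measurable]: "trapezoid a b n \<in> borel_measurable borel"
  by (rule borel_measurable_continuous_onI[OF trapezoid_continuous])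

lemma trapezoid_compactly_supported: "compactly_supported (trapezoid a b n)"
proof -
  have "trapezoid a b n x = 0 \<or> x \<in> {a..b}" for x
    using trapezoid_outside[of x a b n] by (cases "x \<in> {a<..<b}") auto
  then have "{x. trapezoid a b n x \<noteq> 0} \<subseteq> {a..b}" by blast
  then show ?thesis unfolding compactly_supported_def compact_closure
    by (rule bounded_subset[OF bounded_closed_interval])
qed

text \<open>The endpoints may move with n because only rational ones are available later. They
  approach from inside, which keeps the support within the limiting interval and makes the limit 0
  at its endpoints.\<close>

lemma trapezoid_tendsto:
  assumes r: "\<And>n. a \<le> r n" "r \<longlonglongrightarrow> a" and s: "\<And>n. s n \<le> b" "s \<longlonglongrightarrow> b"
  shows "(\<lambda>n. trapezoid (r n) (s n) n x) \<longlonglongrightarrow> indicator {a<..<b} x"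
proof (cases "x \<in> {a<..<b}")
  case True
  define e where "e = min (x - a) (b - x) / 2"
  have e: "e > 0" using True by (simp add: e_def)
  have "\<forall>\<^sub>F n in sequentially. r n < a + e" "\<forall>\<^sub>F n in sequentially. s n > b - e"
    using r(2) s(2) e by (auto intro: order_tendstoD)
  moreover have "\<forall>\<^sub>F n in sequentially. n \<ge> nat \<lceil>1 / e\<rceil>" by (rule eventually_ge_at_top)
  ultimately have "\<forall>\<^sub>F n in sequentially. trapezoid (r n) (s n) n x = 1"
  proof eventually_elim
    case (elim n)
    have "2 * e \<le> x - a" "2 * e \<le> b - x" by (auto simp: e_def)
    then have "e \<le> min (x - r n) (s n - x)" using elim(1,2) by auto
    moreover have "1 \<le> real n * e" using elim(3) e by (simp add: field_simps nat_le_iff ceiling_le_iff)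
    ultimately have "1 \<le> real n * min (x - r n) (s n - x)"
      by (meson mult_left_mono of_nat_0_le_iff order_trans)
    then show ?case by (simp add: trapezoid_def)
  qed
  then show ?thesis using True by (simp add: tendsto_eventually)
next
  case False
  have "trapezoid (r n) (s n) n x = 0" for n
    by (rule trapezoid_outside) (use False r(1)[of n] s(1)[of n] in auto)
  then show ?thesis using False by simp
qed

lemma compactly_supported_product:
  fixes \<alpha> \<beta> :: "real \<Rightarrow> real"
  assumes "compactly_supported \<alpha>" "compactly_supported \<beta>"
  shows "compactly_supported (\<lambda>z. \<alpha> (fst z) * \<beta> (snd z))"
proof -
  have "bounded ({x. \<alpha> x \<noteq> 0} \<times> {x. \<beta> x \<noteq> 0})"
    using assms by (intro bounded_Times) (auto simp: compactly_supported_def compact_closure)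
  then show ?thesis unfolding compactly_supported_def compact_closure
    by (rule bounded_subset) auto
qed

text \<open>Positive and negative part of f are densities of two measures that agree on all half
  lines, hence are equal; densities are unique almost everywhere.\<close>

lemma AE_eq_0_if_integrals_eq_0:
  fixes f :: "real \<Rightarrow> real"
  assumes int: "integrable lborel f" and zero: "\<And>x. (LBINT t:{x<..}. f t) = 0"
  shows "AE t in lborel. f t = 0"
proof -
  have [measurable]: "f \<in> borel_measurable borel" using int by auto
  define p n where "p t = max 0 (f t)" and "n t = max 0 (- f t)" for t
  have pn: "integrable lborel p" "integrable lborel n" unfolding p_def n_def using int by auto
  have [measurable]: "p \<in> borel_measurable borel" "n \<in> borel_measurable borel" unfolding p_def n_def by auto
  have em: "emeasure (density lborel (\<lambda>t. ennreal (h t))) {x<..} = ennreal (LBINT t:{x<..}. h t)"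
    if "integrable lborel h" "\<And>t. h t \<ge> 0" for h :: "real \<Rightarrow> real" and x
  proof -
    have [measurable]: "h \<in> borel_measurable borel" using that by auto
    have si: "integrable lborel (\<lambda>t. indicat_real {x<..} t *\<^sub>R h t)"
      by (rule integrable_mult_indicator[OF _ that(1)]) simp
    have "emeasure (density lborel (\<lambda>t. ennreal (h t))) {x<..} = (\<integral>\<^sup>+t. ennreal (h t) * indicator {x<..} t \<partial>lborel)"
      by (rule emeasure_density) auto
    also have "\<dots> = (\<integral>\<^sup>+t. ennreal (indicat_real {x<..} t *\<^sub>R h t) \<partial>lborel)"
      by (intro nn_integral_cong) (auto simp: indicator_def)
    also have "\<dots> = ennreal (LBINT t:{x<..}. h t)"
      unfolding set_lebesgue_integral_def by (rule nn_integral_eq_integral[OF si]) (use that(2) in auto)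
    finally show ?thesis .
  qed
  have eq: "(LBINT t:{x<..}. p t) = (LBINT t:{x<..}. n t)" for x
  proof -
    have si: "set_integrable lborel {x<..} p" "set_integrable lborel {x<..} n"
      unfolding set_integrable_def by (auto intro!: integrable_mult_indicator pn simp del: real_scaleR_def)
    have "(LBINT t:{x<..}. p t) - (LBINT t:{x<..}. n t) = (LBINT t:{x<..}. p t - n t)"
      using si by (simp add: set_integral_diff)
    also have "(\<lambda>t. p t - n t) = f" by (auto simp: p_def n_def max_def)
    finally show ?thesis using zero by simp
  qed
  have nn: "p t \<ge> 0" "n t \<ge> 0" for t by (auto simp: p_def n_def)
  have "density lborel (\<lambda>t. ennreal (p t)) = density lborel (\<lambda>t. ennreal (n t))"
    by (rule measure_eqI_lessThan) (auto simp: em[OF pn(1) nn(1)] em[OF pn(2) nn(2)] eq)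
  then have "AE t in lborel. ennreal (p t) = ennreal (n t)"
    by (subst (asm) sigma_finite_measure.density_unique_iff[OF sigma_finite_lborel]) auto
  then show ?thesis
  proof eventually_elim
    case (elim t)
    then have "p t = n t" using nn by simp
    then show ?case by (auto simp: p_def n_def max_def split: if_splits)
  qed
qed

lemma borel_measure_eqI_intervals:
  fixes M N :: "real measure"
  assumes sets: "sets M = sets borel" "sets N = sets borel"
    and eq: "\<And>a b. a < b \<Longrightarrow> emeasure M {a<..<b} = emeasure N {a<..<b}"
    and fin: "\<And>a b. emeasure M {a<..<b} < \<infinity>"
  shows "M = N"
proof -
  define E :: "real set set" where "E = range (\<lambda>(a, b). {a<..<b})"
  define A where "A n = {- real n<..<real n}" for n
  have "Int_stable E"
  proof (rule Int_stableI)
    fix X Y assume "X \<in> E" "Y \<in> E"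
    then obtain a b c d where XY: "X = {a<..<b}" "Y = {c<..<d}" by (auto simp: E_def)
    have "X \<inter> Y = {max a c<..<min b d}" by (auto simp: XY)
    then show "X \<inter> Y \<in> E" by (auto simp: E_def)
  qed
  moreover have "sets borel = sigma_sets UNIV E"
    unfolding E_def box_real[symmetric] by (subst borel_eq_box) (rule sets_measure_of, simp)
  then have "sets M = sigma_sets UNIV E" "sets N = sigma_sets UNIV E"
    by (simp_all only: sets)
  moreover have "emeasure M X = emeasure N X" if X: "X \<in> E" for X
  proof -
    obtain p where "X = (\<lambda>(a, b). {a<..<b}) p" using X unfolding E_def by (rule imageE)
    then have X: "X = {fst p<..<snd p}" by (simp only: case_prod_beta)
    show ?thesis unfolding X by (cases "fst p < snd p") (simp_all add: eq)
  qed
  moreover have "range A \<subseteq> E" by (auto simp: A_def E_def)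
  moreover have "(\<Union>i. A i) = UNIV"
  proof (intro set_eqI iffI UNIV_I)
    fix x :: real
    obtain n :: nat where "\<bar>x\<bar> < real n" using reals_Archimedean2 by blast
    then have "x \<in> A n" by (auto simp: A_def)
    then show "x \<in> (\<Union>i. A i)" by blast
  qed
  moreover have "emeasure M (A i) \<noteq> \<infinity>" for i
    unfolding A_def by (rule less_imp_neq[OF fin])
  moreover have "E \<subseteq> Pow UNIV" by simp
  ultimately show ?thesis by (intro measure_eqI_generator_eq[of E UNIV M N A])
qed

lemma small_value_on_interval:
  fixes f :: "real \<Rightarrow> real"
  assumes cont: "continuous_on {a..b} f" and "a < b"
  shows "\<exists>y\<in>{a..b}. \<bar>f y\<bar> * (b - a) \<le> (LBINT x:{a..b}. \<bar>f x\<bar>)"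
proof -
  have c: "continuous_on {a..b} (\<lambda>x. \<bar>f x\<bar>)" by (intro continuous_intros cont)
  obtain y where y: "y \<in> {a..b}" "\<And>x. x \<in> {a..b} \<Longrightarrow> \<bar>f y\<bar> \<le> \<bar>f x\<bar>"
    using continuous_attains_inf[OF compact_Icc _ c] \<open>a < b\<close> by auto
  have "(LBINT x:{a..b}. \<bar>f y\<bar>) \<le> (LBINT x:{a..b}. \<bar>f x\<bar>)"
    by (intro set_integral_mono borel_integrable_atLeastAtMost' c continuous_intros y(2))
  moreover have "(LBINT x:{a..b}. \<bar>f y\<bar>) = \<bar>f y\<bar> * (b - a)"
    using \<open>a < b\<close> by (simp add: set_lebesgue_integral_def)
  ultimately show ?thesis using y(1) by auto
qed

lemma set_integral_abs_subset_le:
  fixes f :: "real \<Rightarrow> real"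
  assumes cont: "continuous_on {a..b} f" and "a \<le> c" "d \<le> b"
  shows "(LBINT x:{c..d}. \<bar>f x\<bar>) \<le> (LBINT x:{a..b}. \<bar>f x\<bar>)"
proof -
  have i: "set_integrable lborel {a..b} (\<lambda>x. \<bar>f x\<bar>)"
    by (intro borel_integrable_atLeastAtMost' continuous_intros cont)
  then have j: "set_integrable lborel {c..d} (\<lambda>x. \<bar>f x\<bar>)"
    by (rule set_integrable_subset) (use assms in auto)
  show ?thesis unfolding set_lebesgue_integral_def
    by (rule integral_mono) (use i j assms in \<open>auto simp: set_integrable_def indicator_def\<close>)
qed

text \<open>Somewhere in the interval |f| does not exceed its mean, and the Lipschitz bound carries
  this to \<open>x\<close>. This upgrades L^1 continuity in time to pointwise continuity.\<close>

lemma Lipschitz_value_le_integral: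
  fixes f :: "real \<Rightarrow> real"
  assumes lip: "\<And>x y. \<bar>f x - f y\<bar> \<le> K * \<bar>x - y\<bar>" and K: "K \<ge> 0" and h: "h > 0"
  shows "\<bar>f x\<bar> \<le> (LBINT z:{x..x + h}. \<bar>f z\<bar>) / h + K * h"
proof -
  have "K-lipschitz_on UNIV f" using lip K by (auto simp: lipschitz_on_def dist_real_def)
  then have cont: "continuous_on S f" for S
    using lipschitz_on_continuous_on continuous_on_subset by blast
  obtain y where y: "y \<in> {x..x + h}" "\<bar>f y\<bar> * h \<le> (LBINT z:{x..x + h}. \<bar>f z\<bar>)"
    using small_value_on_interval[OF cont, of x "x + h"] h by auto
  have "\<bar>f y\<bar> \<le> (LBINT z:{x..x + h}. \<bar>f z\<bar>) / h" using y(2) h by (simp add: field_simps)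
  moreover have "\<bar>f x - f y\<bar> \<le> K * h"
    using lip[of x y] mult_left_mono[of "\<bar>x - y\<bar>" h K] y(1) K by auto
  ultimately show ?thesis by linarith
qed

text \<open>Turns \<open>L\<^sup>1\<close> convergence of functions whose derivatives have a common Lipschitz constant into pointwise
  convergence of the derivatives.\<close>

lemma derivative_le_integral:
  fixes f f' :: "real \<Rightarrow> real"
  assumes f': "\<And>x. (f has_real_derivative f' x) (at x)"
    and lip: "\<And>x y. \<bar>f' x - f' y\<bar> \<le> K * \<bar>x - y\<bar>" and K: "K \<ge> 0" and h: "h > 0"
  shows "\<bar>f' x\<bar> \<le> 2 * (LBINT z:{x..x + 3 * h}. \<bar>f z\<bar>) / h\<^sup>2 + 3 * K * h"
proof -
  define I where "I = (LBINT z:{x..x + 3 * h}. \<bar>f z\<bar>)"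
  have cont: "continuous_on S f" for S
    using f' by (intro continuous_at_imp_continuous_on ballI DERIV_isCont)
  \<comment> \<open>One point is taken in each outer third of the interval: f is small at both, and
    the middle third keeps them at least h apart, so the mean value theorem gives a small derivative
    in between.\<close>
  obtain y1 where y1: "y1 \<in> {x..x + h}" "\<bar>f y1\<bar> * h \<le> (LBINT z:{x..x + h}. \<bar>f z\<bar>)"
    using small_value_on_interval[OF cont, of x "x + h"] h by auto
  obtain y2 where y2: "y2 \<in> {x + 2 * h..x + 3 * h}" "\<bar>f y2\<bar> * h \<le> (LBINT z:{x + 2 * h..x + 3 * h}. \<bar>f z\<bar>)"
    using small_value_on_interval[OF cont, of "x + 2 * h" "x + 3 * h"] h by auto
  have I1: "\<bar>f y1\<bar> * h \<le> I"
    using y1(2) set_integral_abs_subset_le[OF cont, of x x "x + h" "x + 3 * h"] h by (simp add: I_def)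
  have I2: "\<bar>f y2\<bar> * h \<le> I"
    using y2(2) set_integral_abs_subset_le[OF cont, of x "x + 2 * h" "x + 3 * h" "x + 3 * h"] h by (simp add: I_def)
  have lt: "y1 < y2" and hle: "h \<le> y2 - y1" using y1 y2 h by auto
  obtain z where z: "y1 < z" "z < y2" "f y2 - f y1 = (y2 - y1) * f' z"
    using MVT2[OF lt, of f f'] f' by blast
  have "h * \<bar>f' z\<bar> \<le> (y2 - y1) * \<bar>f' z\<bar>" using hle by (intro mult_right_mono) auto
  also have "\<dots> = \<bar>f y2 - f y1\<bar>" using lt by (simp add: z(3) abs_mult)
  also have "\<dots> \<le> \<bar>f y2\<bar> + \<bar>f y1\<bar>" by (rule abs_triangle_ineq4)
  finally have "h * \<bar>f' z\<bar> * h \<le> (\<bar>f y2\<bar> + \<bar>f y1\<bar>) * h" using h by (intro mult_right_mono) auto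
  also have "\<dots> \<le> 2 * I" using I1 I2 by (simp add: distrib_right)
  finally have "\<bar>f' z\<bar> \<le> 2 * I / h\<^sup>2" using h by (simp add: field_simps power2_eq_square)
  moreover have "\<bar>f' x - f' z\<bar> \<le> 3 * K * h"
    using lip[of x z] mult_left_mono[of "\<bar>x - z\<bar>" "3 * h" K] z y1 y2 K by auto
  ultimately show ?thesis unfolding I_def by linarith
qed

section \<open>Passage to the limit\<close>

lemma integrable_indicator_mult:
  fixes a b c :: real
  shows "integrable lborel (\<lambda>x. indicat_real {a..b} x * c)" "integrable lborel (\<lambda>x. indicat_real {a<..<b} x * c)"
  by (intro integrable_mult_left integrable_real_indicator; cases "a \<le> b"; simp)+

text \<open>What the Lagrangian analysis delivers, in Eulerian terms: spatial derivatives that are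
  bounded and Lipschitz with one constant for all k and all times up to T.\<close>

locale gradient_limit =
  fixes w d :: "nat \<Rightarrow> real \<Rightarrow> real \<Rightarrow> real" and u :: "real \<Rightarrow> real \<Rightarrow> real"
    and \<nu> :: "real \<Rightarrow> real measure" and T C :: real
  assumes T: "T > 0"
    and w_derivative: "\<And>k t x. t \<in> {0..T} \<Longrightarrow> (w k t has_real_derivative d k t x) (at x)"
    and d_bound: "\<And>k t x. t \<in> {0..T} \<Longrightarrow> \<bar>d k t x\<bar> \<le> C"
    and d_Lipschitz: "\<And>k t x y. t \<in> {0..T} \<Longrightarrow> \<bar>d k t x - d k t y\<bar> \<le> C * \<bar>x - y\<bar>"
    and conv: "converges_C_L1loc w u"
    and \<nu>: "Linf_measure \<nu>"
    and weak: "converges_weakly_measure (\<lambda>k t x. (deriv (w k t) x)\<^sup>2 / 2) \<nu>"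
begin

lemma C_nonneg: "C \<ge> 0"
  using d_bound[of 0 undefined undefined] T by fastforce

lemma w_cont: "t \<in> {0..T} \<Longrightarrow> continuous_on S (w k t)"
  using w_derivative by (intro continuous_at_imp_continuous_on ballI DERIV_isCont)

lemma w_Lipschitz:
  assumes "t \<in> {0..T}"
  shows "\<bar>w k t x - w k t y\<bar> \<le> C * \<bar>x - y\<bar>"
proof -
  have "norm (w k t x - w k t y) \<le> C * norm (x - y)"
    by (rule field_differentiable_bound[where f' = "d k t" and S = UNIV])
      (use assms w_derivative d_bound in auto)
  then show ?thesis by simp
qed

lemma d_cont:
  assumes "t \<in> {0..T}"
  shows "continuous_on S (d k t)"
proof -
  have "C-lipschitz_on S (d k t)"
    using d_Lipschitz[OF assms] C_nonneg by (auto simp: lipschitz_on_def dist_real_def)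
  then show ?thesis by (rule lipschitz_on_continuous_on)
qed

lemma L1_integrable:
  assumes "t \<in> {0..T}"
  shows "set_integrable lborel {a..b} (w k t)" "set_integrable lborel {a..b} (u t)"
    "u t \<in> borel_measurable borel"
  using conv assms by (auto simp: converges_C_L1loc_def C_L1loc_def locally_integrable_def)

lemma L1_tendsto:
  assumes "t \<in> {0..T}"
  shows "(\<lambda>k. LBINT x:{a..b}. \<bar>w k t x - u t x\<bar>) \<longlonglongrightarrow> 0"
proof -
  have "uniform_limit {0..T} (\<lambda>k t. LBINT x:{a..b}. \<bar>w k t x - u t x\<bar>) (\<lambda>t. 0) sequentially"
    using conv T by (simp add: converges_C_L1loc_def)
  then show ?thesis using assms by (rule tendsto_uniform_limitI)
qed

text \<open>At this stage u is known only as an L^1 limit and has no derivative to compare with. So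
  \<open>derivative_le_integral\<close> is applied to the differences of two members of the
  sequence, and the limit of the derivatives exists by completeness.\<close>

lemma Cauchy_d:
  assumes t: "t \<in> {0..T}"
  shows "Cauchy (\<lambda>k. d k t x)"
proof (rule metric_CauchyI)
  fix e :: real assume e: "e > 0"
  \<comment> \<open>With this h the Lipschitz error 3 * (2 * C) * h is at most e / 2; the 1 avoids a
    division by 0. The threshold e * h^2 / 8 for each \<open>J\<close> then makes the integral term
    less than e / 2.\<close>
  define h where "h = e / (12 * (C + 1))"
  have h: "h > 0" using e C_nonneg by (simp add: h_def)
  have "3 * (2 * C) * h \<le> 3 * (2 * (C + 1)) * h" using h by simp
  also have "\<dots> = e / 2" using C_nonneg by (simp add: h_def field_simps)
  finally have Ch: "3 * (2 * C) * h \<le> e / 2" .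
  define J where "J k = (LBINT z:{x..x + 3 * h}. \<bar>w k t z - u t z\<bar>)" for k
  have "J \<longlonglongrightarrow> 0" unfolding J_def by (rule L1_tendsto[OF t])
  then have "\<forall>\<^sub>F k in sequentially. J k < e * h\<^sup>2 / 8"
    by (rule order_tendstoD) (use e h in simp)
  then obtain K where K: "\<And>k. k \<ge> K \<Longrightarrow> J k < e * h\<^sup>2 / 8" by (auto simp: eventually_sequentially)
  have "dist (d i t x) (d j t x) < e" if ij: "i \<ge> K" "j \<ge> K" for i j
  proof -
    have abs_int: "set_integrable lborel {x..x + 3 * h} (\<lambda>z. \<bar>w k t z - u t z\<bar>)" for k
      using set_integral_diff(1)[OF L1_integrable(1,2)[OF t]] by (rule set_integrable_abs)
    have "(LBINT z:{x..x + 3 * h}. \<bar>w i t z - w j t z\<bar>) \<le> (LBINT z:{x..x + 3 * h}. \<bar>w i t z - u t z\<bar> + \<bar>w j t z - u t z\<bar>)"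
    proof (rule set_integral_mono)
      show "set_integrable lborel {x..x + 3 * h} (\<lambda>z. \<bar>w i t z - w j t z\<bar>)"
        using set_integral_diff(1)[OF L1_integrable(1)[OF t] L1_integrable(1)[OF t]] by (rule set_integrable_abs)
    qed (use abs_int in \<open>auto intro: set_integral_add(1)\<close>)
    also have "\<dots> = J i + J j" unfolding J_def by (rule set_integral_add(2)[OF abs_int abs_int])
    also have "\<dots> < e * h\<^sup>2 / 4" using K[OF ij(1)] K[OF ij(2)] by simp
    finally have small: "(LBINT z:{x..x + 3 * h}. \<bar>w i t z - w j t z\<bar>) < e * h\<^sup>2 / 4" .
    have "\<bar>d i t x - d j t x\<bar> \<le> 2 * (LBINT z:{x..x + 3 * h}. \<bar>w i t z - w j t z\<bar>) / h\<^sup>2 + 3 * (2 * C) * h"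
    proof (rule derivative_le_integral[OF _ _ _ h])
      show "((\<lambda>x. w i t x - w j t x) has_real_derivative d i t x - d j t x) (at x)" for x
        by (intro DERIV_diff w_derivative t)
      show "\<bar>d i t x - d j t x - (d i t y - d j t y)\<bar> \<le> 2 * C * \<bar>x - y\<bar>" for x y
        using d_Lipschitz[OF t, of i x y] d_Lipschitz[OF t, of j x y] by linarith
    qed (use C_nonneg in simp)
    also have "\<dots> < 2 * (e * h\<^sup>2 / 4) / h\<^sup>2 + e / 2"
      using small Ch h by (intro add_less_le_mono divide_strict_right_mono mult_strict_left_mono) auto
    also have "\<dots> = e" using h by simp
    finally show ?thesis by (simp add: dist_real_def)
  qed
  then show "\<exists>K. \<forall>i\<ge>K. \<forall>j\<ge>K. dist (d i t x) (d j t x) < e" by blast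
qed

definition g where "g t x = lim (\<lambda>k. d k t x)"

lemma d_tendsto: "t \<in> {0..T} \<Longrightarrow> (\<lambda>k. d k t x) \<longlonglongrightarrow> g t x"
  using Cauchy_d real_Cauchy_convergent convergent_LIMSEQ_iff unfolding g_def by blast

lemma g_bound:
  assumes "t \<in> {0..T}"
  shows "\<bar>g t x\<bar> \<le> C"
  by (rule LIMSEQ_le_const2[OF tendsto_rabs[OF d_tendsto[OF assms]]]) (use d_bound[OF assms] in auto)

lemma g_cont:
  assumes t: "t \<in> {0..T}"
  shows "continuous_on S (g t)"
proof -
  have "\<bar>g t x - g t y\<bar> \<le> C * \<bar>x - y\<bar>" for x y
    by (rule LIMSEQ_le_const2[OF tendsto_rabs[OF tendsto_diff[OF d_tendsto[OF t] d_tendsto[OF t]]]])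
      (use d_Lipschitz[OF t] in auto)
  then have "C-lipschitz_on S (g t)"
    using C_nonneg by (auto simp: lipschitz_on_def dist_real_def)
  then show ?thesis by (rule lipschitz_on_continuous_on)
qed

lemma g_meas: "t \<in> {0..T} \<Longrightarrow> g t \<in> borel_measurable borel"
  by (rule borel_measurable_continuous_onI[OF g_cont])

text \<open>Integration by parts for \<open>w k\<close>, followed by the limit in k. The left side
  converges because of the L^1 convergence and the boundedness of the derivative of \<phi>, the
  right side by dominated convergence.\<close>

lemma has_weak_derivative_g:
  assumes t: "t \<in> {0..T}"
  shows "has_weak_derivative (u t) (g t)"
  unfolding has_weak_derivative_def
proof (intro conjI allI impI)
  show "locally_integrable (u t)" using L1_integrable(2)[OF t] by (simp add: locally_integrable_def)
  show "locally_integrable (g t)"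
    unfolding locally_integrable_def by (intro allI borel_integrable_atLeastAtMost' g_cont t)
  fix \<phi> assume \<phi>: "test_function \<phi>"
  have \<phi>': "(\<phi> has_real_derivative deriv \<phi> x) (at x)" for x
  proof -
    have "(deriv ^^ 0) \<phi> field_differentiable at x" using \<phi> unfolding test_function_def smooth_def by blast
    then show ?thesis by (simp add: field_differentiable_derivI)
  qed
  have \<phi>_cont: "continuous_on S \<phi>" for S
    using \<phi>' by (intro continuous_at_imp_continuous_on ballI DERIV_isCont)
  have \<phi>'_cont: "continuous_on S (deriv \<phi>)" for S
  proof -
    have "(deriv ^^ 1) \<phi> field_differentiable at x" for x using \<phi> unfolding test_function_def smooth_def by blast
    then show ?thesis
      by (intro continuous_at_imp_continuous_on ballI field_differentiable_imp_continuous_at) simp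
  qed
  have "bounded {x. \<phi> x \<noteq> 0}"
    using \<phi> by (simp add: test_function_def compactly_supported_def compact_closure)
  then obtain R where R: "R > 0" "\<And>x. \<phi> x \<noteq> 0 \<Longrightarrow> \<bar>x\<bar> < R"
    unfolding bounded_pos_less by auto
  have \<phi>0: "\<phi> x = 0" if "x \<notin> {- R<..<R}" for x using R(2)[of x] that by (cases "\<phi> x = 0") (auto simp: abs_less_iff)
  have \<phi>'0: "deriv \<phi> x = 0" if "x \<notin> {- R..R}" for x
  proof -
    have "((\<lambda>x. 0) has_real_derivative 0) (at x)" by simp
    then have "(\<phi> has_real_derivative 0) (at x)"
      by (rule has_field_derivative_transform_within_open[of _ _ _ "- {- R..R}"])
        (use that \<phi>0 in auto)
    then show ?thesis by (rule DERIV_imp_deriv)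
  qed
  have \<phi>0': "\<phi> x = 0" if "x \<notin> {- R..R}" for x using \<phi>0[of x] that by auto
  have restrict: "(LBINT x. f x * deriv \<phi> x) = (LBINT x:{- R..R}. f x * deriv \<phi> x)"
    "(LBINT x. f x * \<phi> x) = (LBINT x:{- R..R}. f x * \<phi> x)" for f
    unfolding set_lebesgue_integral_def
    by (intro Bochner_Integration.integral_cong refl; use \<phi>0' \<phi>'0 in \<open>auto simp: indicator_def\<close>)+
  have parts: "(LBINT x:{- R..R}. w k t x * deriv \<phi> x) = - (LBINT x:{- R..R}. d k t x * \<phi> x)" for k
  proof -
    have int: "set_integrable lborel {- R..R} (\<lambda>x. w k t x * deriv \<phi> x)" "set_integrable lborel {- R..R} (\<lambda>x. d k t x * \<phi> x)"
      by (intro borel_integrable_atLeastAtMost' continuous_intros w_cont d_cont t \<phi>_cont \<phi>'_cont)+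
    have "((\<lambda>x. d k t x * \<phi> x + w k t x * deriv \<phi> x) has_integral w k t R * \<phi> R - w k t (- R) * \<phi> (- R)) {- R..R}"
    proof (rule fundamental_theorem_of_calculus)
      fix x
      have "((\<lambda>x. w k t x * \<phi> x) has_real_derivative d k t x * \<phi> x + deriv \<phi> x * w k t x) (at x)"
        by (rule DERIV_mult[OF w_derivative[OF t] \<phi>'])
      then show "((\<lambda>x. w k t x * \<phi> x) has_vector_derivative d k t x * \<phi> x + w k t x * deriv \<phi> x) (at x within {- R..R})"
        by (simp add: has_real_derivative_iff_has_vector_derivative mult.commute has_vector_derivative_at_within)
    qed (use R in simp)
    then have "integral {- R..R} (\<lambda>x. d k t x * \<phi> x + w k t x * deriv \<phi> x) = 0"
      using \<phi>0[of R] \<phi>0[of "- R"] by (simp add: integral_unique)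
    then have "(LBINT x:{- R..R}. d k t x * \<phi> x + w k t x * deriv \<phi> x) = 0"
      using set_borel_integral_eq_integral(2)[OF set_integral_add(1)[OF int(2) int(1)]] by simp
    then show ?thesis using set_integral_add(2)[OF int(2) int(1)] by simp
  qed
  obtain B where "\<forall>x\<in>{- R..R}. \<bar>deriv \<phi> x\<bar> \<le> B"
    using compact_imp_bounded[OF compact_continuous_image[OF \<phi>'_cont compact_Icc, of "- R" R]]
    unfolding bounded_iff by auto
  then have B: "\<And>x. x \<in> {- R..R} \<Longrightarrow> \<bar>deriv \<phi> x\<bar> \<le> B" by blast
  have lim1: "(\<lambda>k. LBINT x:{- R..R}. w k t x * deriv \<phi> x) \<longlonglongrightarrow> (LBINT x:{- R..R}. u t x * deriv \<phi> x)"
  proof (rule LIM_zero_cancel, rule Lim_null_comparison)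
    have uint: "set_integrable lborel {- R..R} (\<lambda>x. u t x * deriv \<phi> x)"
    proof (rule set_integrable_bound)
      show "set_integrable lborel {- R..R} (\<lambda>x. B * u t x)" using L1_integrable(2)[OF t] by simp
      have [measurable]: "u t \<in> borel_measurable borel" "deriv \<phi> \<in> borel_measurable borel"
        using L1_integrable(3)[OF t] \<phi>'_cont[of UNIV] by (auto intro: borel_measurable_continuous_onI)
      show "set_borel_measurable lborel {- R..R} (\<lambda>x. u t x * deriv \<phi> x)"
        unfolding set_borel_measurable_def by measurable
      show "AE x in lborel. x \<in> {- R..R} \<longrightarrow> norm (u t x * deriv \<phi> x) \<le> norm (B * u t x)"
      proof (intro AE_I2 impI)
        fix x assume "x \<in> {- R..R}"
        then have "\<bar>deriv \<phi> x\<bar> \<le> \<bar>B\<bar>" using B[of x] by linarith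
        then show "norm (u t x * deriv \<phi> x) \<le> norm (B * u t x)"
          by (simp add: abs_mult mult.commute mult_right_mono)
      qed
    qed
    show "\<forall>\<^sub>F k in sequentially. norm ((LBINT x:{- R..R}. w k t x * deriv \<phi> x) - (LBINT x:{- R..R}. u t x * deriv \<phi> x))
      \<le> B * (LBINT x:{- R..R}. \<bar>w k t x - u t x\<bar>)"
    proof (intro always_eventually allI)
      fix k
      have wint: "set_integrable lborel {- R..R} (\<lambda>x. w k t x * deriv \<phi> x)"
        by (intro borel_integrable_atLeastAtMost' continuous_intros w_cont t \<phi>'_cont)
      have dint: "set_integrable lborel {- R..R} (\<lambda>x. \<bar>w k t x - u t x\<bar>)"
        using set_integral_diff(1)[OF L1_integrable(1,2)[OF t]] by (rule set_integrable_abs)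
      have eq: "(LBINT x:{- R..R}. w k t x * deriv \<phi> x) - (LBINT x:{- R..R}. u t x * deriv \<phi> x)
        = (LBINT x:{- R..R}. w k t x * deriv \<phi> x - u t x * deriv \<phi> x)"
        using set_integral_diff(2)[OF wint uint] by simp
      have "\<bar>LBINT x:{- R..R}. w k t x * deriv \<phi> x - u t x * deriv \<phi> x\<bar>
        \<le> (LBINT x:{- R..R}. \<bar>w k t x * deriv \<phi> x - u t x * deriv \<phi> x\<bar>)"
        using set_integral_norm_bound[OF set_integral_diff(1)[OF wint uint]] by simp
      also have "\<dots> \<le> (LBINT x:{- R..R}. B * \<bar>w k t x - u t x\<bar>)"
      proof (rule set_integral_mono)
        show "set_integrable lborel {- R..R} (\<lambda>x. \<bar>w k t x * deriv \<phi> x - u t x * deriv \<phi> x\<bar>)"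
          using set_integral_diff(1)[OF wint uint] by (rule set_integrable_abs)
        show "set_integrable lborel {- R..R} (\<lambda>x. B * \<bar>w k t x - u t x\<bar>)" using dint by simp
        fix x assume x: "x \<in> {- R..R}"
        have "w k t x * deriv \<phi> x - u t x * deriv \<phi> x = deriv \<phi> x * (w k t x - u t x)"
          by (simp add: algebra_simps)
        then have "\<bar>w k t x * deriv \<phi> x - u t x * deriv \<phi> x\<bar> = \<bar>deriv \<phi> x\<bar> * \<bar>w k t x - u t x\<bar>"
          by (simp only: abs_mult)
        also have "\<dots> \<le> B * \<bar>w k t x - u t x\<bar>" using B[OF x] by (rule mult_right_mono) simp
        finally show "\<bar>w k t x * deriv \<phi> x - u t x * deriv \<phi> x\<bar> \<le> B * \<bar>w k t x - u t x\<bar>" .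
      qed
      finally show "norm ((LBINT x:{- R..R}. w k t x * deriv \<phi> x) - (LBINT x:{- R..R}. u t x * deriv \<phi> x))
        \<le> B * (LBINT x:{- R..R}. \<bar>w k t x - u t x\<bar>)" unfolding eq by simp
    qed
    have "(\<lambda>k. B * (LBINT x:{- R..R}. \<bar>w k t x - u t x\<bar>)) \<longlonglongrightarrow> B * 0"
      by (intro tendsto_intros L1_tendsto[OF t])
    then show "(\<lambda>k. B * (LBINT x:{- R..R}. \<bar>w k t x - u t x\<bar>)) \<longlonglongrightarrow> 0" by simp
  qed
  have lim2: "(\<lambda>k. LBINT x:{- R..R}. d k t x * \<phi> x) \<longlonglongrightarrow> (LBINT x:{- R..R}. g t x * \<phi> x)"
    unfolding set_lebesgue_integral_def
  proof (rule integral_dominated_convergence[where w = "\<lambda>x. indicat_real {- R..R} x *\<^sub>R (C * \<bar>\<phi> x\<bar>)"])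
    have [measurable]: "d k t \<in> borel_measurable borel" "g t \<in> borel_measurable borel" "\<phi> \<in> borel_measurable borel" for k
      using d_cont[OF t, of UNIV] g_meas[OF t] \<phi>_cont[of UNIV] by (auto intro: borel_measurable_continuous_onI)
    show "(\<lambda>x. indicat_real {- R..R} x *\<^sub>R (g t x * \<phi> x)) \<in> borel_measurable lborel"
      "(\<lambda>x. indicat_real {- R..R} x *\<^sub>R (d k t x * \<phi> x)) \<in> borel_measurable lborel" for k by measurable
    have "set_integrable lborel {- R..R} (\<lambda>x. C * \<bar>\<phi> x\<bar>)"
      by (intro borel_integrable_atLeastAtMost' continuous_intros \<phi>_cont)
    then show "integrable lborel (\<lambda>x. indicat_real {- R..R} x *\<^sub>R (C * \<bar>\<phi> x\<bar>))" by (simp add: set_integrable_def)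
    show "AE x in lborel. (\<lambda>k. indicat_real {- R..R} x *\<^sub>R (d k t x * \<phi> x)) \<longlonglongrightarrow> indicat_real {- R..R} x *\<^sub>R (g t x * \<phi> x)"
      by (intro AE_I2 tendsto_intros d_tendsto[OF t])
    show "AE x in lborel. norm (indicat_real {- R..R} x *\<^sub>R (d k t x * \<phi> x)) \<le> indicat_real {- R..R} x *\<^sub>R (C * \<bar>\<phi> x\<bar>)" for k
      using d_bound[OF t] by (auto simp: indicator_def abs_mult intro!: mult_right_mono)
  qed
  have "(\<lambda>k. - (LBINT x:{- R..R}. d k t x * \<phi> x)) \<longlonglongrightarrow> - (LBINT x:{- R..R}. g t x * \<phi> x)"
    by (rule tendsto_minus[OF lim2])
  then have "(LBINT x:{- R..R}. u t x * deriv \<phi> x) = - (LBINT x:{- R..R}. g t x * \<phi> x)"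
    using lim1 unfolding parts by (intro LIMSEQ_unique)
  then show "(LBINT x. u t x * deriv \<phi> x) = - (LBINT x. g t x * \<phi> x)" unfolding restrict .
qed (use L1_integrable(3)[OF t] g_meas[OF t] in auto)

text \<open>L^1 continuity in time does not give pointwise continuity by itself; the Lipschitz bound
  in space does the rest. Needed for the joint measurability of \<open>d\<close>.\<close>

lemma w_time_continuous: "continuous_on {0..T} (\<lambda>t. w k t x)"
  unfolding continuous_on_def
proof (intro ballI tendstoI)
  fix t e :: real assume t: "t \<in> {0..T}" and e: "e > 0"
  define h where "h = e / (4 * (C + 1))"
  have h: "h > 0" using e C_nonneg by (simp add: h_def)
  have "2 * C * h \<le> 2 * (C + 1) * h" using h by simp
  also have "\<dots> = e / 2" using C_nonneg by (simp add: h_def field_simps)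
  finally have Ch: "2 * C * h \<le> e / 2" .
  have "((\<lambda>s. LBINT z:{x..x + h}. \<bar>w k s z - w k t z\<bar>) \<longlongrightarrow> 0) (at t within {0..})"
    using conv t by (auto simp: converges_C_L1loc_def C_L1loc_def)
  then have "((\<lambda>s. LBINT z:{x..x + h}. \<bar>w k s z - w k t z\<bar>) \<longlongrightarrow> 0) (at t within {0..T})"
    by (rule tendsto_within_subset) auto
  then have "\<forall>\<^sub>F s in at t within {0..T}. (LBINT z:{x..x + h}. \<bar>w k s z - w k t z\<bar>) < e * h / 2"
    by (rule order_tendstoD) (use e h in simp)
  moreover have "\<forall>\<^sub>F s in at t within {0..T}. s \<in> {0..T}" by (simp add: eventually_at_filter)
  ultimately show "\<forall>\<^sub>F s in at t within {0..T}. dist (w k s x) (w k t x) < e"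
  proof eventually_elim
    case (elim s)
    have "\<bar>w k s x - w k t x\<bar> \<le> (LBINT z:{x..x + h}. \<bar>w k s z - w k t z\<bar>) / h + 2 * C * h"
    proof (rule Lipschitz_value_le_integral[OF _ _ h])
      show "\<bar>w k s x - w k t x - (w k s y - w k t y)\<bar> \<le> 2 * C * \<bar>x - y\<bar>" for x y
        using w_Lipschitz[OF t, of k x y] w_Lipschitz[OF elim(2), of k x y] by linarith
    qed (use C_nonneg in simp)
    also have "\<dots> < (e * h / 2) / h + e / 2"
      using elim(1) h Ch by (intro add_less_le_mono divide_strict_right_mono) auto
    finally show ?case using h by (simp add: dist_real_def)
  qed
qed

text \<open>The hypotheses concern only times in \<open>{0..T}\<close>; clamping the time makes joint measurability a
  statement about functions on the whole plane.\<close>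

definition clampT where "clampT t = max 0 (min T t)"

lemma clampT: "clampT t \<in> {0..T}" "t \<in> {0..T} \<Longrightarrow> clampT t = t"
  using T by (auto simp: clampT_def)

text \<open>The derivative is a pointwise limit of difference quotients, and these are jointly
  continuous in time and space.\<close>

lemma d_meas: "(\<lambda>z. d k (clampT (fst z)) (snd z)) \<in> borel_measurable borel"
proof (rule borel_measurable_LIMSEQ_real)
  have strip: "continuous_on ({0..T} \<times> UNIV) (\<lambda>z. w k (fst z) (snd z))"
    by (rule continuous_on_stripI[where f = "w k", OF w_Lipschitz w_time_continuous])
  have cont: "continuous_on UNIV (\<lambda>z::real \<times> real. w k (clampT (fst z)) (snd z + c))" for c
  proof -
    have "continuous_on UNIV (\<lambda>z::real \<times> real. (clampT (fst z), snd z + c))"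
      unfolding clampT_def by (intro continuous_intros)
    from continuous_on_compose2[OF strip this] show ?thesis using clampT(1) by (auto simp: image_subset_iff)
  qed
  show "(\<lambda>z. (w k (clampT (fst z)) (snd z + inverse (real (Suc n))) - w k (clampT (fst z)) (snd z)) / inverse (real (Suc n))) \<in> borel_measurable borel" for n
    using cont[of "inverse (real (Suc n))"] cont[of 0] by (intro borel_measurable_continuous_onI continuous_intros) auto
  fix z :: "real \<times> real"
  have "filterlim (\<lambda>n. inverse (real (Suc n))) (at 0) sequentially"
    using LIMSEQ_inverse_real_of_nat by (auto simp: filterlim_at)
  then show "(\<lambda>n. (w k (clampT (fst z)) (snd z + inverse (real (Suc n))) - w k (clampT (fst z)) (snd z)) / inverse (real (Suc n))) \<longlonglongrightarrow> d k (clampT (fst z)) (snd z)"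
    by (rule filterlim_compose[OF DERIV_D[OF w_derivative[OF clampT(1)]]])
qed

lemma g_meas2: "(\<lambda>z. g (clampT (fst z)) (snd z)) \<in> borel_measurable borel"
  by (rule borel_measurable_LIMSEQ_real[OF _ d_meas]) (rule d_tendsto[OF clampT(1)])

lemma energy_meas:
  fixes f :: "real \<Rightarrow> real \<Rightarrow> real"
  assumes f: "(\<lambda>z. f (clampT (fst z)) (snd z)) \<in> borel_measurable borel" and [measurable]: "\<beta> \<in> borel_measurable borel"
  shows "(\<lambda>t. LBINT x. \<beta> x * ((f (clampT t) x)\<^sup>2 / 2)) \<in> borel_measurable borel"
proof -
  have "(\<lambda>z. f (clampT (fst z)) (snd z)) \<in> borel_measurable (borel \<Otimes>\<^sub>M borel)"
    using f by (simp add: borel_prod)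
  then have [measurable]: "(\<lambda>z. f (clampT (fst z)) (snd z)) \<in> borel_measurable (borel \<Otimes>\<^sub>M lborel)"
    by (simp cong: measurable_cong_sets add: sets_pair_measure_cong[OF refl sets_lborel])
  have "(\<lambda>t. LBINT x. (\<lambda>z. \<beta> (snd z) * ((f (clampT (fst z)) (snd z))\<^sup>2 / 2)) (t, x)) \<in> borel_measurable borel"
    by (rule sigma_finite_measure.borel_measurable_lebesgue_integral[OF sigma_finite_lborel]) (simp add: case_prod_beta')
  then show ?thesis by simp
qed

text \<open>The weak convergence is tested with a product of a trapezoid in time and \<beta> in
  space. Since the derivatives converge boundedly, the energies tend to that of \<open>g\<close>,
  and the two time integrals agree on intervals. The resulting null set of times depends on
  \<beta>.\<close>

lemma AE_energy_eq:
  assumes cont: "continuous_on UNIV \<beta>" and supp: "compactly_supported \<beta>"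
  shows "AE t in lborel. t \<in> {0..T} \<longrightarrow> (\<integral>x. \<beta> x \<partial>(\<nu> t)) = (LBINT x. \<beta> x * ((g t x)\<^sup>2 / 2))"
proof -
  have [measurable]: "\<beta> \<in> borel_measurable borel" by (rule borel_measurable_continuous_onI[OF cont])
  have "bounded {x. \<beta> x \<noteq> 0}"
    using supp by (simp add: compactly_supported_def compact_closure)
  then obtain R where R: "R > 0" "\<And>x. \<beta> x \<noteq> 0 \<Longrightarrow> \<bar>x\<bar> < R"
    unfolding bounded_pos_less by auto
  have \<beta>0: "\<beta> x = 0" if "x \<notin> {- R..R}" for x using R(2)[of x] that by (cases "\<beta> x = 0") (auto simp: abs_less_iff)
  obtain B where "\<forall>x\<in>{- R..R}. \<bar>\<beta> x\<bar> \<le> B"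
    using compact_imp_bounded[OF compact_continuous_image[OF continuous_on_subset[OF cont subset_UNIV] compact_Icc, of "- R" R]]
 
    unfolding bounded_iff by auto
  then have B: "\<And>x. x \<in> {- R..R} \<Longrightarrow> \<bar>\<beta> x\<bar> \<le> B" by blast
  have B0: "B \<ge> 0" using B[of 0] R(1) by simp
  have \<beta>B: "\<bar>\<beta> x\<bar> \<le> B" for x using B[of x] \<beta>0[of x] B0 by (cases "x \<in> {- R..R}") auto
  have \<beta>int: "integrable lborel (\<lambda>x. \<bar>\<beta> x\<bar> * (C\<^sup>2 / 2))"
  proof -
    have "set_integrable lborel {- R..R} (\<lambda>x. \<bar>\<beta> x\<bar>)"
      by (intro borel_integrable_atLeastAtMost' continuous_intros continuous_on_subset[OF cont]) auto
    moreover have "(\<lambda>x. indicat_real {- R..R} x *\<^sub>R \<bar>\<beta> x\<bar>) = (\<lambda>x. \<bar>\<beta> x\<bar>)"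
    proof (rule ext)
      show "indicat_real {- R..R} x *\<^sub>R \<bar>\<beta> x\<bar> = \<bar>\<beta> x\<bar>" for x
        using \<beta>0[of x] by (cases "x \<in> {- R..R}") auto
    qed
    ultimately show ?thesis unfolding set_integrable_def by (simp only: integrable_mult_left)
  qed
  define K where "K = (LBINT x. \<bar>\<beta> x\<bar> * (C\<^sup>2 / 2))"
  have dom: "\<bar>\<beta> x * (y\<^sup>2 / 2)\<bar> \<le> \<bar>\<beta> x\<bar> * (C\<^sup>2 / 2)" if "\<bar>y\<bar> \<le> C" for x y
  proof -
    have "y\<^sup>2 \<le> C\<^sup>2" using that C_nonneg by (simp flip: abs_le_square_iff)
    then show ?thesis unfolding abs_mult by (intro mult_left_mono) auto
  qed
  define Gk where "Gk k t = (LBINT x. \<beta> x * ((d k (clampT t) x)\<^sup>2 / 2))" for k t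
  define G where "G t = (LBINT x. \<beta> x * ((g (clampT t) x)\<^sup>2 / 2))" for t
  have [measurable]: "Gk k \<in> borel_measurable borel" "G \<in> borel_measurable borel" for k
    unfolding Gk_def G_def by (rule energy_meas[OF d_meas], simp, rule energy_meas[OF g_meas2], simp)
  have [measurable]: "d k (clampT t) \<in> borel_measurable borel" "g (clampT t) \<in> borel_measurable borel" for k t
    using d_cont[OF clampT(1), of UNIV] g_meas[OF clampT(1)] by (auto intro: borel_measurable_continuous_onI)
  have Gk_bound: "\<bar>Gk k t\<bar> \<le> K" for k t
    unfolding Gk_def K_def by (rule integral_abs_bound_integral) (use dom[OF d_bound[OF clampT(1)]] \<beta>int in \<open>auto intro: Bochner_Integration.integrable_bound[OF \<beta>int]\<close>)
  have G_bound: "\<bar>G t\<bar> \<le> K" for t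
    unfolding G_def K_def by (rule integral_abs_bound_integral) (use dom[OF g_bound[OF clampT(1)]] \<beta>int in \<open>auto intro: Bochner_Integration.integrable_bound[OF \<beta>int]\<close>)
  have G_lim: "(\<lambda>k. Gk k t) \<longlonglongrightarrow> G t" for t
    unfolding Gk_def G_def
  proof (rule integral_dominated_convergence[OF _ _ \<beta>int])
    show "AE x in lborel. (\<lambda>k. \<beta> x * ((d k (clampT t) x)\<^sup>2 / 2)) \<longlonglongrightarrow> \<beta> x * ((g (clampT t) x)\<^sup>2 / 2)"
      by (intro AE_I2 tendsto_intros d_tendsto clampT(1)) simp
    show "AE x in lborel. norm (\<beta> x * ((d k (clampT t) x)\<^sup>2 / 2)) \<le> \<bar>\<beta> x\<bar> * (C\<^sup>2 / 2)" for k
      using dom[OF d_bound[OF clampT(1)]] by auto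
  qed measurable
  \<comment> \<open>\<open>\<nu> t\<close> is constrained only for times from 0 on; cutting off
    there gives a measurable function on the whole line.\<close>
  define N where "N t = indicator {0..} t * (\<integral>x. \<beta> x \<partial>(\<nu> t))" for t :: real
  have [measurable]: "N \<in> borel_measurable borel"
  proof -
    have "(\<lambda>t. \<integral>x. \<beta> x \<partial>(\<nu> t)) \<in> borel_measurable (restrict_space borel {0..})"
      using \<nu> cont supp by (simp add: Linf_measure_def)
    then show ?thesis unfolding N_def by (subst (asm) borel_measurable_restrict_space_iff) auto
  qed
  obtain Cv where Cv: "AE t in lborel. t \<ge> 0 \<longrightarrow> emeasure (\<nu> t) UNIV \<le> ennreal Cv"
    using \<nu> by (auto simp: Linf_measure_def)
  have N_bound: "AE t in lborel. \<bar>N t\<bar> \<le> B * max 0 Cv"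
    using Cv
  proof eventually_elim
    case (elim t)
    show ?case
    proof (cases "t \<ge> 0")
      case True
      have sets: "sets (\<nu> t) = sets borel" using \<nu> True by (simp add: Linf_measure_def)
      have sp: "space (\<nu> t) = UNIV" using sets_eq_imp_space_eq[OF sets] by simp
      have em: "emeasure (\<nu> t) UNIV \<le> ennreal Cv" using elim True by simp
      interpret finite_measure "\<nu> t"
        by (rule finite_measureI) (use em in \<open>auto simp: sp top_unique\<close>)
      have m: "measure (\<nu> t) UNIV \<le> max 0 Cv"
        using em by (auto simp: emeasure_eq_measure ennreal_le_iff2)
      have "\<bar>\<integral>x. \<beta> x \<partial>(\<nu> t)\<bar> \<le> (\<integral>x. B \<partial>(\<nu> t))"
      proof (rule integral_abs_bound_integral)
        have \<beta>m: "\<beta> \<in> borel_measurable (\<nu> t)" by (simp cong: measurable_cong_sets add: sets)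
        show "integrable (\<nu> t) \<beta>" by (rule integrable_const_bound[of _ B]) (use \<beta>B \<beta>m in auto)
      qed (use \<beta>B in auto)
      also have "\<dots> \<le> B * max 0 Cv" using m B0 by (simp add: sp mult.commute mult_left_mono)
      finally show ?thesis using True by (simp add: N_def)
    qed (use B0 in \<open>simp add: N_def\<close>)
  qed
  \<comment> \<open>The weight in time has to vanish outside \<open>{0..T}\<close>, where nothing is
    known about the derivatives; \<open>a \<ge> 0\<close> ensures this. Clamping and the cut-off of
    \<open>N\<close> are then invisible under the integrals.\<close>
  have test: "(LBINT t. trapezoid a T n t * G t) = (LBINT t. trapezoid a T n t * N t)" if a: "a \<ge> 0" for a n
  proof -
    let ?\<alpha> = "trapezoid a T n"
    have \<alpha>0: "?\<alpha> t = 0" if "t \<notin> {0..T}" for t using trapezoid_outside[of t a T n] that a by auto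
    define \<phi> where "\<phi> z = ?\<alpha> (fst z) * \<beta> (snd z)" for z
    have "continuous_on UNIV \<phi>"
      unfolding \<phi>_def
      by (intro continuous_intros continuous_on_compose2[OF trapezoid_continuous[of UNIV]] continuous_on_compose2[OF cont] subset_UNIV)
    moreover have "compactly_supported \<phi>"
      unfolding \<phi>_def by (rule compactly_supported_product[OF trapezoid_compactly_supported supp])
    ultimately have W: "(\<lambda>k. LBINT t:{0..}. (LBINT x. \<phi> (t, x) * ((deriv (w k t) x)\<^sup>2 / 2)))
      \<longlonglongrightarrow> (LBINT t:{0..}. (\<integral>x. \<phi> (t, x) \<partial>(\<nu> t)))"
      using weak by (simp add: converges_weakly_measure_def)
    have L: "(LBINT t:{0..}. (LBINT x. \<phi> (t, x) * ((deriv (w k t) x)\<^sup>2 / 2))) = (LBINT t. ?\<alpha> t * Gk k t)" for k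
      unfolding set_lebesgue_integral_def
    proof (rule Bochner_Integration.integral_cong[OF refl])
      fix t
      show "indicat_real {0..} t *\<^sub>R (LBINT x. \<phi> (t, x) * ((deriv (w k t) x)\<^sup>2 / 2)) = ?\<alpha> t * Gk k t"
      proof (cases "t \<in> {0..T}")
        case True
        have "deriv (w k t) x = d k t x" for x using w_derivative[OF True] by (rule DERIV_imp_deriv)
        then show ?thesis using True by (simp add: \<phi>_def Gk_def clampT(2) mult.assoc)
      qed (simp add: \<phi>_def \<alpha>0)
    qed
    have Rt: "(LBINT t:{0..}. (\<integral>x. \<phi> (t, x) \<partial>(\<nu> t))) = (LBINT t. ?\<alpha> t * N t)"
      unfolding set_lebesgue_integral_def by (intro Bochner_Integration.integral_cong refl) (simp add: \<phi>_def N_def)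
    have "(\<lambda>k. LBINT t. ?\<alpha> t * Gk k t) \<longlonglongrightarrow> (LBINT t. ?\<alpha> t * G t)"
    proof (rule integral_dominated_convergence[where w = "\<lambda>t. indicator {0..T} t * K"])
      show "integrable lborel (\<lambda>t. indicator {0..T} t * K)" by (rule integrable_indicator_mult)
      show "AE t in lborel. (\<lambda>k. ?\<alpha> t * Gk k t) \<longlonglongrightarrow> ?\<alpha> t * G t"
        by (intro AE_I2 tendsto_intros G_lim)
      show "AE t in lborel. norm (?\<alpha> t * Gk k t) \<le> indicator {0..T} t * K" for k
      proof (rule AE_I2)
        fix t
        have "\<bar>?\<alpha> t\<bar> * \<bar>Gk k t\<bar> \<le> 1 * K"
          using Gk_bound trapezoid_bounds[of a T n t] by (intro mult_mono) auto
        then show "norm (?\<alpha> t * Gk k t) \<le> indicator {0..T} t * K"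
          using \<alpha>0[of t] by (cases "t \<in> {0..T}") (auto simp: abs_mult)
      qed
    qed measurable
    then show ?thesis using LIMSEQ_unique[OF W[unfolded L Rt]] by simp
  qed
  \<comment> \<open>It is enough that f integrates to 0 over every half line, and this is the limit
    of \<open>test\<close> for steep ramps.\<close>
  define f where "f t = indicator {0..T} t * (N t - G t)" for t
  have K0: "K \<ge> 0" using G_bound[of 0] by linarith
  have f_bound: "AE t in lborel. \<bar>N t - G t\<bar> \<le> B * max 0 Cv + K"
    using N_bound
  proof eventually_elim
    case (elim t)
    then show ?case using G_bound[of t] abs_triangle_ineq4[of "N t" "G t"] by linarith
  qed
  have fint: "integrable lborel f"
  proof (rule Bochner_Integration.integrable_bound)
    show "integrable lborel (\<lambda>t. indicator {0..T} t * (B * max 0 Cv + K))" by (rule integrable_indicator_mult)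
    show "AE t in lborel. norm (f t) \<le> norm (indicator {0..T} t * (B * max 0 Cv + K))"
      using f_bound by eventually_elim (use B0 K0 in \<open>auto simp: f_def indicator_def\<close>)
    show "f \<in> borel_measurable lborel" unfolding f_def by measurable
  qed
  have zero: "(LBINT t:{x<..}. f t) = 0" for x
  proof (cases "x < T")
    case False
    then have "indicat_real {x<..} t *\<^sub>R f t = 0" for t by (auto simp: f_def indicator_def)
    then show ?thesis unfolding set_lebesgue_integral_def by (simp only: Bochner_Integration.integral_zero)
  next
    case True
    \<comment> \<open>As f vanishes before time 0, the half line may be cut at
      \<open>max 0 x\<close>, where \<open>test\<close> is available.\<close>
    define a where "a = max 0 x"
    have aT: "a \<ge> 0" "a < T" using True T by (auto simp: a_def)
    have "(\<lambda>n. LBINT t. trapezoid a T n t * f t) \<longlonglongrightarrow> (LBINT t. indicator {a<..<T} t * f t)"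
    proof (rule integral_dominated_convergence[OF _ _ integrable_abs[OF fint]])
      show "AE t in lborel. (\<lambda>n. trapezoid a T n t * f t) \<longlonglongrightarrow> indicator {a<..<T} t * f t"
        by (intro AE_I2 tendsto_intros trapezoid_tendsto) auto
      show "AE t in lborel. norm (trapezoid a T n t * f t) \<le> \<bar>f t\<bar>" for n
        using trapezoid_bounds by (auto simp: abs_mult intro!: mult_left_le_one_le)
    qed (use fint in auto)
    moreover have "(LBINT t. trapezoid a T n t * f t) = 0" for n
    proof -
      have eq: "trapezoid a T n t * f t = trapezoid a T n t * N t - trapezoid a T n t * G t" for t
        using trapezoid_outside[of t a T n] aT by (cases "t \<in> {0..T}") (auto simp: f_def algebra_simps)
      have i: "integrable lborel (\<lambda>t. trapezoid a T n t * H t)" if H: "AE t in lborel. \<bar>H t\<bar> \<le> c" and [measurable]: "H \<in> borel_measurable borel" for H c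
      proof (rule Bochner_Integration.integrable_bound)
        show "integrable lborel (\<lambda>t. indicator {0..T} t * c)" by (rule integrable_indicator_mult)
        show "AE t in lborel. norm (trapezoid a T n t * H t) \<le> norm (indicator {0..T} t * c)"
          using H
        proof eventually_elim
          case (elim t)
          have "\<bar>trapezoid a T n t\<bar> * \<bar>H t\<bar> \<le> 1 * \<bar>c\<bar>"
            using elim trapezoid_bounds[of a T n t] by (intro mult_mono) auto
          then show ?case using trapezoid_outside[of t a T n] aT by (cases "t \<in> {0..T}") (auto simp: abs_mult)
        qed
      qed measurable
      have iN: "integrable lborel (\<lambda>t. trapezoid a T n t * N t)" by (rule i[OF N_bound]) simp
      have iG: "integrable lborel (\<lambda>t. trapezoid a T n t * G t)" by (rule i[of _ K]) (use G_bound in auto)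
      show ?thesis unfolding eq using iN iG test[OF aT(1), of n] by simp
    qed
    ultimately have "(LBINT t. indicator {a<..<T} t * f t) = 0"
      using LIMSEQ_unique[OF _ tendsto_const] by simp
    moreover have "(LBINT t:{x<..}. f t) = (LBINT t. indicator {a<..<T} t * f t)"
      unfolding set_lebesgue_integral_def
    proof (rule integral_cong_AE)
      have "AE t in lborel. t \<noteq> a" "AE t in lborel. t \<noteq> T" by (rule AE_lborel_singleton)+
      then show "AE t in lborel. indicat_real {x<..} t *\<^sub>R f t = indicator {a<..<T} t * f t"
        by eventually_elim (auto simp: f_def indicator_def a_def)
    qed (use fint in auto)
    ultimately show ?thesis by simp
  qed
  have "AE t in lborel. f t = 0" by (rule AE_eq_0_if_integrals_eq_0[OF fint zero])
  then show ?thesis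
    by eventually_elim (auto simp: f_def N_def G_def clampT(2))
qed

lemma rational_approximation:
  fixes a b :: real
  shows "\<exists>r s. (\<forall>n. r n \<in> \<rat> \<and> s n \<in> \<rat> \<and> a \<le> r n \<and> s n \<le> b) \<and> r \<longlonglongrightarrow> a \<and> s \<longlonglongrightarrow> b"
proof -
  have e: "0 < inverse (real (Suc n))" for n by simp
  have "\<exists>x\<in>\<rat>. a < x \<and> x < a + inverse (real (Suc n))" for n
    using Rats_dense_in_real[of a "a + inverse (real (Suc n))"] e[of n] by linarith
  then obtain r where r: "\<And>n. r n \<in> \<rat>" "\<And>n. a < r n" "\<And>n. r n < a + inverse (real (Suc n))" by metis
  have "\<exists>x\<in>\<rat>. b - inverse (real (Suc n)) < x \<and> x < b" for n
    using Rats_dense_in_real[of "b - inverse (real (Suc n))" b] e[of n] by linarith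
  then obtain s where s: "\<And>n. s n \<in> \<rat>" "\<And>n. b - inverse (real (Suc n)) < s n" "\<And>n. s n < b" by metis
  have "(\<lambda>n. a + inverse (real (Suc n))) \<longlonglongrightarrow> a + 0" "(\<lambda>n. b - inverse (real (Suc n))) \<longlonglongrightarrow> b - 0"
    by (intro tendsto_intros LIMSEQ_inverse_real_of_nat)+
  then have lim: "(\<lambda>n. a + inverse (real (Suc n))) \<longlonglongrightarrow> a" "(\<lambda>n. b - inverse (real (Suc n))) \<longlonglongrightarrow> b" by simp_all
  have "r \<longlonglongrightarrow> a"
    by (rule tendsto_sandwich[OF _ _ tendsto_const lim(1)]) (use r in \<open>auto intro!: always_eventually less_imp_le\<close>)
  moreover have "s \<longlonglongrightarrow> b"
    by (rule tendsto_sandwich[OF _ _ lim(2) tendsto_const]) (use s in \<open>auto intro!: always_eventually less_imp_le\<close>)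
  ultimately show ?thesis
    by (intro exI[of _ r] exI[of _ s]) (simp add: r(1) s(1) less_imp_le[OF r(2)] less_imp_le[OF s(3)])
qed

text \<open>Only countably many test functions can share one null set of times: trapezoids with
  rational endpoints and integer slopes. By dominated convergence they determine both measures on
  every open interval, and hence altogether.\<close>

theorem AE_measure_eq:
  "AE t in lborel. t \<in> {0..T} \<longrightarrow> \<nu> t = density lborel (\<lambda>x. ennreal ((g t x)\<^sup>2 / 2))"
proof -
  obtain C' where C': "AE t in lborel. t \<ge> 0 \<longrightarrow> emeasure (\<nu> t) UNIV \<le> ennreal C'"
    using \<nu> by (auto simp: Linf_measure_def)
  have "AE t in lborel. \<forall>r\<in>\<rat>. \<forall>s\<in>\<rat>. \<forall>n. t \<in> {0..T} \<longrightarrow>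
      (\<integral>x. trapezoid r s n x \<partial>(\<nu> t)) = (LBINT x. trapezoid r s n x * ((g t x)\<^sup>2 / 2))"
    unfolding AE_ball_countable[OF countable_rat] AE_all_countable
    by (intro ballI allI AE_energy_eq trapezoid_continuous trapezoid_compactly_supported)
  then show ?thesis using C'
  proof (eventually_elim, intro impI)
    case (elim t)
    assume t: "t \<in> {0..T}"
    have sets: "sets (\<nu> t) = sets borel" using \<nu> t by (simp add: Linf_measure_def)
    have sp: "space (\<nu> t) = UNIV" using sets_eq_imp_space_eq[OF sets] by simp
    interpret finite_measure "\<nu> t"
      by (rule finite_measureI) (use elim(2) t in \<open>auto simp: sp top_unique\<close>)
    have meas: "f \<in> borel_measurable (\<nu> t)" if "f \<in> borel_measurable borel" for f :: "real \<Rightarrow> real"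
      using that by (simp cong: measurable_cong_sets add: sets)
    have [measurable]: "g t \<in> borel_measurable borel" by (rule g_meas[OF t])
    show "\<nu> t = density lborel (\<lambda>x. ennreal ((g t x)\<^sup>2 / 2))"
    proof (rule borel_measure_eqI_intervals)
      fix a b :: real
      obtain r s where "\<forall>n. r n \<in> \<rat> \<and> s n \<in> \<rat> \<and> a \<le> r n \<and> s n \<le> b" and lim: "r \<longlonglongrightarrow> a" "s \<longlonglongrightarrow> b"
        using rational_approximation[of a b] by blast
      then have rs: "r n \<in> \<rat>" "s n \<in> \<rat>" "a \<le> r n" "s n \<le> b" for n by auto
      define \<beta> where "\<beta> n = trapezoid (r n) (s n) n" for n
      have \<beta>lim: "(\<lambda>n. \<beta> n x) \<longlonglongrightarrow> indicator {a<..<b} x" for x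
        unfolding \<beta>_def by (rule trapezoid_tendsto[OF rs(3) lim(1) rs(4) lim(2)])
      have \<beta>le: "0 \<le> \<beta> n x" "\<beta> n x \<le> indicator {a<..<b} x" for n x
      proof -
        show "0 \<le> \<beta> n x" by (simp add: \<beta>_def trapezoid_bounds)
        have "x \<notin> {a<..<b} \<Longrightarrow> x \<notin> {r n<..<s n}" using rs(3)[of n] rs(4)[of n] by auto
        then show "\<beta> n x \<le> indicator {a<..<b} x"
          using trapezoid_bounds(2)[of "r n" "s n" n x] trapezoid_outside[of x "r n" "s n" n]
          by (cases "x \<in> {a<..<b}") (auto simp: \<beta>_def)
      qed
      have [measurable]: "\<beta> n \<in> borel_measurable borel" for n by (simp add: \<beta>_def)
      have "(\<lambda>n. \<integral>x. \<beta> n x \<partial>(\<nu> t)) \<longlonglongrightarrow> (\<integral>x. indicator {a<..<b} x \<partial>(\<nu> t))"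
      proof (rule integral_dominated_convergence[where w = "\<lambda>_. 1"])
        show "AE x in \<nu> t. norm (\<beta> n x) \<le> 1" for n
          using trapezoid_bounds by (auto simp: \<beta>_def)
      qed (use \<beta>lim in \<open>auto intro!: meas\<close>)
      then have l1: "(\<lambda>n. \<integral>x. \<beta> n x \<partial>(\<nu> t)) \<longlonglongrightarrow> measure (\<nu> t) {a<..<b}" by (simp add: sp)
      have dom: "integrable lborel (\<lambda>x. indicat_real {a<..<b} x * (C\<^sup>2 / 2))"
        by (rule integrable_indicator_mult)
      have sq: "(g t x)\<^sup>2 / 2 \<le> C\<^sup>2 / 2" for x
        using g_bound[OF t, of x] C_nonneg by (simp flip: abs_le_square_iff)
      have "(\<lambda>n. LBINT x. \<beta> n x * ((g t x)\<^sup>2 / 2)) \<longlonglongrightarrow> (LBINT x. indicator {a<..<b} x * ((g t x)\<^sup>2 / 2))"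
      proof (rule integral_dominated_convergence[OF _ _ dom])
        show "AE x in lborel. (\<lambda>n. \<beta> n x * ((g t x)\<^sup>2 / 2)) \<longlonglongrightarrow> indicator {a<..<b} x * ((g t x)\<^sup>2 / 2)"
          by (intro AE_I2 tendsto_intros \<beta>lim)
        show "AE x in lborel. norm (\<beta> n x * ((g t x)\<^sup>2 / 2)) \<le> indicat_real {a<..<b} x * (C\<^sup>2 / 2)" for n
        proof (rule AE_I2)
          fix x
          have "\<beta> n x * ((g t x)\<^sup>2 / 2) \<le> indicat_real {a<..<b} x * (C\<^sup>2 / 2)"
            using \<beta>le[of n x] sq by (intro mult_mono) auto
          then show "norm (\<beta> n x * ((g t x)\<^sup>2 / 2)) \<le> indicat_real {a<..<b} x * (C\<^sup>2 / 2)"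
            using \<beta>le(1)[of n x] by simp
        qed
      qed measurable
      moreover have "(\<integral>x. \<beta> n x \<partial>(\<nu> t)) = (LBINT x. \<beta> n x * ((g t x)\<^sup>2 / 2))" for n
        unfolding \<beta>_def using elim(1) rs(1,2) t by blast
      ultimately have "(\<lambda>n. \<integral>x. \<beta> n x \<partial>(\<nu> t)) \<longlonglongrightarrow> (LBINT x. indicator {a<..<b} x * ((g t x)\<^sup>2 / 2))"
        by (simp only:)
      with l1 have eq: "measure (\<nu> t) {a<..<b} = (LBINT x. indicator {a<..<b} x * ((g t x)\<^sup>2 / 2))"
        by (rule LIMSEQ_unique)
      have int: "integrable lborel (\<lambda>x. indicat_real {a<..<b} x * ((g t x)\<^sup>2 / 2))"
        by (rule Bochner_Integration.integrable_bound[OF dom]) (use sq in \<open>auto simp: indicator_def\<close>)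
      have "emeasure (density lborel (\<lambda>x. ennreal ((g t x)\<^sup>2 / 2))) {a<..<b}
        = (\<integral>\<^sup>+x. ennreal ((g t x)\<^sup>2 / 2) * indicator {a<..<b} x \<partial>lborel)"
        by (rule emeasure_density) auto
      also have "\<dots> = (\<integral>\<^sup>+x. ennreal (indicat_real {a<..<b} x * ((g t x)\<^sup>2 / 2)) \<partial>lborel)"
        by (intro nn_integral_cong) (auto simp: indicator_def)
      also have "\<dots> = ennreal (LBINT x. indicat_real {a<..<b} x * ((g t x)\<^sup>2 / 2))"
        by (rule nn_integral_eq_integral[OF int]) auto
      finally show "emeasure (\<nu> t) {a<..<b} = emeasure (density lborel (\<lambda>x. ennreal ((g t x)\<^sup>2 / 2))) {a<..<b}"
        by (simp add: emeasure_eq_measure eq)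
      show "emeasure (\<nu> t) {a<..<b} < \<infinity>" by (simp add: emeasure_eq_measure)
    qed (auto simp: sets)
  qed
qed

end

section \<open>Fourier inversion and Sobolev regularity\<close>

text \<open>Test functions for the Fourier inversion formula, in a form that is closed under differentiation.\<close>

definition gauss_trig :: "real \<Rightarrow> real \<Rightarrow> real poly \<Rightarrow> real poly \<Rightarrow> real \<Rightarrow> real" where
  "gauss_trig c a p r = (\<lambda>x. (poly p x * cos (a * x) + poly r x * sin (a * x)) * exp (- (c * x\<^sup>2)))"

lemma gauss_trig_has_derivative:
  "(gauss_trig c a p r has_field_derivative
     gauss_trig c a (pderiv p + smult a r - [:0, 2 * c:] * p) (pderiv r - smult a p - [:0, 2 * c:] * r) x) (at x)"
  unfolding gauss_trig_def
  by (auto intro!: derivative_eq_intros poly_DERIV simp: algebra_simps power2_eq_square)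

lemma iterated_deriv_gauss_trig:
  "\<exists>p' r'. (deriv ^^ n) (gauss_trig c a p r) = gauss_trig c a p' r'"
proof (induction n)
  case 0
  show ?case by (intro exI) simp
next
  case (Suc n)
  then obtain p' r' where pr: "(deriv ^^ n) (gauss_trig c a p r) = gauss_trig c a p' r'" by blast
  have "(deriv ^^ Suc n) (gauss_trig c a p r) = deriv (gauss_trig c a p' r')"
    using pr by simp
  also have "\<dots> = gauss_trig c a (pderiv p' + smult a r' - [:0, 2 * c:] * p') (pderiv r' - smult a p' - [:0, 2 * c:] * r')"
    by (rule ext) (rule DERIV_imp_deriv[OF gauss_trig_has_derivative])
  finally show ?case by blast
qed

text \<open>With y = c * x^2 and n = m + 1, (y / n)^n <= (1 + y / n)^n <= exp y. This controls x^(2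
  * n) * exp (- y), and |x|^m is at most 1 + x^(2 * n).\<close>

lemma power_mult_gauss_bounded:
  fixes c :: real
  assumes "c > 0"
  shows "\<exists>C. \<forall>x. \<bar>x\<bar> ^ m * exp (- (c * x\<^sup>2)) \<le> C"
proof (intro exI allI)
  fix x :: real
  show "\<bar>x\<bar> ^ m * exp (- (c * x\<^sup>2)) \<le> 1 + (real (Suc m) / c) ^ (Suc m)"
  proof -
    define y where "y = c * x\<^sup>2"
    have y0: "y \<ge> 0" using assms by (simp add: y_def)
    have "(y / real (Suc m)) ^ Suc m \<le> (1 + y / real (Suc m)) ^ Suc m"
      using y0 by (intro power_mono) auto
    also have "\<dots> \<le> exp y"
      using y0 by (intro exp_ge_one_plus_x_over_n_power_n) auto
    finally have "(y / real (Suc m)) ^ Suc m * exp (- y) \<le> exp y * exp (- y)"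
      by (rule mult_right_mono) simp
    then have 1: "(y / real (Suc m)) ^ Suc m * exp (- y) \<le> 1"
      by (simp flip: exp_add)
    have 2: "\<bar>x\<bar> ^ m \<le> 1 + (x\<^sup>2) ^ Suc m"
    proof (cases "\<bar>x\<bar> \<le> 1")
      case True
      then have "\<bar>x\<bar> ^ m \<le> 1" by (simp add: power_le_one)
      then show ?thesis using zero_le_power[OF zero_le_power2, of x "Suc m"] by linarith
    next
      case False
      have "(x\<^sup>2) ^ Suc m = \<bar>x\<bar> ^ (2 * Suc m)"
        by (metis power2_abs power_mult)
      moreover have "\<bar>x\<bar> ^ m \<le> \<bar>x\<bar> ^ (2 * Suc m)"
        using False by (intro power_increasing) auto
      ultimately show ?thesis by simp
    qed
    have 3: "(x\<^sup>2) ^ Suc m = (real (Suc m) / c) ^ Suc m * (y / real (Suc m)) ^ Suc m"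
      using assms by (simp add: y_def flip: power_mult_distrib)
    have "\<bar>x\<bar> ^ m * exp (- y) \<le> (1 + (x\<^sup>2) ^ Suc m) * exp (- y)"
      using 2 by (intro mult_right_mono) auto
    also have "\<dots> = exp (- y) + (real (Suc m) / c) ^ Suc m * ((y / real (Suc m)) ^ Suc m * exp (- y))"
      unfolding 3 by (simp add: algebra_simps)
    also have "\<dots> \<le> 1 + (real (Suc m) / c) ^ Suc m * 1"
      using 1 y0 assms by (intro add_mono mult_left_mono) auto
    finally show ?thesis by (simp add: y_def)
  qed
qed

lemma poly_mult_gauss_bounded:
  fixes c :: real
  assumes "c > 0"
  shows "\<exists>C. \<forall>x. \<bar>x\<bar> ^ m * \<bar>poly p x\<bar> * exp (- (c * x\<^sup>2)) \<le> C"
proof (induction p arbitrary: m)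
  case 0
  show ?case by (intro exI[of _ 0]) simp
next
  case (pCons a p)
  obtain C where C: "\<bar>x\<bar> ^ m * exp (- (c * x\<^sup>2)) \<le> C" for x
    using power_mult_gauss_bounded[OF assms] by blast
  obtain C' where C': "\<bar>x\<bar> ^ Suc m * \<bar>poly p x\<bar> * exp (- (c * x\<^sup>2)) \<le> C'" for x
    using pCons.IH by blast
  show ?case
  proof (intro exI allI)
    fix x
    have "\<bar>x\<bar> ^ m * \<bar>poly (pCons a p) x\<bar> * exp (- (c * x\<^sup>2))
        \<le> \<bar>x\<bar> ^ m * (\<bar>a\<bar> + \<bar>x\<bar> * \<bar>poly p x\<bar>) * exp (- (c * x\<^sup>2))"
      by (intro mult_right_mono mult_left_mono) (auto simp: abs_mult[symmetric] intro: order.trans[OF abs_triangle_ineq])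
    also have "\<dots> = \<bar>a\<bar> * (\<bar>x\<bar> ^ m * exp (- (c * x\<^sup>2))) + \<bar>x\<bar> ^ Suc m * \<bar>poly p x\<bar> * exp (- (c * x\<^sup>2))"
      by (simp add: algebra_simps)
    also have "\<dots> \<le> \<bar>a\<bar> * C + C'"
      using C C' by (intro add_mono mult_left_mono) auto
    finally show "\<bar>x\<bar> ^ m * \<bar>poly (pCons a p) x\<bar> * exp (- (c * x\<^sup>2)) \<le> \<bar>a\<bar> * C + C'" .
  qed
qed

lemma power_mult_gauss_trig_bounded:
  assumes "c > 0"
  shows "\<exists>C. \<forall>x. \<bar>x\<bar> ^ m * \<bar>gauss_trig c a p r x\<bar> \<le> C"
proof -
  obtain C where C: "\<And>x. \<bar>x\<bar> ^ m * \<bar>poly p x\<bar> * exp (- (c * x\<^sup>2)) \<le> C"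
    by (rule exE[OF poly_mult_gauss_bounded[OF assms]]) (rule that, erule spec)
  obtain D where D: "\<And>x. \<bar>x\<bar> ^ m * \<bar>poly r x\<bar> * exp (- (c * x\<^sup>2)) \<le> D"
    by (rule exE[OF poly_mult_gauss_bounded[OF assms]]) (rule that, erule spec)
  have "\<bar>x\<bar> ^ m * \<bar>gauss_trig c a p r x\<bar> \<le> C + D" for x
  proof -
    have "\<bar>poly p x * cos (a * x) + poly r x * sin (a * x)\<bar> \<le> \<bar>poly p x\<bar> * 1 + \<bar>poly r x\<bar> * 1"
      by (rule order.trans[OF abs_triangle_ineq], unfold abs_mult, intro add_mono mult_left_mono) simp_all
    then have "\<bar>x\<bar> ^ m * \<bar>gauss_trig c a p r x\<bar>
        \<le> \<bar>x\<bar> ^ m * ((\<bar>poly p x\<bar> + \<bar>poly r x\<bar>) * exp (- (c * x\<^sup>2)))"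
      unfolding gauss_trig_def abs_mult by (intro mult_left_mono mult_mono) simp_all
    also have "\<dots> \<le> C + D" using C[of x] D[of x] by (simp add: algebra_simps)
    finally show ?thesis .
  qed
  then show ?thesis by (intro exI allI)
qed

lemma schwartz_gauss_trig:
  assumes "c > 0"
  shows "schwartz (gauss_trig c a p r)"
proof -
  have "(deriv ^^ n) (gauss_trig c a p r) field_differentiable at x" for n x
  proof (rule exE[OF iterated_deriv_gauss_trig], erule exE)
    fix p' r'
    assume "(deriv ^^ n) (gauss_trig c a p r) = gauss_trig c a p' r'"
    then show ?thesis
      by (simp only: field_differentiable_def) (rule exI, rule gauss_trig_has_derivative)
  qed
  moreover have "\<exists>C. \<forall>x. \<bar>x\<bar> ^ m * \<bar>(deriv ^^ n) (gauss_trig c a p r) x\<bar> \<le> C" for m n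
  proof (rule exE[OF iterated_deriv_gauss_trig], erule exE)
    fix p' r'
    assume "(deriv ^^ n) (gauss_trig c a p r) = gauss_trig c a p' r'"
    then show ?thesis
      by (simp only:) (rule power_mult_gauss_trig_bounded[OF assms])
  qed
  ultimately show ?thesis by (simp only: schwartz_def smooth_def simp_thms)
qed

text \<open>This is the characteristic function of the standard normal distribution at - y,
  multiplied by sqrt (2 * pi) to remove the normalisation of the density.\<close>

lemma has_bochner_integral_cis_std_gauss:
  "has_bochner_integral lborel (\<lambda>z. cis (- (y * z)) * complex_of_real (exp (- (z\<^sup>2 / 2))))
     (complex_of_real (sqrt (2 * pi) * exp (- (y\<^sup>2 / 2))))"
proof -
  have m: "real_distribution std_normal_distribution" by (rule real_dist_normal_dist)
  interpret real_distribution std_normal_distribution by (rule m)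
  have int: "integrable std_normal_distribution (\<lambda>x. iexp (- y * x))"
    by (intro integrable_iexp) auto
  have "complex_lebesgue_integral std_normal_distribution (\<lambda>x. iexp (- y * x)) = complex_of_real (exp (- (y\<^sup>2 / 2)))"
    using fun_cong[OF char_std_normal_distribution, of "- y"] by (simp add: char_def)
  then have "has_bochner_integral std_normal_distribution (\<lambda>x. iexp (- y * x)) (complex_of_real (exp (- (y\<^sup>2 / 2))))"
    using int by (simp add: has_bochner_integral_iff)
  then have "has_bochner_integral lborel (\<lambda>x. std_normal_density x *\<^sub>R iexp (- y * x)) (complex_of_real (exp (- (y\<^sup>2 / 2))))"
    by (simp add: has_bochner_integral_iff integrable_density integral_density)
  then have "has_bochner_integral lborel (\<lambda>x. complex_of_real (sqrt (2 * pi)) * (std_normal_density x *\<^sub>R iexp (- y * x)))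
     (complex_of_real (sqrt (2 * pi)) * (complex_of_real (exp (- (y\<^sup>2 / 2)))))"
    by (rule has_bochner_integral_mult_right)
  moreover have "complex_of_real (sqrt (2 * pi)) * (std_normal_density x *\<^sub>R iexp (- y * x))
      = cis (- (y * x)) * complex_of_real (exp (- (x\<^sup>2 / 2)))" for x
    by (simp add: std_normal_density_def scaleR_conv_of_real cis_conv_exp)
  ultimately show ?thesis by simp
qed

lemma has_bochner_integral_cis_gauss:
  assumes "\<epsilon> > 0"
  shows "has_bochner_integral lborel (\<lambda>\<omega>. cis (- (y * \<omega>)) * complex_of_real (exp (- (\<epsilon>\<^sup>2 / 2 * \<omega>\<^sup>2))))
     (complex_of_real (2 * pi * normal_density 0 \<epsilon> y))"
proof -
  have "has_bochner_integral lborel (\<lambda>\<omega>. cis (- (y / \<epsilon> * (0 + \<epsilon> * \<omega>))) * complex_of_real (exp (- ((0 + \<epsilon> * \<omega>)\<^sup>2 / 2))))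
     (complex_of_real (sqrt (2 * pi) * exp (- ((y / \<epsilon>)\<^sup>2 / 2))) /\<^sub>R \<bar>\<epsilon>\<bar>)"
    using assms by (intro lborel_has_bochner_integral_real_affine_iff[THEN iffD1] has_bochner_integral_cis_std_gauss) auto
  moreover have "complex_of_real (sqrt (2 * pi) * exp (- ((y / \<epsilon>)\<^sup>2 / 2))) /\<^sub>R \<bar>\<epsilon>\<bar> = complex_of_real (2 * pi * normal_density 0 \<epsilon> y)"
  proof -
    have "sqrt (2 * pi) * exp (- ((y / \<epsilon>)\<^sup>2 / 2)) / \<epsilon> = 2 * pi * normal_density 0 \<epsilon> y"
      using assms by (simp add: normal_density_def real_sqrt_mult field_simps power_divide)
    then show ?thesis using assms
      by (metis abs_of_pos divide_inverse mult.commute of_real_mult scaleR_conv_of_real)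
  qed
  ultimately show ?thesis using assms by (simp add: power_mult_distrib mult.commute)
qed

section \<open>Fourier inversion by Gaussian regularisation\<close>

lemma integral_normal_density_tendsto:
  fixes f :: "real \<Rightarrow> real"
  assumes cont: "continuous_on UNIV f" and bdd: "\<And>x. \<bar>f x\<bar> \<le> B"
    and \<epsilon>: "\<epsilon> \<longlonglongrightarrow> 0" "\<And>n. \<epsilon> n > 0"
  shows "(\<lambda>n. LBINT x. f x * normal_density 0 (\<epsilon> n) (x - a)) \<longlonglongrightarrow> f a"
proof -
  have [measurable]: "f \<in> borel_measurable borel"
    using cont by (rule borel_measurable_continuous_onI)
  have eq: "(LBINT x. f x * normal_density 0 (\<epsilon> n) (x - a)) = (LBINT z. f (a + \<epsilon> n * z) * std_normal_density z)" for n
  proof -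
    have "(LBINT x. f x * normal_density 0 (\<epsilon> n) (x - a))
        = \<bar>\<epsilon> n\<bar> *\<^sub>R (LBINT z. f (a + \<epsilon> n * z) * normal_density 0 (\<epsilon> n) ((a + \<epsilon> n * z) - a))"
      using \<epsilon>(2)[of n] by (intro lborel_integral_real_affine) auto
    also have "\<dots> = (LBINT z. f (a + \<epsilon> n * z) * (\<lambda>z. \<epsilon> n * normal_density 0 (\<epsilon> n) (\<epsilon> n * z)) z)"
      using \<epsilon>(2)[of n] by (simp add: mult_ac flip: integral_mult_right_zero)
    also have "(\<lambda>z. \<epsilon> n * normal_density 0 (\<epsilon> n) (\<epsilon> n * z)) = std_normal_density"
      using \<epsilon>(2)[of n] by (intro ext) (simp add: normal_density_def real_sqrt_mult power_mult_distrib field_simps)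
    finally show ?thesis .
  qed
  have "(\<lambda>n. LBINT z. f (a + \<epsilon> n * z) * std_normal_density z) \<longlonglongrightarrow> (LBINT z. f a * std_normal_density z)"
  proof (rule integral_dominated_convergence[where w = "\<lambda>z. B * std_normal_density z"])
    show "AE z in lborel. (\<lambda>n. f (a + \<epsilon> n * z) * std_normal_density z) \<longlonglongrightarrow> f a * std_normal_density z"
    proof (intro AE_I2 tendsto_mult tendsto_const)
      fix z
      have "(\<lambda>n. a + \<epsilon> n * z) \<longlonglongrightarrow> a + 0 * z"
        by (intro tendsto_intros \<epsilon>)
      then show "(\<lambda>n. f (a + \<epsilon> n * z)) \<longlonglongrightarrow> f a"
        using cont by (auto intro!: continuous_on_tendsto_compose[OF cont, where l = a])
    qed
    show "AE z in lborel. norm (f (a + \<epsilon> n * z) * std_normal_density z) \<le> B * std_normal_density z" for n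
      using bdd by (auto simp: abs_mult intro!: mult_right_mono)
    show "integrable lborel (\<lambda>z. B * std_normal_density z)"
      by (intro integrable_mult_right integrable_normal_density) auto
  qed auto
  then show ?thesis by (simp add: eq integral_normal_density)
qed

text \<open>The transform is given only by testing, and cis (a * \<omega>) is no Schwartz function.
  Multiplied by a wide Gaussian it becomes one, whose transform is 2 * pi times a normal density
  concentrated near a. Letting the width of that density tend to 0 gives g's integral on one side
  and the value of f at a on the other.\<close>

theorem fourier_inversion:
  assumes ft: "fourier_transform_of f g" and int: "integrable lborel g"
    and cont: "continuous_on UNIV f" and bdd: "\<And>x. \<bar>f x\<bar> \<le> B"
  shows "(LBINT \<omega>. g \<omega> * cis (a * \<omega>)) = complex_of_real (2 * pi * f a)"
proof -
  have [measurable]: "f \<in> borel_measurable borel"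
    using cont by (rule borel_measurable_continuous_onI)
  have [measurable]: "g \<in> borel_measurable borel"
    using ft by (simp add: fourier_transform_of_def)
  define \<epsilon> where "\<epsilon> n = 1 / real (Suc n)" for n
  have \<epsilon>0: "\<epsilon> n > 0" for n by (simp add: \<epsilon>_def)
  have \<epsilon>lim: "\<epsilon> \<longlonglongrightarrow> 0" unfolding \<epsilon>_def using LIMSEQ_inverse_real_of_nat by (simp add: inverse_eq_divide)
  define N where "N n y = complex_of_real (2 * pi * normal_density 0 (\<epsilon> n) y)" for n y
  define G where "G n \<omega> = complex_of_real (exp (- ((\<epsilon> n)\<^sup>2 / 2 * \<omega>\<^sup>2)))" for n \<omega>
  have [measurable]: "G n \<in> borel_measurable borel" for n
    unfolding G_def by measurable
  have G1: "norm (G n \<omega>) \<le> 1" for n \<omega> by (simp add: G_def)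
  have N: "has_bochner_integral lborel (\<lambda>\<omega>. cis (- (y * \<omega>)) * G n \<omega>) (N n y)" for n y
    unfolding N_def G_def by (rule has_bochner_integral_cis_gauss[OF \<epsilon>0])
  have intN: "integrable lborel (\<lambda>x. complex_of_real (f x) * N n (x - y))" for n y
  proof (rule Bochner_Integration.integrable_bound)
    have "integrable lborel (\<lambda>x. B * (2 * pi * normal_density 0 (\<epsilon> n) (- y + 1 * x)))"
      by (intro integrable_mult_right lborel_integrable_real_affine integrable_normal_density \<epsilon>0) auto
    then show "integrable lborel (\<lambda>x. B * (2 * pi * normal_density 0 (\<epsilon> n) (x - y)))" by simp
    show "AE x in lborel. norm (complex_of_real (f x) * N n (x - y)) \<le> norm (B * (2 * pi * normal_density 0 (\<epsilon> n) (x - y)))"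
    proof (rule AE_I2)
      fix x
      have "\<bar>f x\<bar> \<le> \<bar>B\<bar>" using bdd[of x] by linarith
      then show "norm (complex_of_real (f x) * N n (x - y)) \<le> norm (B * (2 * pi * normal_density 0 (\<epsilon> n) (x - y)))"
        by (auto simp: N_def norm_mult abs_mult intro!: mult_right_mono)
    qed
  qed (auto simp: N_def)
  have intg: "integrable lborel (\<lambda>\<omega>. g \<omega> * h \<omega>)" if [measurable]: "h \<in> borel_measurable borel" and "\<And>\<omega>. norm (h \<omega>) \<le> 1" for h
    by (rule Bochner_Integration.integrable_bound[OF int]) (use that(2) in \<open>auto simp: norm_mult intro!: mult_left_le\<close>)
  have key: "(LBINT \<omega>. g \<omega> * (cis (a * \<omega>) * G n \<omega>)) = complex_of_real (2 * pi) * complex_of_real (LBINT x. f x * normal_density 0 (\<epsilon> n) (x - a))" for n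
  proof -
    \<comment> \<open>Test functions are real, so the cosine and sine parts are tested separately;
      this identity joins them again to the exponential.\<close>
    have lin: "X = A + \<i> * B" if "A = (X + Y) / 2" "B = (X - Y) / (2 * \<i>)" for X Y A B :: complex
      by (simp add: that field_simps)
    define c where "c = (\<epsilon> n)\<^sup>2 / 2"
    have c0: "c > 0" using \<epsilon>0[of n] by (simp add: c_def)
    have trig: "of_real (cos t) = (cis t + cis (- t)) / 2" "of_real (sin t) = (cis t - cis (- t)) / (2 * \<i>)" for t
      by (auto simp: complex_eq_iff Re_divide Im_divide power2_eq_square)
    have C: "complex_of_real (gauss_trig c a [:1:] 0 \<omega>) = (cis (a * \<omega>) + cis (- (a * \<omega>))) / 2 * G n \<omega>" for \<omega>
      by (simp add: gauss_trig_def c_def G_def trig(1)[symmetric])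
    have S: "complex_of_real (gauss_trig c a 0 [:1:] \<omega>) = (cis (a * \<omega>) - cis (- (a * \<omega>))) / (2 * \<i>) * G n \<omega>" for \<omega>
      unfolding trig(2)[symmetric] by (simp add: gauss_trig_def c_def G_def)
    have FC: "(LBINT \<omega>. cis (- (x * \<omega>)) * complex_of_real (gauss_trig c a [:1:] 0 \<omega>)) = (N n (x - a) + N n (x + a)) / 2" for x
    proof -
      have "has_bochner_integral lborel (\<lambda>\<omega>. (cis (- ((x - a) * \<omega>)) * G n \<omega> + cis (- ((x + a) * \<omega>)) * G n \<omega>) / 2) ((N n (x - a) + N n (x + a)) / 2)"
        by (rule has_bochner_integral_divide has_bochner_integral_add N)+
      moreover have "(cis (- ((x - a) * \<omega>)) * G n \<omega> + cis (- ((x + a) * \<omega>)) * G n \<omega>) / 2 = cis (- (x * \<omega>)) * complex_of_real (gauss_trig c a [:1:] 0 \<omega>)" for \<omega>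
      proof -
        have "cis (- ((x - a) * \<omega>)) = cis (- (x * \<omega>)) * cis (a * \<omega>)" "cis (- ((x + a) * \<omega>)) = cis (- (x * \<omega>)) * cis (- (a * \<omega>))"
          by (auto simp: cis_mult algebra_simps)
        then show ?thesis unfolding C by (simp add: field_simps)
      qed
      ultimately show ?thesis by (simp add: has_bochner_integral_iff)
    qed
    have FS: "(LBINT \<omega>. cis (- (x * \<omega>)) * complex_of_real (gauss_trig c a 0 [:1:] \<omega>)) = (N n (x - a) - N n (x + a)) / (2 * \<i>)" for x
    proof -
      have "has_bochner_integral lborel (\<lambda>\<omega>. (cis (- ((x - a) * \<omega>)) * G n \<omega> - cis (- ((x + a) * \<omega>)) * G n \<omega>) / (2 * \<i>)) ((N n (x - a) - N n (x + a)) / (2 * \<i>))"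
        by (rule has_bochner_integral_divide has_bochner_integral_diff N)+
      moreover have "(cis (- ((x - a) * \<omega>)) * G n \<omega> - cis (- ((x + a) * \<omega>)) * G n \<omega>) / (2 * \<i>) = cis (- (x * \<omega>)) * complex_of_real (gauss_trig c a 0 [:1:] \<omega>)" for \<omega>
      proof -
        have "cis (- ((x - a) * \<omega>)) = cis (- (x * \<omega>)) * cis (a * \<omega>)" "cis (- ((x + a) * \<omega>)) = cis (- (x * \<omega>)) * cis (- (a * \<omega>))"
          by (auto simp: cis_mult algebra_simps)
        then show ?thesis unfolding S by (simp add: field_simps)
      qed
      ultimately show ?thesis by (simp only: has_bochner_integral_iff)
    qed
    have EC: "(LBINT \<omega>. g \<omega> * complex_of_real (gauss_trig c a [:1:] 0 \<omega>)) = (LBINT x. complex_of_real (f x) * ((N n (x - a) + N n (x + a)) / 2))"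
      using ft schwartz_gauss_trig[OF c0] unfolding fourier_transform_of_def FC[symmetric] by blast
    have ES: "(LBINT \<omega>. g \<omega> * complex_of_real (gauss_trig c a 0 [:1:] \<omega>)) = (LBINT x. complex_of_real (f x) * ((N n (x - a) - N n (x + a)) / (2 * \<i>)))"
      using ft schwartz_gauss_trig[OF c0] unfolding fourier_transform_of_def FS[symmetric] by blast
    have i1: "integrable lborel (\<lambda>\<omega>. g \<omega> * (cis (b * \<omega>) * G n \<omega>))" for b
      by (rule intg) (use G1 in \<open>auto simp: norm_mult cis_conv_exp\<close>)
    have i1': "integrable lborel (\<lambda>\<omega>. g \<omega> * (cis (- (a * \<omega>)) * G n \<omega>))"
      using i1[of "- a"] by simp
    have "(LBINT \<omega>. g \<omega> * (cis (a * \<omega>) * G n \<omega>)) =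
      (LBINT \<omega>. g \<omega> * complex_of_real (gauss_trig c a [:1:] 0 \<omega>)) + \<i> * (LBINT \<omega>. g \<omega> * complex_of_real (gauss_trig c a 0 [:1:] \<omega>))"
    proof -
      have "(LBINT \<omega>. g \<omega> * complex_of_real (gauss_trig c a [:1:] 0 \<omega>)) = ((LBINT \<omega>. g \<omega> * (cis (a * \<omega>) * G n \<omega>)) + (LBINT \<omega>. g \<omega> * (cis (- (a * \<omega>)) * G n \<omega>))) / 2"
        unfolding C using i1[of a] i1' by (simp add: algebra_simps add_divide_distrib)
      moreover have "(LBINT \<omega>. g \<omega> * complex_of_real (gauss_trig c a 0 [:1:] \<omega>)) = ((LBINT \<omega>. g \<omega> * (cis (a * \<omega>) * G n \<omega>)) - (LBINT \<omega>. g \<omega> * (cis (- (a * \<omega>)) * G n \<omega>))) / (2 * \<i>)"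
        unfolding S using i1[of a] i1' by (simp add: algebra_simps diff_divide_distrib)
      ultimately show ?thesis by (rule lin)
    qed
    also have "\<dots> = (LBINT x. complex_of_real (f x) * N n (x - a))"
    proof -
      have p: "integrable lborel (\<lambda>x. complex_of_real (f x) * N n (x + a))" using intN[of n "- a"] by simp
      have "(LBINT x. complex_of_real (f x) * ((N n (x - a) + N n (x + a)) / 2)) = ((LBINT x. complex_of_real (f x) * N n (x - a)) + (LBINT x. complex_of_real (f x) * N n (x + a))) / 2"
        using intN[of n a] p by (simp add: algebra_simps add_divide_distrib)
      moreover have "(LBINT x. complex_of_real (f x) * ((N n (x - a) - N n (x + a)) / (2 * \<i>))) = ((LBINT x. complex_of_real (f x) * N n (x - a)) - (LBINT x. complex_of_real (f x) * N n (x + a))) / (2 * \<i>)"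
        using intN[of n a] p by (simp add: algebra_simps diff_divide_distrib)
      ultimately show ?thesis unfolding EC ES by (rule lin[symmetric])
    qed
    also have "\<dots> = (LBINT x. complex_of_real ((2 * pi) * (f x * normal_density 0 (\<epsilon> n) (x - a))))"
      by (simp add: N_def mult_ac)
    also have "\<dots> = complex_of_real (LBINT x. (2 * pi) * (f x * normal_density 0 (\<epsilon> n) (x - a)))"
      by (rule integral_complex_of_real)
    finally show ?thesis by (simp only: integral_mult_right_zero of_real_mult)
  qed
  have "(\<lambda>n. LBINT \<omega>. g \<omega> * (cis (a * \<omega>) * G n \<omega>)) \<longlonglongrightarrow> (LBINT \<omega>. g \<omega> * cis (a * \<omega>))"
  proof (rule integral_dominated_convergence[where w = "\<lambda>\<omega>. norm (g \<omega>)"])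
    show "AE \<omega> in lborel. (\<lambda>n. g \<omega> * (cis (a * \<omega>) * G n \<omega>)) \<longlonglongrightarrow> g \<omega> * cis (a * \<omega>)"
    proof (rule AE_I2)
      fix \<omega>
      have "(\<lambda>n. g \<omega> * (cis (a * \<omega>) * G n \<omega>)) \<longlonglongrightarrow> g \<omega> * (cis (a * \<omega>) * complex_of_real (exp (- (0\<^sup>2 / 2 * \<omega>\<^sup>2))))"
        unfolding G_def by (intro tendsto_intros \<epsilon>lim) simp
      then show "(\<lambda>n. g \<omega> * (cis (a * \<omega>) * G n \<omega>)) \<longlonglongrightarrow> g \<omega> * cis (a * \<omega>)" by simp
    qed
    show "AE \<omega> in lborel. norm (g \<omega> * (cis (a * \<omega>) * G n \<omega>)) \<le> norm (g \<omega>)" for n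
      using G1 by (auto simp: norm_mult intro!: mult_left_le)
  qed (use int in \<open>auto simp: cis_conv_exp\<close>)
  moreover have "(\<lambda>n. LBINT \<omega>. g \<omega> * (cis (a * \<omega>) * G n \<omega>)) \<longlonglongrightarrow> complex_of_real (2 * pi) * complex_of_real (f a)"
    unfolding key by (intro tendsto_intros integral_normal_density_tendsto[OF cont bdd \<epsilon>lim \<epsilon>0])
  ultimately have "(LBINT \<omega>. g \<omega> * cis (a * \<omega>)) = complex_of_real (2 * pi) * complex_of_real (f a)"
    by (rule LIMSEQ_unique)
  then show ?thesis by simp
qed

section \<open>Differentiability of Sobolev functions\<close>

lemma integrable_inverse_one_plus_square: "integrable lborel (\<lambda>x::real. inverse (1 + x\<^sup>2))"
proof -
  have "set_integrable lborel (einterval (-\<infinity>) \<infinity>) (\<lambda>x::real. inverse (1 + x\<^sup>2))"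
  proof (rule interval_integral_FTC_nonneg(1))
    show "((arctan \<circ> real_of_ereal) \<longlongrightarrow> - (pi / 2)) (at_right (- \<infinity>))"
      using tendsto_arctan_at_bot by (simp add: ereal_tendsto_simps)
    show "((arctan \<circ> real_of_ereal) \<longlongrightarrow> pi / 2) (at_left \<infinity>)"
      using tendsto_arctan_at_top by (simp add: ereal_tendsto_simps)
    show "(arctan has_real_derivative inverse (1 + x\<^sup>2)) (at x)" for x
      by (rule DERIV_arctan)
    show "isCont (\<lambda>x. inverse (1 + x\<^sup>2)) x" for x :: real
      by (intro continuous_intros) (simp add: add_nonneg_eq_0_iff)
  qed auto
  then show ?thesis by (simp add: set_integrable_def)
qed

text \<open>Put w = 1 + \<omega>^2 and c = |g|. For j <= 2 the weight |\<omega>|^j is at most w, and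
  w * c <= 1 / w + w^3 * c^2 by completing a square. The first term is integrable, the second is
  covered by the Sobolev norm because \<open>s \<ge> 3\<close>.\<close>

lemma integrable_weighted_fourier:
  fixes g :: "real \<Rightarrow> complex"
  assumes g [measurable]: "g \<in> borel_measurable borel" and "s \<ge> 3"
    and int: "integrable lborel (\<lambda>\<omega>. (1 + \<omega>\<^sup>2) powr s * (cmod (g \<omega>))\<^sup>2)" and "j \<le> 2"
  shows "integrable lborel (\<lambda>\<omega>. \<bar>\<omega>\<bar> ^ j * cmod (g \<omega>))"
proof (rule Bochner_Integration.integrable_bound)
  show "integrable lborel (\<lambda>\<omega>. inverse (1 + \<omega>\<^sup>2) + (1 + \<omega>\<^sup>2) powr s * (cmod (g \<omega>))\<^sup>2)"
    by (intro Bochner_Integration.integrable_add integrable_inverse_one_plus_square int)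
  show "AE \<omega> in lborel. norm (\<bar>\<omega>\<bar> ^ j * cmod (g \<omega>)) \<le> norm (inverse (1 + \<omega>\<^sup>2) + (1 + \<omega>\<^sup>2) powr s * (cmod (g \<omega>))\<^sup>2)"
  proof (rule AE_I2)
    fix \<omega> :: real
    define w where "w = 1 + \<omega>\<^sup>2"
    define c where "c = cmod (g \<omega>)"
    have w1: "w \<ge> 1" and c0: "c \<ge> 0" by (auto simp: w_def c_def)
    have j: "j = 0 \<or> j = 1 \<or> j = 2" using \<open>j \<le> 2\<close> by auto
    have "\<bar>\<omega>\<bar> \<le> w"
    proof (cases "\<bar>\<omega>\<bar> \<le> 1")
      case False
      then have "\<bar>\<omega>\<bar> * 1 \<le> \<bar>\<omega>\<bar> * \<bar>\<omega>\<bar>" by (intro mult_left_mono) auto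
      then show ?thesis by (simp add: w_def power2_eq_square)
    qed (simp add: w_def add_increasing2)
    then have "\<bar>\<omega>\<bar> ^ j \<le> w" using j w1 by (auto simp: w_def)
    then have "\<bar>\<omega>\<bar> ^ j * c \<le> w * c" using c0 by (rule mult_right_mono)
    also have "w * c \<le> inverse w + w ^ 3 * c\<^sup>2"
    proof -
      have "0 \<le> (1 - w\<^sup>2 * c)\<^sup>2 + w\<^sup>2 * c" using w1 c0 by (intro add_nonneg_nonneg) auto
      then have "w\<^sup>2 * c \<le> 1 + w ^ 4 * c\<^sup>2" by (simp add: power2_eq_square algebra_simps eval_nat_numeral)
      then show ?thesis using w1 by (simp add: field_simps eval_nat_numeral)
    qed
    also have "w ^ 3 \<le> w powr s"
    proof -
      have "w ^ 3 = w powr real 3" using w1 by (subst powr_realpow) auto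
      also have "\<dots> \<le> w powr s" using w1 \<open>s \<ge> 3\<close> by (intro powr_mono) auto
      finally show ?thesis .
    qed
    finally have "\<bar>\<omega>\<bar> ^ j * c \<le> inverse w + w powr s * c\<^sup>2" by (simp add: mult_right_mono)
    then show "norm (\<bar>\<omega>\<bar> ^ j * cmod (g \<omega>)) \<le> norm (inverse (1 + \<omega>\<^sup>2) + (1 + \<omega>\<^sup>2) powr s * (cmod (g \<omega>))\<^sup>2)"
      using c0 w1 by (simp add: w_def c_def)
  qed
qed measurable

text \<open>Integrability of \<omega>^2 * |g| allows the inversion integral to be differentiated
  once, with a derivative that is Lipschitz; the Taylor estimates \<open>cis1\<close> and
  \<open>cis2\<close> give both facts directly. Continuity of f turns the inversion formula into an
  identity at every point.\<close>

theorem sobolev_H_Lipschitz_derivative: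
  assumes "s \<ge> 3" and H: "f \<in> sobolev_H s" and cont: "continuous_on UNIV f" and bdd: "\<And>x. \<bar>f x\<bar> \<le> B"
  obtains D C where "\<And>x. (f has_real_derivative D x) (at x)" "\<And>x y. \<bar>D x - D y\<bar> \<le> C * \<bar>x - y\<bar>" "C \<ge> 0"
proof -
  from H obtain g where ft: "fourier_transform_of f g"
    and int: "integrable lborel (\<lambda>\<omega>. (1 + \<omega>\<^sup>2) powr s * (cmod (g \<omega>))\<^sup>2)"
    by (auto simp: sobolev_H_def)
  have g [measurable]: "g \<in> borel_measurable borel" using ft by (simp add: fourier_transform_of_def)
  note wt = integrable_weighted_fourier[OF g \<open>s \<ge> 3\<close> int]
  have int0: "integrable lborel g" using wt[of 0] by (simp add: integrable_norm_iff)
  have int1: "integrable lborel (\<lambda>\<omega>. \<i> * of_real \<omega> * g \<omega>)"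
    using wt[of 1] by (auto intro: Bochner_Integration.integrable_bound simp: norm_mult)
  have int2: "integrable lborel (\<lambda>\<omega>. \<omega>\<^sup>2 * cmod (g \<omega>))" using wt[of 2] by simp
  define K where "K = (LBINT \<omega>. \<omega>\<^sup>2 * cmod (g \<omega>))"
  have K0: "K \<ge> 0" unfolding K_def by (intro integral_nonneg_AE) auto
  define F where "F x = (LBINT \<omega>. g \<omega> * cis (x * \<omega>))" for x
  define F' where "F' x = (LBINT \<omega>. \<i> * of_real \<omega> * g \<omega> * cis (x * \<omega>))" for x
  have F: "F x = complex_of_real (2 * pi * f x)" for x
    unfolding F_def by (rule fourier_inversion[OF ft int0 cont bdd])
  have meas [measurable]: "(\<lambda>\<omega>. cis (x * \<omega>)) \<in> borel_measurable borel" for x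
    unfolding cis_conv_exp by measurable
  have iF: "integrable lborel (\<lambda>\<omega>. g \<omega> * cis (x * \<omega>))" for x
    by (rule Bochner_Integration.integrable_bound[OF int0]) (auto simp: norm_mult)
  have iF': "integrable lborel (\<lambda>\<omega>. \<i> * of_real \<omega> * g \<omega> * cis (x * \<omega>))" for x
    by (rule Bochner_Integration.integrable_bound[OF int1]) (auto simp: norm_mult)
  have cis1: "cmod (cis t - 1) \<le> \<bar>t\<bar>" for t
    using iexp_approx1[of t 0] by (simp add: cis_conv_exp)
  have cis2: "cmod (cis t - 1 - \<i> * of_real t) \<le> t\<^sup>2" for t
  proof -
    have "cmod (cis t - (1 + \<i> * of_real t)) \<le> \<bar>t\<bar>\<^sup>2 / 2"
      using iexp_approx1[of t 1] by (simp add: cis_conv_exp numeral_2_eq_2)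
    then have "cmod (cis t - 1 - \<i> * of_real t) \<le> t\<^sup>2 / 2" by (simp add: diff_diff_eq)
    also have "\<dots> \<le> t\<^sup>2" by simp
    finally show ?thesis .
  qed
  have E1: "cmod (F y - F x - of_real (y - x) * F' x) \<le> (y - x)\<^sup>2 * K" for x y
  proof -
    have "F y - F x - of_real (y - x) * F' x
        = (LBINT \<omega>. g \<omega> * cis (y * \<omega>) - g \<omega> * cis (x * \<omega>) - of_real (y - x) * (\<i> * of_real \<omega> * g \<omega> * cis (x * \<omega>)))"
      unfolding F_def F'_def using iF iF' by simp
    also have "cmod \<dots> \<le> (LBINT \<omega>. (y - x)\<^sup>2 * (\<omega>\<^sup>2 * cmod (g \<omega>)))"
    proof (rule Bochner_Integration.integral_norm_bound_integral)
      show "integrable lborel (\<lambda>\<omega>. (y - x)\<^sup>2 * (\<omega>\<^sup>2 * cmod (g \<omega>)))" using int2 by simp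
      fix \<omega> :: real
      have "cis (y * \<omega>) = cis (x * \<omega>) * cis ((y - x) * \<omega>)" by (simp add: cis_mult algebra_simps)
      then have "g \<omega> * cis (y * \<omega>) - g \<omega> * cis (x * \<omega>) - of_real (y - x) * (\<i> * of_real \<omega> * g \<omega> * cis (x * \<omega>))
        = g \<omega> * cis (x * \<omega>) * (cis ((y - x) * \<omega>) - 1 - \<i> * of_real ((y - x) * \<omega>))"
        by (simp add: algebra_simps)
      then show "cmod (g \<omega> * cis (y * \<omega>) - g \<omega> * cis (x * \<omega>) - of_real (y - x) * (\<i> * of_real \<omega> * g \<omega> * cis (x * \<omega>)))
         \<le> (y - x)\<^sup>2 * (\<omega>\<^sup>2 * cmod (g \<omega>))"
        using mult_left_mono[OF cis2[of "(y - x) * \<omega>"], of "cmod (g \<omega>)"]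
        by (simp add: norm_mult power_mult_distrib mult_ac)
    qed (use iF iF' in simp)
    finally show ?thesis by (simp add: K_def)
  qed
  have E2: "cmod (F' y - F' x) \<le> \<bar>y - x\<bar> * K" for x y
  proof -
    have "F' y - F' x = (LBINT \<omega>. \<i> * of_real \<omega> * g \<omega> * cis (y * \<omega>) - \<i> * of_real \<omega> * g \<omega> * cis (x * \<omega>))"
      unfolding F'_def using iF' by simp
    also have "cmod \<dots> \<le> (LBINT \<omega>. \<bar>y - x\<bar> * (\<omega>\<^sup>2 * cmod (g \<omega>)))"
    proof (rule Bochner_Integration.integral_norm_bound_integral)
      show "integrable lborel (\<lambda>\<omega>. \<bar>y - x\<bar> * (\<omega>\<^sup>2 * cmod (g \<omega>)))" using int2 by simp
      fix \<omega> :: real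
      have "cis (y * \<omega>) = cis (x * \<omega>) * cis ((y - x) * \<omega>)" by (simp add: cis_mult algebra_simps)
      then have "\<i> * of_real \<omega> * g \<omega> * cis (y * \<omega>) - \<i> * of_real \<omega> * g \<omega> * cis (x * \<omega>)
        = \<i> * of_real \<omega> * g \<omega> * cis (x * \<omega>) * (cis ((y - x) * \<omega>) - 1)"
        by (simp add: algebra_simps)
      then have "cmod (\<i> * of_real \<omega> * g \<omega> * cis (y * \<omega>) - \<i> * of_real \<omega> * g \<omega> * cis (x * \<omega>))
         = \<bar>\<omega>\<bar> * cmod (g \<omega>) * cmod (cis ((y - x) * \<omega>) - 1)"
        by (simp add: norm_mult)
      also have "\<dots> \<le> \<bar>\<omega>\<bar> * cmod (g \<omega>) * \<bar>(y - x) * \<omega>\<bar>"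
        by (intro mult_left_mono cis1) auto
      also have "\<dots> = \<bar>y - x\<bar> * (\<omega>\<^sup>2 * cmod (g \<omega>))"
      proof -
        have "\<omega>\<^sup>2 = \<bar>\<omega>\<bar> * \<bar>\<omega>\<bar>" by (simp add: power2_eq_square)
        then show ?thesis by (simp only: abs_mult mult_ac)
      qed
      finally show "cmod (\<i> * of_real \<omega> * g \<omega> * cis (y * \<omega>) - \<i> * of_real \<omega> * g \<omega> * cis (x * \<omega>)) \<le> \<bar>y - x\<bar> * (\<omega>\<^sup>2 * cmod (g \<omega>))" .
    qed (use iF' in simp)
    finally show ?thesis by (simp add: K_def)
  qed
  have abs_le: "\<bar>z\<bar> \<le> \<bar>2 * pi * z\<bar>" for z
    using pi_ge_two mult_right_mono[of 1 "2 * pi" "\<bar>z\<bar>"] by (simp add: abs_mult)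
  define D where "D x = Re (F' x) / (2 * pi)" for x
  have "(f has_real_derivative D x) (at x)" for x
  proof -
    have bound: "\<bar>f y - f x - (y - x) * D x\<bar> \<le> (y - x)\<^sup>2 * K" for y
    proof -
      have "2 * pi * (f y - f x - (y - x) * D x) = Re (F y - F x - of_real (y - x) * F' x)"
      proof -
        have "2 * pi * D x = Re (F' x)" by (simp add: D_def)
        then have "2 * pi * ((y - x) * D x) = (y - x) * Re (F' x)" by (metis mult.assoc mult.commute)
        then show ?thesis by (simp add: F right_diff_distrib)
      qed
      then have "\<bar>2 * pi * (f y - f x - (y - x) * D x)\<bar> \<le> (y - x)\<^sup>2 * K"
        using E1[of y x] abs_Re_le_cmod order_trans by metis
      then show ?thesis by (rule order_trans[OF abs_le])
    qed
    have "((\<lambda>y. (f y - f x) / (y - x) - D x) \<longlongrightarrow> 0) (at x)"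
    proof (rule tendsto_rabs_zero_cancel, rule tendsto_sandwich[where f = "\<lambda>_. 0" and h = "\<lambda>y. \<bar>y - x\<bar> * K"])
      show "\<forall>\<^sub>F y in at x. \<bar>(f y - f x) / (y - x) - D x\<bar> \<le> \<bar>y - x\<bar> * K"
      proof (rule eventually_mono[OF eventually_neq_at_within[of x]])
        fix y assume "y \<noteq> x"
        then have "\<bar>(f y - f x) / (y - x) - D x\<bar> = \<bar>f y - f x - (y - x) * D x\<bar> / \<bar>y - x\<bar>"
          by (simp add: field_simps flip: abs_divide)
        also have "\<dots> \<le> (y - x)\<^sup>2 * K / \<bar>y - x\<bar>"
          by (intro divide_right_mono bound) auto
        also have "\<dots> = \<bar>y - x\<bar> * K"
          using \<open>y \<noteq> x\<close> by (cases "y < x") (simp_all add: power2_eq_square divide_simps algebra_simps)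
        finally show "\<bar>(f y - f x) / (y - x) - D x\<bar> \<le> \<bar>y - x\<bar> * K" .
      qed
      have "((\<lambda>y. \<bar>y - x\<bar> * K) \<longlongrightarrow> \<bar>x - x\<bar> * K) (at x)" by (intro tendsto_intros)
      then show "((\<lambda>y. \<bar>y - x\<bar> * K) \<longlongrightarrow> 0) (at x)" by simp
    qed simp_all
    then have "((\<lambda>y. (f y - f x) / (y - x)) \<longlongrightarrow> D x) (at x)" by (simp add: LIM_zero_iff)
    then show ?thesis by (simp add: has_field_derivative_iff)
  qed
  moreover have "\<bar>D x - D y\<bar> \<le> K * \<bar>x - y\<bar>" for x y
  proof -
    have "2 * pi * (D x - D y) = Re (F' x - F' y)" by (simp add: D_def algebra_simps)
    then have "\<bar>2 * pi * (D x - D y)\<bar> \<le> \<bar>x - y\<bar> * K"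
      using E2[of x y] abs_Re_le_cmod order_trans by metis
    then have "\<bar>D x - D y\<bar> \<le> \<bar>x - y\<bar> * K" by (rule order_trans[OF abs_le])
    then show ?thesis by (simp add: mult.commute)
  qed
  ultimately show thesis by (rule that[of D K, OF _ _ K0])
qed

text \<open>Membership in \<open>sobolev_H\<close> does not depend on null sets, and continuity
  selects the representative whose derivative is meant. The measures \<nu> are determined only for
  almost every time, hence the \<open>AE\<close>. The value \<infinity> of 1 / 0 in
  \<open>ereal\<close> covers a datum with vanishing slope.\<close>

theorem proposition7p8:
  fixes s :: real
    and u0 :: "real \<Rightarrow> real"
    and U :: "real \<Rightarrow> real \<Rightarrow> real \<Rightarrow> real"
    and L :: "nat \<Rightarrow> real"
    and u :: "real \<Rightarrow> real \<Rightarrow> real"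
    and \<nu> :: "real \<Rightarrow> real measure"
  assumes "s \<ge> 3"
    and "u0 \<in> sobolev_H s \<inter> BV" and "continuous_on UNIV u0"
    and "\<forall>l>0. dissipative_solution l u0 (U l)"
    and "\<forall>k. L k > 0" and "filterlim L at_top sequentially"
    and "Linf_BV u" and "Linf_measure \<nu>"
    and "converges_C_L1loc (\<lambda>k. U (L k)) u"
    and "converges_weakly_measure (\<lambda>k t x. (deriv (U (L k) t) x)\<^sup>2 / 2) \<nu>"
    and "burgers_x_equation u \<nu>"
  shows "AE t in lborel. 0 \<le> t \<and> ereal t < 1 / (SUP x. ereal \<bar>deriv u0 x\<bar>) \<longrightarrow>
           (\<exists>ux. has_weak_derivative (u t) ux \<and>
                 \<nu> t = density lborel (\<lambda>x. ennreal ((ux x)\<^sup>2 / 2)))"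
proof -
  define S where "S = (SUP x. ereal \<bar>deriv u0 x\<bar>)"
  have S_upper: "ereal \<bar>deriv u0 x\<bar> \<le> S" for x unfolding S_def by (rule SUP_upper) simp
  show ?thesis
  proof (cases "S = \<infinity>")
    case True
    \<comment> \<open>\<open>1 / \<infinity> = 0\<close>, so there is no admissible time.\<close>
    then show ?thesis unfolding S_def[symmetric] by (intro AE_I2) auto
  next
    case False
    moreover have "S \<noteq> - \<infinity>" using S_upper[of 0] by auto
    ultimately obtain M where M: "S = ereal M" by (cases S) auto
    have D_le: "\<bar>deriv u0 x\<bar> \<le> M" for x using S_upper[of x] by (simp add: M)
    obtain B where B: "\<And>x. \<bar>u0 x\<bar> \<le> B" using BV_bounded[of u0] assms(2) by auto
    obtain D \<Lambda> where D: "\<And>x. (u0 has_real_derivative D x) (at x)" and D_lip: "\<And>x y. \<bar>D x - D y\<bar> \<le> \<Lambda> * \<bar>x - y\<bar>"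
    proof (rule sobolev_H_Lipschitz_derivative[OF assms(1) _ assms(3) B])
      show "u0 \<in> sobolev_H s" using assms(2) by simp
    qed (rule that; assumption)
    have D_bound: "\<bar>D x\<bar> \<le> M" for x using D_le[of x] DERIV_imp_deriv[OF D[of x]] by simp
    obtain V where V: "total_variation u0 \<le> ennreal V" "V \<ge> 0"
      using assms(2) unfolding BV_def by (cases "total_variation u0" rule: ennreal_cases) auto
    let ?Q = "\<lambda>t. \<exists>ux. has_weak_derivative (u t) ux \<and> \<nu> t = density lborel (\<lambda>x. ennreal ((ux x)\<^sup>2 / 2))"
    have main: "AE t in lborel. t \<in> {0..T} \<longrightarrow> ?Q t" if T: "T > 0" "M * T < 1" for T
    proof -
      obtain l0 C where l0: "\<And>l w t. l \<ge> l0 \<Longrightarrow> dissipative_solution l u0 w \<Longrightarrow> t \<in> {0..T} \<Longrightarrow>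
        \<exists>d. (\<forall>x. (w t has_real_derivative d x) (at x)) \<and> (\<forall>x. \<bar>d x\<bar> \<le> C) \<and> (\<forall>x y. \<bar>d x - d y\<bar> \<le> C * \<bar>x - y\<bar>)"
        by (rule dissipative_solution_derivative_bounds[OF D D_bound D_lip V T]) (rule that; assumption)
      \<comment> \<open>The bounds are available only for large \<open>l\<close>. Dropping finitely
        many members of the sequence changes neither limit.\<close>
      have "\<forall>\<^sub>F k in sequentially. L k \<ge> l0" using assms(6) by (simp add: filterlim_at_top)
      then obtain k0 where k0: "\<And>k. k \<ge> k0 \<Longrightarrow> L k \<ge> l0" by (auto simp: eventually_sequentially)
      define w where "w k = U (L (k + k0))" for k
      have "gradient_limit w (\<lambda>k t. deriv (w k t)) u \<nu> T C"
      proof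
        fix k t x y assume t: "t \<in> {0..T}"
        have "dissipative_solution (L (k + k0)) u0 (w k)" using assms(4,5) by (simp add: w_def)
        from l0[OF k0 this t] obtain d where d: "\<And>x. (w k t has_real_derivative d x) (at x)"
          "\<And>x. \<bar>d x\<bar> \<le> C" "\<And>x y. \<bar>d x - d y\<bar> \<le> C * \<bar>x - y\<bar>" by auto
        have eq: "deriv (w k t) = d" using d(1) by (auto intro: DERIV_imp_deriv)
        show "(w k t has_real_derivative deriv (w k t) x) (at x)" "\<bar>deriv (w k t) x\<bar> \<le> C"
          "\<bar>deriv (w k t) x - deriv (w k t) y\<bar> \<le> C * \<bar>x - y\<bar>"
          unfolding eq by (rule d)+
      next
        show "converges_C_L1loc w u"
          unfolding converges_C_L1loc_def
        proof (intro conjI allI impI)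
          show "C_L1loc (w k)" for k using assms(9) by (simp add: converges_C_L1loc_def w_def)
          show "C_L1loc u" using assms(9) by (simp add: converges_C_L1loc_def)
          fix T a b :: real assume "T > 0"
          then have "uniform_limit {0..T} (\<lambda>k t. LBINT x:{a..b}. \<bar>U (L k) t x - u t x\<bar>) (\<lambda>t. 0) sequentially"
            using assms(9) by (simp add: converges_C_L1loc_def)
          from filterlim_compose[OF this filterlim_add_const_nat_at_top[of k0]]
          show "uniform_limit {0..T} (\<lambda>k t. LBINT x:{a..b}. \<bar>w k t x - u t x\<bar>) (\<lambda>t. 0) sequentially"
            by (simp only: w_def)
        qed
        show "converges_weakly_measure (\<lambda>k t x. (deriv (w k t) x)\<^sup>2 / 2) \<nu>"
          unfolding converges_weakly_measure_def
        proof (intro allI impI)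
          fix \<phi> :: "real \<times> real \<Rightarrow> real" assume "continuous_on UNIV \<phi> \<and> compactly_supported \<phi>"
          then have "(\<lambda>k. LBINT t:{0..}. (LBINT x. \<phi> (t, x) * ((deriv (U (L k) t) x)\<^sup>2 / 2)))
              \<longlonglongrightarrow> (LBINT t:{0..}. (\<integral>x. \<phi> (t, x) \<partial>(\<nu> t)))"
            using assms(10) by (simp add: converges_weakly_measure_def)
          from LIMSEQ_ignore_initial_segment[OF this, of k0]
          show "(\<lambda>k. LBINT t:{0..}. (LBINT x. \<phi> (t, x) * ((deriv (w k t) x)\<^sup>2 / 2)))
              \<longlonglongrightarrow> (LBINT t:{0..}. (\<integral>x. \<phi> (t, x) \<partial>(\<nu> t)))"
            by (simp only: w_def)
        qed
      qed (use T assms(8) in auto)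
      then interpret gradient_limit w "\<lambda>k t. deriv (w k t)" u \<nu> T C .
      show ?thesis
        using AE_measure_eq by eventually_elim (use has_weak_derivative_g in blast)
    qed
    \<comment> \<open>The null sets for the single T are united over the rational T only; these
      suffice because the set of admissible times has no largest element.\<close>
    have "AE t in lborel. \<forall>T\<in>{T \<in> \<rat>. T > 0 \<and> M * T < 1}. t \<in> {0..T} \<longrightarrow> ?Q t"
    proof (subst AE_ball_countable)
      show "countable {T \<in> \<rat>. T > 0 \<and> M * T < 1}"
        by (rule countable_subset[OF _ countable_rat]) auto
    qed (use main in auto)
    then show ?thesis
    proof (eventually_elim, intro impI)
      case (elim t)
      assume t: "0 \<le> t \<and> ereal t < 1 / (SUP x. ereal \<bar>deriv u0 x\<bar>)"
      then have t': "ereal t < 1 / ereal M" by (simp add: S_def[symmetric] M)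
      have M0: "M \<ge> 0" using D_bound[of 0] by linarith
      have "\<exists>T\<in>\<rat>. t < T \<and> M * T < 1"
      proof (cases "M = 0")
        case True
        \<comment> \<open>For \<open>M = 0\<close> every time is admissible, and any rational beyond
          t will do.\<close>
        then show ?thesis using Rats_dense_in_real[of t "t + 1"] by auto
      next
        case False
        then have Mpos: "M > 0" using M0 by simp
        have "t < 1 / M" using t' False by (simp add: one_ereal_def)
        then obtain T where "T \<in> \<rat>" "t < T" "T < 1 / M" using Rats_dense_in_real by blast
        then show ?thesis using Mpos by (auto simp: field_simps)
      qed
      then obtain T where "T \<in> \<rat>" "t < T" "M * T < 1" by blast
      then show "?Q t" using elim t by (intro elim[rule_format, of T]) auto
    qed
  qed
qed

end
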